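(* Let $k\ge 1$, let $h=1/n$ with $n$ a positive integer, let $t:=kh\le 1$, let $\gamma$ be a real number with $0<|\gamma|\le\frac16$, and let $f\in L^2(0,1)$. Let $u\in H^2(0,1)$ be the solution of $$u''+k^2u=-f \text{ in } (0,1),\qquad u(0)=0,\qquad u'(1)-\mathbf{i}ku(1)=0,$$ and let $u_h\in V_h$ be the solution of the continuous interior penalty finite element method $a_h(u_h,v_h)=(f,v_h)$ for all $v_h\in V_h$. Then $$\|u-u_h\|_{1,h}\lesssim (kh+|k_h^--k|)\,\|f\|\lesssim (kh+k^3h^2)\,\|f\|.$$ If, furthermore, $\gamma=-\frac1{12}$, then $$\|u-u_h\|_{1,h}\lesssim (kh+k^5h^4)\,\|f\|.$$ If, furthermore, $|\gamma-\gamma_o|\lesssim \frac{1}{k^2h}$, where $$\gamma_o=\frac{6\cos t-6+t^2\cos t+2t^2}{12(1-\cos t)^2},$$ then $$\|u-u_h\|_{1,h}\lesssim kh\,\|f\|.$$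
   Context: Here $A\lesssim B$ means $A\le CB$ with a generic positive constant $C$ independent of $k$, $h$ and $f$. All functions are complex-valued, $\mathbf{i}$ is the imaginary unit, $(v,w)=\int_0^1 v\bar w\,dx$ and $\|w\|=(w,w)^{1/2}$. The boundary value problem has a unique solution $u\in H^2(0,1)$. Mesh: $x_j=j/n=jh$, $0\le j\le n$, $K_j=(x_{j-1},x_j)$. For a function $v$ with one-sided limits at an interior node $x_j$ ($1\le j\le n-1$), the jump is $[v]_j:=v(x_j-)-v(x_j+)$. $V_h$ is the space of continuous functions on $[0,1]$ that are linear on each $K_j$ and vanish at $x=0$. For $u,v\in H^1(0,1)$ that vanish at $0$ and are $H^2$ on each $K_j$, $$a_h(u,v):=(u',v')-k^2(u,v)-\mathbf{i}k\,u(1)\bar v(1)+J(u,v),$$ $$J(u,v):=\sum_{j=1}^{n-1}\gamma h\,[u']_j[\bar v']_j+\gamma h\,\bigl(u'(1)-\mathbf{i}k\,u(1)\bigr)\bigl(\bar v'(1)-\mathbf{i}k\,\bar v(1)\bigr),$$ $$\|v\|_{1,h}:=\Bigl(\|v'\|^2+\sum_{j=1}^{n-1}|\gamma|\,h\,|[v']_j|^2\Bigr)^{1/2}.$$ Discrete wave number: $k_h^-:=t_h^-/h$, where $t_h^-\in(0,\pi/2)$ is determined by $$\cos t_h^-=\frac{4\gamma+1+\frac{t^2}{6}-\sqrt{\left(1+\frac{t^2}{6}\right)^2+4\gamma t^2}}{4\gamma}.$$ *)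

theory Defs
  imports "HOL-Analysis.Analysis"
begin

definition L2 :: "(real \<Rightarrow> complex) set" where
  "L2 = {v. v \<in> borel_measurable (lebesgue_on {0<..<1}) \<and>
            integrable (lebesgue_on {0<..<1}) (\<lambda>x. (norm (v x))\<^sup>2)}"

definition L2_inner :: "(real \<Rightarrow> complex) \<Rightarrow> (real \<Rightarrow> complex) \<Rightarrow> complex" where
  "L2_inner v w = (LINT x|lebesgue_on {0<..<1}. v x * cnj (w x))"

definition L2_norm :: "(real \<Rightarrow> complex) \<Rightarrow> real" where
  "L2_norm w = sqrt (Re (L2_inner w w))"

definition test_function :: "(real \<Rightarrow> complex) \<Rightarrow> bool" where
  "test_function \<phi> \<longleftrightarrow> \<phi> C1_differentiable_on UNIV \<and> closure {x. \<phi> x \<noteq> 0} \<subseteq> {0<..<1}"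

text \<open>
  Weak derivatives on \<open>(0,1)\<close>, tested against \<open>C\<^sup>1\<close> functions with compact support in \<open>(0,1)\<close>
  (as in Brezis' textbook).
\<close>

definition has_weak_derivative :: "(real \<Rightarrow> complex) \<Rightarrow> (real \<Rightarrow> complex) \<Rightarrow> bool" where
  "has_weak_derivative v g \<longleftrightarrow>
     (\<forall>\<phi>. test_function \<phi> \<longrightarrow>
        (LINT x|lebesgue_on {0<..<1}. v x * vector_derivative \<phi> (at x)) =
        - (LINT x|lebesgue_on {0<..<1}. g x * \<phi> x))"

text \<open>
  \<open>H2_derivatives u u1 u2\<close>: \<open>u\<close> is in \<open>H\<^sup>2(0,1)\<close>, with first and second weak derivatives
  \<open>u1\<close> and \<open>u2\<close>.
\<close>

definition H2_derivatives ::
    "(real \<Rightarrow> complex) \<Rightarrow> (real \<Rightarrow> complex) \<Rightarrow> (real \<Rightarrow> complex) \<Rightarrow> bool" where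
  "H2_derivatives u u1 u2 \<longleftrightarrow>
     u \<in> L2 \<and> u1 \<in> L2 \<and> u2 \<in> L2 \<and> has_weak_derivative u u1 \<and> has_weak_derivative u1 u2"

text \<open>
  A continuous function on \<open>[0,1]\<close> that is \<open>H\<^sup>2\<close> on each element is \<open>C\<^sup>1\<close> on each open element, with
  one-sided limits of the derivative at the nodes. Its weak derivative is therefore represented
  by the classical derivative off the (finitely many) nodes, and the traces of the derivative
  at the nodes are the one-sided limits of the classical one.
\<close>

definition D :: "(real \<Rightarrow> complex) \<Rightarrow> real \<Rightarrow> complex" where
  "D v x = vector_derivative v (at x)"

definition left_limit :: "(real \<Rightarrow> complex) \<Rightarrow> real \<Rightarrow> complex" where
  "left_limit v x = Lim (at_left x) v"

definition right_limit :: "(real \<Rightarrow> complex) \<Rightarrow> real \<Rightarrow> complex" where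
  "right_limit v x = Lim (at_right x) v"

definition node :: "nat \<Rightarrow> nat \<Rightarrow> real" where
  "node n j = real j / real n"

definition jump :: "nat \<Rightarrow> (real \<Rightarrow> complex) \<Rightarrow> nat \<Rightarrow> complex" where
  "jump n v j = left_limit v (node n j) - right_limit v (node n j)"

text \<open>
  \<open>u\<close> is taken to be the continuous representative on \<open>[0,1]\<close> of its class, so that \<open>u 0\<close>, \<open>u 1\<close>
  are the traces.
\<close>

definition bvp_solution :: "real \<Rightarrow> (real \<Rightarrow> complex) \<Rightarrow> (real \<Rightarrow> complex) \<Rightarrow> bool" where
  "bvp_solution k f u \<longleftrightarrow>
     continuous_on {0..1} u \<and>
     (\<exists>u1 u2. H2_derivatives u u1 u2 \<and>
        (AE x in lebesgue_on {0<..<1}. u2 x + (of_real k)\<^sup>2 * u x = - f x)) \<and>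
     u 0 = 0 \<and>
     left_limit (D u) 1 - \<i> * of_real k * u 1 = 0"

definition V :: "nat \<Rightarrow> (real \<Rightarrow> complex) set" where
  "V n = {v. continuous_on {0..1} v \<and> v 0 = 0 \<and>
             (\<forall>j\<in>{1..n}. \<exists>a b. \<forall>x\<in>{node n (j - 1)<..<node n j}. v x = a + b * of_real x)}"

text \<open>The penalty form is not Hermitian: in its last term \<open>v\<close> enters through
  \<open>cnj v'(1) - \<i>k cnj v(1)\<close>, which is not the conjugate of \<open>v'(1) - \<i>k v(1)\<close>.\<close>

definition J :: "nat \<Rightarrow> real \<Rightarrow> real \<Rightarrow> (real \<Rightarrow> complex) \<Rightarrow> (real \<Rightarrow> complex) \<Rightarrow> complex" where
  "J n \<gamma> k u v =
     (let h = 1 / real n in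
       (\<Sum>j\<in>{1..<n}. of_real (\<gamma> * h) * jump n (D u) j * cnj (jump n (D v) j)) +
       of_real (\<gamma> * h) *
         (left_limit (D u) 1 - \<i> * of_real k * u 1) *
         (cnj (left_limit (D v) 1) - \<i> * of_real k * cnj (v 1)))"

definition a_form :: "nat \<Rightarrow> real \<Rightarrow> real \<Rightarrow> (real \<Rightarrow> complex) \<Rightarrow> (real \<Rightarrow> complex) \<Rightarrow> complex" where
  "a_form n \<gamma> k u v =
     L2_inner (D u) (D v) - (of_real k)\<^sup>2 * L2_inner u v
     - \<i> * of_real k * u 1 * cnj (v 1) + J n \<gamma> k u v"

definition cip_solution ::
    "nat \<Rightarrow> real \<Rightarrow> real \<Rightarrow> (real \<Rightarrow> complex) \<Rightarrow> (real \<Rightarrow> complex) \<Rightarrow> bool" where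
  "cip_solution n \<gamma> k f uh \<longleftrightarrow> uh \<in> V n \<and> (\<forall>vh\<in>V n. a_form n \<gamma> k uh vh = L2_inner f vh)"

definition norm_1h :: "nat \<Rightarrow> real \<Rightarrow> (real \<Rightarrow> complex) \<Rightarrow> real" where
  "norm_1h n \<gamma> v =
     (let h = 1 / real n in
       sqrt ((L2_norm (D v))\<^sup>2 + (\<Sum>j\<in>{1..<n}. \<bar>\<gamma>\<bar> * h * (norm (jump n (D v) j))\<^sup>2)))"

definition t_minus :: "real \<Rightarrow> real \<Rightarrow> real" where
  "t_minus \<gamma> t =
     (THE s. 0 < s \<and> s < pi / 2 \<and>
        cos s = (4 * \<gamma> + 1 + t\<^sup>2 / 6 - sqrt ((1 + t\<^sup>2 / 6)\<^sup>2 + 4 * \<gamma> * t\<^sup>2)) / (4 * \<gamma>))"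

definition k_minus :: "real \<Rightarrow> real \<Rightarrow> real \<Rightarrow> real" where
  "k_minus \<gamma> k h = t_minus \<gamma> (k * h) / h"

definition gamma_o :: "real \<Rightarrow> real" where
  "gamma_o t = (6 * cos t - 6 + t\<^sup>2 * cos t + 2 * t\<^sup>2) / (12 * (1 - cos t)\<^sup>2)"

end

theory Submission
  imports Defs
begin

text \<open>
  In terms of the nodal values \<open>U\<close> of \<open>u\<^sub>h\<close> and their second differences \<open>E\<close>, the method is a
  fourth-order recurrence with symbol \<open>\<gamma>(\<delta>\<^sup>2 + \<alpha>)(\<delta>\<^sup>2 + \<beta>)\<close>, where \<open>\<alpha> = 2 - 2 cos t\<^sub>h\<^sup>-\<close> and \<open>\<bar>\<beta>\<bar> \<ge> 6\<close>.
  Then \<open>W = E + \<alpha>U\<close> solves a diagonally dominant second-order recurrence and is negligible, while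
  \<open>Y = U + E/\<beta>\<close> solves one whose homogeneous solutions are exact waves of wave number \<open>k\<^sub>h\<^sup>-\<close>. Variation
  of constants writes the difference quotients of \<open>Y\<close> as sums over the loads with kernel
  \<open>cos (k\<^sub>h\<^sup>-(x - y))\<close>, just as \<open>u'\<close> is an integral of \<open>f\<close> with kernel \<open>cos (k(x - y))\<close>; comparing the two
  formulas on each element gives the error \<open>O(kh + \<bar>k\<^sub>h\<^sup>- - k\<bar>)\<close>. The other bounds are Taylor estimates of
  \<open>\<bar>t\<^sub>h\<^sup>- - t\<bar>\<close>: inserting \<open>2 - 2 cos t\<close> into the quadratic equation for \<open>\<alpha>\<close> leaves the residual
  \<open>4(\<gamma> - \<gamma>\<^sub>o)(1 - cos t)\<^sup>2\<close>.
\<close>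

section \<open>Integration by parts and the fundamental lemma\<close>

text \<open>The constants must be uniform in k, where coercivity is of no help, and in \<gamma>,
  which may have either sign and tend to 0. Explicit formulas with kernels of bounded modulus give
  the first: only the L1 norm of f and its masses on single elements enter. For the second, the
  equation for W contains the factor \<open>1 / \<bar>\<gamma>\<bar> = \<bar>\<beta>\<bar> *
  (\<alpha> / t\<^sup>2)\<close>, so what dividing by \<gamma> costs is regained from the diagonal
  entry \<beta>; and \<bar>\<gamma>\<bar> \<le> 1/6 is what yields \<alpha> \<le> t^2 and hence
  \<bar>\<beta>\<bar> \<ge> 6. The obstacle is the row at x = 1. Its test function is half a hat, so
  the factorization leaves a term in \<open>U n\<close>, which couples Y and W again. This row also
  has to fix the amplitude of the wave: it is a discrete outgoing condition, met by the wave up to a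
  defect of order t^3 times \<open>Y n\<close>. In turn \<open>Y n\<close> is bounded only after
  division by sin s, which is of order t. The resulting loop closes because its gain is numerically
  below 1, which is why explicit fractions are carried through the stability estimates.\<close>

lemma absolutely_integrable_continuous_mult:
  fixes f g :: "real \<Rightarrow> complex"
  assumes "f absolutely_integrable_on {a..b}" "continuous_on {a..b} g"
  shows "(\<lambda>x. g x * f x) absolutely_integrable_on {a..b}"
proof (rule absolutely_integrable_bounded_measurable_product[where h = "(*)", OF _ _ _ _ assms(1)])
  show "bilinear ((*) :: complex \<Rightarrow> complex \<Rightarrow> complex)"
    by (simp add: bilinear_times)
  show "g \<in> borel_measurable (lebesgue_on {a..b})"
    by (simp add: assms(2) continuous_imp_measurable_on_sets_lebesgue)
  show "bounded (g ` {a..b})"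
    using assms(2) compact_Icc compact_continuous_image compact_imp_bounded by blast
qed auto

lemma integral_diff_initial:
  fixes \<phi> :: "real \<Rightarrow> 'a::banach"
  assumes "\<phi> integrable_on {a..b}" "a \<le> y" "y \<le> z" "z \<le> b"
  shows "integral {a..z} \<phi> - integral {a..y} \<phi> = integral {y..z} \<phi>"
proof -
  have "\<phi> integrable_on {a..z}" using assms by (auto intro: integrable_on_subinterval)
  then show ?thesis
    using Henstock_Kurzweil_Integration.integral_combine[of a y z \<phi>] assms by (simp add: algebra_simps)
qed

text \<open>For merely integrable \<open>f\<close> the product rule is not available pointwise; instead the difference
  of the two sides varies by \<open>O(\<bar>y - x\<bar> \<integral>\<^sub>x\<^sup>y \<bar>f\<bar>)\<close> between \<open>x\<close> and \<open>y\<close>,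
  so its derivative vanishes.\<close>

lemma integral_by_parts_absolutely_integrable:
  fixes f g g' :: "real \<Rightarrow> complex"
  assumes f: "f absolutely_integrable_on {a..b}"
    and g: "\<And>x. x \<in> {a..b} \<Longrightarrow> (g has_vector_derivative g' x) (at x within {a..b})"
    and g': "continuous_on {a..b} g'"
    and x: "x \<in> {a..b}"
  shows "integral {a..x} (\<lambda>y. g y * f y)
    = g x * integral {a..x} f - integral {a..x} (\<lambda>y. g' y * integral {a..y} f)"
proof -
  define F where "F x = integral {a..x} f" for x
  define A where "A x = integral {a..x} (\<lambda>y. norm (f y))" for x
  define \<Phi> where "\<Phi> x = g x * F x - integral {a..x} (\<lambda>y. g' y * F y)
      - integral {a..x} (\<lambda>y. g y * f y)" for x
  have gc: "continuous_on {a..b} g"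
    using g by (meson continuous_on_eq_continuous_within has_vector_derivative_continuous)
  have fi: "f integrable_on {a..b}" and nfi: "(\<lambda>y. norm (f y)) integrable_on {a..b}"
    using f by (auto simp: absolutely_integrable_on_def)
  have Fc: "continuous_on {a..b} F" and Ac: "continuous_on {a..b} A"
    unfolding F_def A_def by (intro indefinite_integral_continuous_1 fi nfi)+
  have gfi: "(\<lambda>y. g y * f y) integrable_on {a..b}"
    using absolutely_integrable_continuous_mult[OF f gc] by (simp add: absolutely_integrable_on_def)
  have gFi: "(\<lambda>y. g' y * F y) integrable_on {a..b}"
    by (intro integrable_continuous_real continuous_intros g' Fc)
  obtain M where M: "M > 0" "\<And>y. y \<in> {a..b} \<Longrightarrow> norm (g' y) \<le> M"
    using compact_continuous_image[OF g' compact_Icc, THEN compact_imp_bounded]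
    unfolding bounded_pos by auto
  have gb: "norm (g z - g y) \<le> M * (z - y)" if "a \<le> y" "y \<le> z" "z \<le> b" for y z
  proof -
    have "(g' has_integral g z - g y) {y..z}"
      by (rule fundamental_theorem_of_calculus)
        (use that in \<open>auto intro!: has_vector_derivative_within_subset[OF g]\<close>)
    then show ?thesis
      using has_integral_bound_real[of M "{}" g' "g z - g y" y z] M that by auto
  qed
  have key: "norm (\<Phi> z - \<Phi> y) \<le> 2 * M * (z - y) * (A z - A y)" if yz: "a \<le> y" "y \<le> z" "z \<le> b" for y z
  proof -
    have sub: "{y..z} \<subseteq> {a..b}" using yz by auto
    have f': "f integrable_on {y..z}" and nf': "(\<lambda>y. norm (f y)) integrable_on {y..z}"
      and gf': "(\<lambda>y. g y * f y) integrable_on {y..z}"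
      and gF': "(\<lambda>y. g' y * F y) integrable_on {y..z}"
      and g'': "g' integrable_on {y..z}"
      using sub fi nfi gfi gFi integrable_continuous_real[OF g'] integrable_on_subinterval by blast+
    have AA: "A z - A y = integral {y..z} (\<lambda>y. norm (f y))"
      using integral_diff_initial[OF nfi yz] by (simp add: A_def)
    have FF: "F z - F w = integral {w..z} f" if "w \<in> {y..z}" for w
      using integral_diff_initial[OF fi, of w z] yz that by (simp add: F_def)
    have FFb: "norm (F z - F w) \<le> A z - A y" if "w \<in> {y..z}" for w
    proof -
      have "norm (F z - F w) \<le> integral {w..z} (\<lambda>y. norm (f y))"
        unfolding FF[OF that]
        by (rule integral_norm_bound_integral)
          (use that in \<open>auto intro!: integrable_on_subinterval[OF f'] integrable_on_subinterval[OF nf']\<close>)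
      also have "\<dots> \<le> integral {y..z} (\<lambda>y. norm (f y))"
        by (rule integral_subset_le)
          (use that nf' in \<open>auto intro!: integrable_on_subinterval[OF nf']\<close>)
      finally show ?thesis by (simp add: AA)
    qed
    have "(g' has_integral g z - g y) {y..z}"
      by (rule fundamental_theorem_of_calculus)
        (use yz in \<open>auto intro!: has_vector_derivative_within_subset[OF g]\<close>)
    then have gi: "g z - g y = integral {y..z} g'" by (simp add: integral_unique)
    have i1: "((\<lambda>w. g' w * (F z - F w)) has_integral
        (g z - g y) * F z - integral {y..z} (\<lambda>y. g' y * F y)) {y..z}"
      unfolding right_diff_distrib gi
      by (intro has_integral_diff has_integral_mult_left integrable_integral gF' g'')
    have i2: "((\<lambda>w. (g w - g y) * f w) has_integral
        integral {y..z} (\<lambda>y. g y * f y) - g y * (F z - F y)) {y..z}"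
      unfolding left_diff_distrib using FF[of y] yz
      by (auto intro!: has_integral_diff has_integral_mult_right integrable_integral gf' f')
    \<comment> \<open>Each integrand on the right is an increment times an integrable factor: the
      difference is of second order although the indefinite integral of f is never
      differentiated.\<close>
    have "\<Phi> z - \<Phi> y = integral {y..z} (\<lambda>w. g' w * (F z - F w)) - integral {y..z} (\<lambda>w. (g w - g y) * f w)"
      unfolding integral_unique[OF i1] integral_unique[OF i2] \<Phi>_def
      using integral_diff_initial[OF gFi yz] integral_diff_initial[OF gfi yz] by (simp add: algebra_simps)
    moreover have "norm (integral {y..z} (\<lambda>w. g' w * (F z - F w))) \<le> M * (A z - A y) * (z - y)"
    proof -
      have "norm (g' w * (F z - F w)) \<le> M * (A z - A y)" if "w \<in> {y..z}" for w
        unfolding norm_mult by (intro mult_mono M FFb that) (use M that sub in auto)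
      moreover have "0 \<le> M * (A z - A y)"
        using FFb[of z] M(1) yz norm_ge_zero[of "F z - F z"] by (intro mult_nonneg_nonneg) auto
      ultimately show ?thesis
        using has_integral_bound_real[of "M * (A z - A y)" "{}", OF _ _ i1] yz unfolding integral_unique[OF i1]
        by auto
    qed
    moreover have "norm (integral {y..z} (\<lambda>w. (g w - g y) * f w)) \<le> M * (z - y) * (A z - A y)"
    proof -
      have "norm (integral {y..z} (\<lambda>w. (g w - g y) * f w))
          \<le> integral {y..z} (\<lambda>w. M * (z - y) * norm (f w))"
      proof (rule integral_norm_bound_integral)
        show "(\<lambda>w. (g w - g y) * f w) integrable_on {y..z}" using i2 by blast
        show "(\<lambda>w. M * (z - y) * norm (f w)) integrable_on {y..z}"
          using integrable_on_cmult_left[OF nf', of "M * (z - y)"] by simp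
        fix w assume w: "w \<in> {y..z}"
        have "norm (g w - g y) \<le> M * (w - y)" using gb[of y w] yz w by auto
        also have "\<dots> \<le> M * (z - y)" using M w by auto
        finally show "norm ((g w - g y) * f w) \<le> M * (z - y) * norm (f w)"
          unfolding norm_mult by (rule mult_right_mono) auto
      qed
      then show ?thesis by (simp add: AA)
    qed
    ultimately have "norm (\<Phi> z - \<Phi> y) \<le> M * (A z - A y) * (z - y) + M * (z - y) * (A z - A y)"
      by (elim ssubst, intro order_trans[OF norm_triangle_ineq4] add_mono)
    then show ?thesis by (simp add: algebra_simps)
  qed
  have key': "norm (\<Phi> z - \<Phi> y) \<le> 2 * M * \<bar>z - y\<bar> * \<bar>A z - A y\<bar>" if "y \<in> {a..b}" "z \<in> {a..b}" for y z
  proof (cases "y \<le> z")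
    case True
    have "norm (\<Phi> z - \<Phi> y) \<le> 2 * M * (z - y) * (A z - A y)" using key[of y z] that True by auto
    also have "\<dots> \<le> 2 * M * (z - y) * \<bar>A z - A y\<bar>" by (intro mult_left_mono) (use M True in auto)
    finally show ?thesis using True by simp
  next
    case False
    have "norm (\<Phi> y - \<Phi> z) \<le> 2 * M * (y - z) * (A y - A z)" using key[of z y] that False by auto
    also have "\<dots> \<le> 2 * M * (y - z) * \<bar>A y - A z\<bar>" by (intro mult_left_mono) (use M False in auto)
    finally show ?thesis using False by (simp add: norm_minus_commute abs_minus_commute)
  qed
  have der: "(\<Phi> has_vector_derivative 0) (at y within {a..b})" if y: "y \<in> {a..b}" for y
    unfolding has_vector_derivative_def has_derivative_within
  proof (intro conjI)
    show "bounded_linear (\<lambda>x. x *\<^sub>R (0::complex))" by simp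
    have "((\<lambda>z. 2 * M * \<bar>A z - A y\<bar>) \<longlongrightarrow> 2 * M * \<bar>A y - A y\<bar>) (at y within {a..b})"
      using Ac y by (intro tendsto_intros) (auto simp: continuous_on_def)
    then have lim: "((\<lambda>z. 2 * M * \<bar>A z - A y\<bar>) \<longlongrightarrow> 0) (at y within {a..b})" by simp
    show "((\<lambda>z. (1 / norm (z - y)) *\<^sub>R (\<Phi> z - (\<Phi> y + (z - y) *\<^sub>R 0))) \<longlongrightarrow> 0) (at y within {a..b})"
    proof (rule Lim_null_comparison[OF _ lim])
      show "\<forall>\<^sub>F z in at y within {a..b}.
          norm ((1 / norm (z - y)) *\<^sub>R (\<Phi> z - (\<Phi> y + (z - y) *\<^sub>R 0))) \<le> 2 * M * \<bar>A z - A y\<bar>"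
        unfolding eventually_at_filter
      proof (intro always_eventually allI impI)
        fix z assume z: "z \<noteq> y" "z \<in> {a..b}"
        have "norm (\<Phi> z - \<Phi> y) / \<bar>z - y\<bar> \<le> 2 * M * \<bar>A z - A y\<bar>"
          using key'[OF y z(2)] z(1) by (simp add: divide_le_eq mult_ac)
        then show "norm ((1 / norm (z - y)) *\<^sub>R (\<Phi> z - (\<Phi> y + (z - y) *\<^sub>R 0))) \<le> 2 * M * \<bar>A z - A y\<bar>"
          by (simp add: divide_inverse mult_ac)
      qed
    qed
  qed
  obtain c where c: "\<And>y. y \<in> {a..b} \<Longrightarrow> \<Phi> y = c"
    using has_vector_derivative_zero_constant[OF convex_real_interval(5) der] by blast
  have "\<Phi> x = \<Phi> a" using c x by auto
  also have "\<Phi> a = 0" by (simp add: \<Phi>_def F_def)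
  finally show ?thesis by (simp add: \<Phi>_def F_def algebra_simps)
qed

text \<open>Second differences of truncated cubes: \<open>spline_ramp\<close> is \<open>C\<^sup>2\<close>, vanishes on \<open>(-\<infinity>, -1]\<close> and
  equals \<open>z\<close> on \<open>[1, \<infinity>)\<close>; its second derivative is the tent function.\<close>

definition spline_ramp :: "real \<Rightarrow> real" where
  "spline_ramp z = (max 0 (z + 1) ^ 3 - 2 * max 0 z ^ 3 + max 0 (z - 1) ^ 3) / 6"

definition spline_step :: "real \<Rightarrow> real" where
  "spline_step z = ((max 0 (z + 1))\<^sup>2 - 2 * (max 0 z)\<^sup>2 + (max 0 (z - 1))\<^sup>2) / 2"

definition tent :: "real \<Rightarrow> real" where
  "tent z = max 0 (z + 1) - 2 * max 0 z + max 0 (z - 1)"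

text \<open>Only the kink needs an argument: there the difference quotient is at most
  \<open>max 0 h ^ p\<close>, which tends to 0 as p \<ge> 1.\<close>

lemma has_derivative_max0_power:
  fixes z :: real
  assumes "p \<ge> 1"
  shows "((\<lambda>z. max 0 z ^ Suc p) has_real_derivative real (Suc p) * max 0 z ^ p) (at z)"
proof (cases z "0 :: real" rule: linorder_cases)
  case less
  then have 0: "real (Suc p) * max 0 z ^ p = 0" using assms by (simp add: max_def)
  show ?thesis unfolding 0 using less
    by (subst has_field_derivative_cong_ev[where g = "\<lambda>_. 0" and y = z])
      (auto intro!: eventually_mono[OF eventually_nhds_in_open[of "{..<0}"]])
next
  case greater
  have "((\<lambda>z. z ^ Suc p) has_real_derivative real (Suc p) * z ^ p) (at z)"
    using DERIV_pow[of "Suc p" z] by simp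
  then show ?thesis
    using greater by (subst has_field_derivative_cong_ev[where g = "\<lambda>z. z ^ Suc p" and y = z])
      (auto intro!: eventually_mono[OF eventually_nhds_in_open[of "{0<..}"]])
next
  case equal
  have "((\<lambda>h. max 0 h ^ p) \<longlongrightarrow> max 0 0 ^ p) (at (0 :: real))"
    by (intro tendsto_intros)
  moreover have "max 0 (0 :: real) ^ p = 0" using assms by simp
  ultimately have lim: "((\<lambda>h. max 0 h ^ p) \<longlongrightarrow> 0) (at (0 :: real))" by (simp only:)
  show ?thesis unfolding equal has_field_derivative_def has_derivative_at
  proof (intro conjI)
    have "((\<lambda>h. norm (max 0 (0 + h) ^ Suc p - max 0 0 ^ Suc p - real (Suc p) * max 0 0 ^ p * h) / norm h)
      \<longlongrightarrow> 0) (at (0 :: real))"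
    proof (rule Lim_null_comparison[OF _ lim])
      have "norm (norm (max 0 (0 + h) ^ Suc p - max 0 0 ^ Suc p - real (Suc p) * max 0 0 ^ p * h) / norm h)
          \<le> max 0 h ^ p" if "h \<noteq> 0" for h :: real
        using that assms by (simp add: max_def abs_mult power_0_left)
      then show "\<forall>\<^sub>F h in at 0.
          norm (norm (max 0 (0 + h) ^ Suc p - max 0 0 ^ Suc p - real (Suc p) * max 0 0 ^ p * h) / norm h)
          \<le> max 0 h ^ p"
        by (simp add: eventually_at_filter)
    qed
    then show "(\<lambda>h. norm (max 0 (0 + h) ^ Suc p - max 0 0 ^ Suc p - real (Suc p) * max 0 0 ^ p * h) / norm h)
      \<midarrow>0\<rightarrow> (0::real)" .
  qed (rule bounded_linear_mult_right)
qed

lemma spline_derivatives: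
  "(spline_ramp has_real_derivative spline_step z) (at z)"
  "(spline_step has_real_derivative tent z) (at z)"
proof -
  have 3: "((\<lambda>z. max 0 (z + c) ^ 3) has_real_derivative 3 * (max 0 (z + c))\<^sup>2) (at z)" for c :: real
    using has_derivative_max0_power[of 2 "z + c"]
    unfolding DERIV_shift by (simp add: numeral_3_eq_3 numeral_2_eq_2)
  have 2: "((\<lambda>z. (max 0 (z + c))\<^sup>2) has_real_derivative 2 * max 0 (z + c)) (at z)" for c :: real
    using has_derivative_max0_power[of 1 "z + c"]
    unfolding DERIV_shift by (simp add: numeral_2_eq_2)
  show "(spline_ramp has_real_derivative spline_step z) (at z)"
    unfolding spline_ramp_def[abs_def] spline_step_def
    by (rule DERIV_cong[OF DERIV_cdivide[OF DERIV_add[OF DERIV_diff[OF 3[of 1] DERIV_cmult[OF 3[of 0], of 2,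
            simplified add_0_right]] 3[of "-1", simplified add_uminus_conv_diff]], of 6]])
      (simp add: field_simps)
  show "(spline_step has_real_derivative tent z) (at z)"
    unfolding spline_step_def[abs_def] tent_def
    by (rule DERIV_cong[OF DERIV_cdivide[OF DERIV_add[OF DERIV_diff[OF 2[of 1] DERIV_cmult[OF 2[of 0], of 2,
            simplified add_0_right]] 2[of "-1", simplified add_uminus_conv_diff]], of 2]])
      (simp add: field_simps)
qed

lemma spline_outside:
  "z \<le> -1 \<Longrightarrow> spline_ramp z = 0" "z \<ge> 1 \<Longrightarrow> spline_ramp z = z"
  "z \<le> -1 \<Longrightarrow> spline_step z = 0" "z \<ge> 1 \<Longrightarrow> spline_step z = 1"
  "\<bar>z\<bar> \<ge> 1 \<Longrightarrow> tent z = 0" "tent z \<ge> 0" "tent z \<le> 1"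
  unfolding spline_ramp_def spline_step_def tent_def
  by (auto simp: max_def algebra_simps power2_eq_square power3_eq_cube abs_if split: if_splits)


text \<open>The scaled tents are an approximate identity: nonnegative, of mass 1 once their support
  lies in (0,1), and with support shrinking to a.\<close>

lemma tent_average_tendsto:
  fixes g :: "real \<Rightarrow> complex"
  assumes g: "continuous_on {0..1} g" and a: "0 < a" "a < 1"
  shows "((\<lambda>\<epsilon>. integral {0..1} (\<lambda>x. g x * of_real (tent ((x - a) / \<epsilon>) / \<epsilon>))) \<longlongrightarrow> g a) (at_right 0)"
proof (rule tendstoI)
  fix e :: real assume e: "e > 0"
  obtain d where d: "d > 0" "\<And>x. x \<in> {0..1} \<Longrightarrow> dist x a < d \<Longrightarrow> dist (g x) (g a) < e / 2"
    using g[unfolded continuous_on_iff, rule_format, of a "e / 2"] a e by auto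
  show "\<forall>\<^sub>F \<epsilon> in at_right 0.
      dist (integral {0..1} (\<lambda>x. g x * of_real (tent ((x - a) / \<epsilon>) / \<epsilon>))) (g a) < e"
    unfolding eventually_at_right_field
  proof (intro exI conjI allI impI)
    show "0 < min d (min a (1 - a))" using d a by simp
    fix \<epsilon> assume \<epsilon>: "0 < \<epsilon>" "\<epsilon> < min d (min a (1 - a))"
    let ?T = "\<lambda>x. tent ((x - a) / \<epsilon>) / \<epsilon>"
    have Tc: "continuous_on {0..1} ?T"
      unfolding tent_def using \<epsilon> by (intro continuous_intros) auto
    have "(?T has_integral spline_step ((1 - a) / \<epsilon>) - spline_step ((0 - a) / \<epsilon>)) {0..1}"
    proof (rule fundamental_theorem_of_calculus)
      fix x :: real
      have "((\<lambda>x. spline_step ((x - a) / \<epsilon>)) has_real_derivative tent ((x - a) / \<epsilon>) * (1 / \<epsilon>)) (at x within {0..1})"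
        by (rule DERIV_chain2[OF spline_derivatives(2)])
          (use \<epsilon> in \<open>auto intro!: derivative_eq_intros\<close>)
      then show "((\<lambda>x. spline_step ((x - a) / \<epsilon>)) has_vector_derivative ?T x) (at x within {0..1})"
        by (simp add: has_real_derivative_iff_has_vector_derivative)
    qed simp
    then have Ti: "(?T has_integral 1) {0..1}"
      using \<epsilon> by (simp add: spline_outside le_divide_eq divide_le_eq)
    have Ti': "((\<lambda>x. g a * of_real (?T x)) has_integral g a) {0..1}"
      using has_integral_mult_right[OF has_integral_of_real[OF Ti], of "g a"] by simp
    have i: "(\<lambda>x. g x * of_real (?T x)) integrable_on {0..1}"
      by (intro integrable_continuous_real continuous_intros g Tc)
    have "integral {0..1} (\<lambda>x. g x * of_real (?T x)) - g a
        = integral {0..1} (\<lambda>x. g x * of_real (?T x) - g a * of_real (?T x))"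
      using integral_unique[OF has_integral_diff[OF integrable_integral[OF i] Ti']] by simp
    also have "norm \<dots> \<le> integral {0..1} (\<lambda>x. e / 2 * ?T x)"
    proof (rule integral_norm_bound_integral)
      show "(\<lambda>x. g x * of_real (?T x) - g a * of_real (?T x)) integrable_on {0..1}"
        using Ti' i by (intro integrable_diff) auto
      show "(\<lambda>x. e / 2 * ?T x) integrable_on {0..1}"
        using has_integral_mult_right[OF Ti] by blast
      fix x :: real assume x: "x \<in> {0..1}"
      have T0: "0 \<le> ?T x" using \<epsilon> by (simp add: spline_outside)
      have "norm (g x - g a) * ?T x \<le> e / 2 * ?T x"
      proof (cases "dist x a < d")
        case True
        then show ?thesis using d(2)[OF x True] T0 by (intro mult_right_mono) (auto simp: dist_norm)
      next
        case False
        then have "\<bar>(x - a) / \<epsilon>\<bar> \<ge> 1" using \<epsilon> by (simp add: dist_real_def le_divide_eq)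
        then show ?thesis by (simp add: spline_outside)
      qed
      then show "norm (g x * of_real (?T x) - g a * of_real (?T x)) \<le> e / 2 * ?T x"
        using T0 unfolding left_diff_distrib[symmetric] norm_mult norm_of_real by (simp only: abs_of_nonneg)
    qed
    also have "\<dots> = e / 2" using integral_unique[OF has_integral_mult_right[OF Ti, of "e / 2"]] by simp
    finally show "dist (integral {0..1} (\<lambda>x. g x * of_real (?T x))) (g a) < e"
      using e by (simp add: dist_norm)
  qed
qed

text \<open>The second-order du Bois-Reymond lemma. Three tents weighted as in a second divided
  difference have a compactly supported second primitive of class C^2; letting their width tend to 0
  turns orthogonality into the vanishing of the divided difference of g at any a < b < c.\<close>

lemma affine_if_orthogonal_to_second_derivatives:
  fixes g :: "real \<Rightarrow> complex"
  assumes g: "continuous_on {0..1} g"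
    and orth: "\<And>\<phi> \<phi>' \<phi>'' r. \<lbrakk>\<And>x. (\<phi> has_vector_derivative \<phi>' x) (at x);
        \<And>x. (\<phi>' has_vector_derivative \<phi>'' x) (at x); continuous_on UNIV \<phi>'';
        0 < r; \<And>x. x \<notin> {r..1 - r} \<Longrightarrow> \<phi> x = 0 \<and> \<phi>' x = 0\<rbrakk>
      \<Longrightarrow> integral {0..1} (\<lambda>x. g x * \<phi>'' x) = (0 :: complex)"
    and x: "x \<in> {0..1}"
  shows "g x = of_real (1 - x) * g 0 + of_real x * g 1"
proof -
  have interior: "of_real (c - b) * g a + of_real (b - a) * g c - of_real (c - a) * g b = 0"
    if abc: "0 < a" "a < b" "b < c" "c < 1" for a b c
  proof -
    define I where "I a \<epsilon> = integral {0..1} (\<lambda>x. g x * of_real (tent ((x - a) / \<epsilon>) / \<epsilon>))" for a \<epsilon>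
    have lim: "(I z \<longlongrightarrow> g z) (at_right 0)" if "0 < z" "z < 1" for z
      unfolding I_def using tent_average_tendsto[OF g that] .
    have "((\<lambda>\<epsilon>. of_real (c - b) * I a \<epsilon> + of_real (b - a) * I c \<epsilon> - of_real (c - a) * I b \<epsilon>)
        \<longlongrightarrow> of_real (c - b) * g a + of_real (b - a) * g c - of_real (c - a) * g b) (at_right 0)"
      using abc by (intro tendsto_intros lim) auto
    moreover have "\<forall>\<^sub>F \<epsilon> in at_right 0.
        of_real (c - b) * I a \<epsilon> + of_real (b - a) * I c \<epsilon> - of_real (c - a) * I b \<epsilon> = 0"
      unfolding eventually_at_right_field
    proof (intro exI conjI allI impI)
      define r where "r = min (a / 2) ((1 - c) / 2)"
      show "0 < r" using abc by (simp add: r_def)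
      fix \<epsilon> assume \<epsilon>: "0 < \<epsilon>" "\<epsilon> < r"
      \<comment> \<open>The weights annihilate 1 and x. Hence the combination of ramps vanishes
        beyond c + \<epsilon>, where all three ramps are linear, as it does before a - \<epsilon>,
        where all three are 0.\<close>
      define comb :: "(real \<Rightarrow> real) \<Rightarrow> real \<Rightarrow> real" where
        "comb \<psi> x = (c - b) * \<psi> ((x - a) / \<epsilon>) + (b - a) * \<psi> ((x - c) / \<epsilon>) - (c - a) * \<psi> ((x - b) / \<epsilon>)"
        for \<psi> x
      have comb_deriv: "(comb \<psi> has_real_derivative comb \<psi>' x / \<epsilon>) (at x)"
        if "\<And>z. (\<psi> has_real_derivative \<psi>' z) (at z)" for \<psi> \<psi>' x
      proof -
        have *: "((\<lambda>x. \<psi> ((x - z) / \<epsilon>)) has_real_derivative \<psi>' ((x - z) / \<epsilon>) * (1 / \<epsilon>)) (at x)" for z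
          by (rule DERIV_chain2[OF that]) (use \<epsilon> in \<open>auto intro!: derivative_eq_intros\<close>)
        show ?thesis unfolding comb_def[abs_def]
          using DERIV_diff[OF DERIV_add[OF DERIV_cmult[OF *[of a], of "c - b"] DERIV_cmult[OF *[of c], of "b - a"]]
              DERIV_cmult[OF *[of b], of "c - a"]]
          by (simp add: add_divide_distrib diff_divide_distrib)
      qed
      have zero: "integral {0..1} (\<lambda>x. g x * of_real (comb tent x / \<epsilon>)) = 0"
      proof (rule orth[where r = r])
        show "((\<lambda>x. of_real (\<epsilon> * comb spline_ramp x) :: complex) has_vector_derivative
            of_real (comb spline_step x)) (at x)" for x
          using DERIV_cmult[OF comb_deriv[of spline_ramp spline_step x], of \<epsilon>] spline_derivatives \<epsilon>
          by (intro has_vector_derivative_of_real)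
            (simp add: has_real_derivative_iff_has_vector_derivative)
        show "((\<lambda>x. of_real (comb spline_step x) :: complex) has_vector_derivative
            of_real (comb tent x / \<epsilon>)) (at x)" for x
          using comb_deriv[of spline_step tent x] spline_derivatives
          by (intro has_vector_derivative_of_real)
            (simp add: has_real_derivative_iff_has_vector_derivative)
        show "continuous_on UNIV (\<lambda>x. of_real (comb tent x / \<epsilon>) :: complex)"
          unfolding comb_def tent_def using \<epsilon> by (intro continuous_intros) auto
        show "0 < r" by fact
        fix x assume "x \<notin> {r..1 - r}"
        then consider "x \<le> a - \<epsilon>" | "x \<ge> c + \<epsilon>" proof -
          have "r \<le> a / 2" "r \<le> (1 - c) / 2" unfolding r_def by linarith+
          with that \<epsilon> \<open>x \<notin> {r..1 - r}\<close> show ?thesis by fastforce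
        qed
        then show "of_real (\<epsilon> * comb spline_ramp x) = (0 :: complex) \<and> of_real (comb spline_step x) = (0 :: complex)"
        proof cases
          case 1
          then have "(x - a) / \<epsilon> \<le> -1" "(x - b) / \<epsilon> \<le> -1" "(x - c) / \<epsilon> \<le> -1"
            using \<epsilon> abc by (auto simp: divide_le_eq)
          then show ?thesis by (simp add: comb_def spline_outside)
        next
          case 2
          then have "(x - a) / \<epsilon> \<ge> 1" "(x - b) / \<epsilon> \<ge> 1" "(x - c) / \<epsilon> \<ge> 1"
            using \<epsilon> abc by (auto simp: le_divide_eq)
          then show ?thesis using \<epsilon> by (simp add: comb_def spline_outside field_simps)
        qed
      qed
      have split: "(\<lambda>x. g x * of_real (comb tent x / \<epsilon>))
        = (\<lambda>x. of_real (c - b) * (g x * of_real (tent ((x - a) / \<epsilon>) / \<epsilon>))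
          + of_real (b - a) * (g x * of_real (tent ((x - c) / \<epsilon>) / \<epsilon>))
          - of_real (c - a) * (g x * of_real (tent ((x - b) / \<epsilon>) / \<epsilon>)))"
        unfolding comb_def fun_eq_iff of_real_add of_real_diff of_real_divide of_real_mult
          diff_divide_distrib add_divide_distrib by (simp add: algebra_simps)
      have i: "(\<lambda>x. g x * of_real (tent ((x - z) / \<epsilon>) / \<epsilon>)) integrable_on {0..1}" for z
        unfolding tent_def using \<epsilon> by (intro integrable_continuous_real continuous_intros g) auto
      have "((\<lambda>x. g x * of_real (comb tent x / \<epsilon>))
          has_integral of_real (c - b) * I a \<epsilon> + of_real (b - a) * I c \<epsilon> - of_real (c - a) * I b \<epsilon>) {0..1}"
        unfolding split I_def
        by (intro has_integral_diff has_integral_add has_integral_mult_right integrable_integral i)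
      from integral_unique[OF this] zero
      show "of_real (c - b) * I a \<epsilon> + of_real (b - a) * I c \<epsilon> - of_real (c - a) * I b \<epsilon> = 0"
        by (simp only:)
    qed
    ultimately show ?thesis
      by (rule tendsto_unique[OF trivial_limit_at_right_real _ tendsto_eventually])
  qed
  show ?thesis
  proof (cases "0 < x \<and> x < 1")
    case True
    \<comment> \<open>Only interior points are available so far; the endpoint values are reached by
      continuity, letting first a tend to 0 and then c tend to 1.\<close>
    have left: "of_real (c - x) * g 0 + of_real (x - 0) * g c - of_real (c - 0) * g x = 0"
      if c: "x < c" "c < 1" for c
    proof (rule continuous_constant_on_closure[of "{0<..<x}"
          "\<lambda>a. of_real (c - x) * g a + of_real (x - a) * g c - of_real (c - a) * g x" 0 0])
      show "continuous_on (closure {0<..<x})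
          (\<lambda>a. of_real (c - x) * g a + of_real (x - a) * g c - of_real (c - a) * g x)"
        using True by (auto intro!: continuous_intros continuous_on_subset[OF g])
    qed (use True c interior in auto)
    have "of_real (1 - x) * g 0 + of_real (x - 0) * g 1 - of_real (1 - 0) * g x = 0"
    proof (rule continuous_constant_on_closure[of "{x<..<1}"
          "\<lambda>c. of_real (c - x) * g 0 + of_real (x - 0) * g c - of_real (c - 0) * g x" 0 1])
      show "continuous_on (closure {x<..<1})
          (\<lambda>c. of_real (c - x) * g 0 + of_real (x - 0) * g c - of_real (c - 0) * g x)"
        using True by (auto intro!: continuous_intros continuous_on_subset[OF g])
    qed (use True left in auto)
    then show ?thesis by simp
  next
    case False
    then have "x = 0 \<or> x = 1" using x by auto
    then show ?thesis by auto
  qed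
qed

section \<open>The derivative of the exact solution\<close>

lemma absolutely_integrable_iff_lebesgue_on:
  fixes w :: "real \<Rightarrow> complex"
  shows "w absolutely_integrable_on {0..1} \<longleftrightarrow> integrable (lebesgue_on {0<..<1}) w"
  using absolutely_integrable_on_open_interval[where f = w and a = 0 and b = 1]
  by (auto intro: absolutely_integrable_imp_integrable simp: integrable_restrict_space set_integrable_def)

lemma lebesgue_on_eq_integral:
  fixes w :: "real \<Rightarrow> complex"
  assumes "w absolutely_integrable_on {0..1}"
  shows "(LINT x|lebesgue_on {0<..<1}. w x) = integral {0..1} w"
  using lebesgue_integral_eq_integral[of "{0<..<1}" w] assms integral_open_interval_real[of 0 1 w]
  by (simp add: absolutely_integrable_iff_lebesgue_on)

lemma L2_absolutely_integrable:
  assumes "f \<in> L2"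
  shows "f absolutely_integrable_on {0..1}"
proof -
  have "integrable (lebesgue_on {0<..<1}) f"
  proof (rule Bochner_Integration.integrable_bound)
    show "integrable (lebesgue_on {0<..<1}) (\<lambda>x. 1 + (norm (f x))\<^sup>2)"
      using assms unfolding L2_def
      by (intro Bochner_Integration.integrable_add finite_measure.integrable_const finite_measure_lebesgue_on)
        auto
    show "f \<in> borel_measurable (lebesgue_on {0<..<1})" using assms by (simp add: L2_def)
    have "y \<le> 1 + y\<^sup>2" for y :: real
      using sum_squares_bound[of 1 y] zero_le_power2[of y] by (smt (verit) mult_cancel_left1 one_power2 sum_squares_bound)
    then show "AE x in lebesgue_on {0<..<1}. norm (f x) \<le> norm (1 + (norm (f x))\<^sup>2)"
      by (intro AE_I2) (simp add: abs_of_nonneg)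
  qed
  then show ?thesis by (simp add: absolutely_integrable_iff_lebesgue_on)
qed

lemma has_vector_derivative_continuous_on:
  fixes \<phi> :: "real \<Rightarrow> complex"
  assumes "\<And>x. (\<phi> has_vector_derivative \<phi>' x) (at x)"
  shows "continuous_on S \<phi>"
  by (meson assms continuous_at_imp_continuous_on has_vector_derivative_continuous)

text \<open>Integrating the equation twice against test functions turns the weak formulation into
  a statement about continuous functions: with \<open>R = \<integral> (f + k\<^sup>2 u)\<close> and \<open>S = \<integral> R\<close>, the function \<open>u + S\<close> is
  orthogonal to second derivatives of test functions.\<close>

lemma bvp_solution_first_integral:
  assumes f: "f \<in> L2" and u: "bvp_solution k f u"
  defines "R \<equiv> \<lambda>x. integral {0..x} f + of_real (k\<^sup>2) * integral {0..x} u"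
  obtains b where "\<And>x. x \<in> {0..1} \<Longrightarrow> (u has_vector_derivative b - R x) (at x within {0..1})"
proof -
  obtain u1 u2 where uc: "continuous_on {0..1} u" and H2: "H2_derivatives u u1 u2"
    and ae: "AE x in lebesgue_on {0<..<1}. u2 x + (of_real k)\<^sup>2 * u x = - f x"
    using u by (auto simp: bvp_solution_def)
  have fa: "f absolutely_integrable_on {0..1}" by (rule L2_absolutely_integrable[OF f])
  have ua: "u absolutely_integrable_on {0..1}" by (rule absolutely_integrable_continuous_real[OF uc])
  have u1a: "u1 absolutely_integrable_on {0..1}" and u2a: "u2 absolutely_integrable_on {0..1}"
    using H2 L2_absolutely_integrable by (auto simp: H2_derivatives_def)
  define G where "G x = f x + of_real (k\<^sup>2) * u x" for x
  have Ga: "G absolutely_integrable_on {0..1}"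
    unfolding G_def by (intro set_integral_add fa set_integrable_mult_right ua)
  have RG: "R x = integral {0..x} G" if "x \<in> {0..1}" for x
  proof -
    have "f integrable_on {0..x}" "u integrable_on {0..x}"
      using fa ua that integrable_on_subinterval[of _ "{0..1}" 0 x]
      by (auto simp: absolutely_integrable_on_def)
    then show ?thesis unfolding R_def G_def
      by (subst integral_add) (auto intro!: integrable_on_mult_right simp: integral_mult_right)
  qed
  have Rc: "continuous_on {0..1} R"
    unfolding R_def using fa ua
    by (intro continuous_intros indefinite_integral_continuous_1) (auto simp: absolutely_integrable_on_def)
  define S where "S x = integral {0..x} R" for x
  have Sd: "(S has_vector_derivative R x) (at x within {0..1})" if "x \<in> {0..1}" for x
    unfolding S_def[abs_def] by (rule integral_has_vector_derivative[OF Rc that])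
  have Sc: "continuous_on {0..1} S"
    using Sd by (meson continuous_on_eq_continuous_within has_vector_derivative_continuous)
  have "integral {0..1} (\<lambda>x. (u x + S x) * \<phi>'' x) = 0"
    if d1: "\<And>x. (\<phi> has_vector_derivative \<phi>' x) (at x)"
      and d2: "\<And>x. (\<phi>' has_vector_derivative \<phi>'' x) (at x)" and c2: "continuous_on UNIV \<phi>''"
      and r: "0 < r" and supp: "\<And>x. x \<notin> {r..1 - r} \<Longrightarrow> \<phi> x = 0 \<and> \<phi>' x = 0" for \<phi> \<phi>' \<phi>'' r
  proof -
    have c0: "continuous_on A \<phi>" and c1: "continuous_on A \<phi>'" for A
      using has_vector_derivative_continuous_on d1 d2 by blast+
    have c2': "continuous_on {0..1} \<phi>''" using c2 continuous_on_subset by blast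
    have D1: "vector_derivative \<phi> (at x) = \<phi>' x" and D2: "vector_derivative \<phi>' (at x) = \<phi>'' x" for x
      using d1 d2 vector_derivative_at by blast+
    have "{x. \<phi> x \<noteq> 0} \<subseteq> {r..1 - r}" "{x. \<phi>' x \<noteq> 0} \<subseteq> {r..1 - r}"
      using supp by blast+
    then have "closure {x. \<phi> x \<noteq> 0} \<subseteq> {r..1 - r}" "closure {x. \<phi>' x \<noteq> 0} \<subseteq> {r..1 - r}"
      by (simp_all add: closure_minimal)
    moreover have "{r..1 - r} \<subseteq> {0<..<1}" using r by auto
    \<comment> \<open>Integrating by parts twice needs both: the weak derivative of u is tested with
      \<open>\<phi>'\<close>, that of \<open>u1\<close> with \<open>\<phi>\<close>. As tests need
      only be C^1, a function \<phi> of class C^2 suffices.\<close>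
    ultimately have t1: "test_function \<phi>" and t2: "test_function \<phi>'"
      unfolding test_function_def C1_differentiable_on_eq D1 D2
      using c1 c2 d1 d2 vector_derivative_works differentiableI_vector by blast+
    have mult: "(LINT x|lebesgue_on {0<..<1}. v x * \<psi> x) = integral {0..1} (\<lambda>x. v x * \<psi> x)"
      if "v absolutely_integrable_on {0..1}" "continuous_on {0..1} \<psi>" for v \<psi> :: "real \<Rightarrow> complex"
      using lebesgue_on_eq_integral[OF absolutely_integrable_continuous_mult[OF that]]
      by (simp add: mult.commute)
    have b1: "\<phi> 1 = 0" "\<phi>' 1 = 0" using supp[of 1] r by auto
    have "integral {0..1} (\<lambda>x. u x * \<phi>'' x) = - (LINT x|lebesgue_on {0<..<1}. u1 x * \<phi>' x)"
      using H2 t2 mult[OF ua c2'] unfolding H2_derivatives_def has_weak_derivative_def by (auto simp: D2)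
    also have "\<dots> = (LINT x|lebesgue_on {0<..<1}. u2 x * \<phi> x)"
      using H2 t1 unfolding H2_derivatives_def has_weak_derivative_def by (auto simp: D1)
    also have "\<dots> = (LINT x|lebesgue_on {0<..<1}. - (\<phi> x * G x))"
    proof (rule integral_cong_AE)
      have "integrable (lebesgue_on {0<..<1}) (\<lambda>x. \<phi> x * u2 x)"
        "integrable (lebesgue_on {0<..<1}) (\<lambda>x. \<phi> x * G x)"
        using absolutely_integrable_continuous_mult[OF u2a c0] absolutely_integrable_continuous_mult[OF Ga c0]
        by (simp_all add: absolutely_integrable_iff_lebesgue_on)
      then show "(\<lambda>x. u2 x * \<phi> x) \<in> borel_measurable (lebesgue_on {0<..<1})"
        "(\<lambda>x. - (\<phi> x * G x)) \<in> borel_measurable (lebesgue_on {0<..<1})"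
        by (auto simp: mult.commute dest: borel_measurable_integrable)
      show "AE x in lebesgue_on {0<..<1}. u2 x * \<phi> x = - (\<phi> x * G x)"
        using ae
      proof (rule AE_mp, intro AE_I2 impI)
        fix x assume "u2 x + (of_real k)\<^sup>2 * u x = - f x"
        then have "u2 x = - G x" by (simp add: G_def add_eq_0_iff2 algebra_simps)
        then show "u2 x * \<phi> x = - (\<phi> x * G x)" by simp
      qed
    qed
    also have "\<dots> = - integral {0..1} (\<lambda>x. \<phi> x * G x)"
      using lebesgue_on_eq_integral[OF absolutely_integrable_continuous_mult[OF Ga c0]] by simp
    also have "\<dots> = integral {0..1} (\<lambda>x. \<phi>' x * integral {0..x} G)"
      using integral_by_parts_absolutely_integrable[OF Ga has_vector_derivative_at_within[OF d1] c1, of 1] b1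
      by simp
    also have "\<dots> = integral {0..1} (\<lambda>x. \<phi>' x * R x)"
      by (intro integral_cong) (simp add: RG)
    also have "\<dots> = - integral {0..1} (\<lambda>x. \<phi>'' x * S x)"
      using integral_by_parts_absolutely_integrable[OF absolutely_integrable_continuous_real[OF Rc]
          has_vector_derivative_at_within[OF d2] c2', of 1] b1
      by (simp add: S_def)
    finally have "integral {0..1} (\<lambda>x. u x * \<phi>'' x) + integral {0..1} (\<lambda>x. S x * \<phi>'' x) = 0"
      by (simp add: mult.commute)
    then show ?thesis
      using integral_add[of "\<lambda>x. u x * \<phi>'' x" "{0..1}" "\<lambda>x. S x * \<phi>'' x"]
      by (simp add: distrib_right integrable_continuous_real continuous_intros uc Sc c2')
  qed
  then have aff: "u x + S x = of_real (1 - x) * (u 0 + S 0) + of_real x * (u 1 + S 1)" if "x \<in> {0..1}" for x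
    using affine_if_orthogonal_to_second_derivatives[of "\<lambda>x. u x + S x" x] that uc Sc
    by (auto intro!: continuous_intros)
  show ?thesis
  proof
    fix x :: real assume x: "x \<in> {0..1}"
    let ?p = "\<lambda>x. of_real (1 - x) * (u 0 + S 0) + of_real x * (u 1 + S 1) - S x"
    have "(?p has_vector_derivative ((u 1 + S 1) - (u 0 + S 0)) - R x) (at x within {0..1})"
      by (auto intro!: derivative_eq_intros Sd[OF x])
    then show "(u has_vector_derivative ((u 1 + S 1) - (u 0 + S 0)) - R x) (at x within {0..1})"
      by (rule has_vector_derivative_transform[OF x, rotated])
        (simp only: aff[symmetric] add_diff_cancel_right')
  qed
qed

text \<open>The x-derivative of the outgoing Green's function, integrated against f. It is split
  into the waves cis(-kx) and cis(kx) because the discrete solution is compared with each of them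
  separately.\<close>

definition exact_derivative :: "real \<Rightarrow> (real \<Rightarrow> complex) \<Rightarrow> real \<Rightarrow> complex" where
  "exact_derivative k f x =
    (cis (- (k * x)) * (integral {0..1} (\<lambda>y. cis (k * y) * f y) - integral {0..x} (\<lambda>y. cis (k * y) * f y))
     + cis (k * x) * (integral {0..1} (\<lambda>y. cis (k * y) * f y) - integral {0..x} (\<lambda>y. cis (- (k * y)) * f y))) / 2"

text \<open>The first-order quantities u' - iku and u' + iku have the integrating factors cis(kx)
  and cis(-kx). Solving for both and adding eliminates u.\<close>

lemma bvp_solution_derivative:
  assumes k: "k > 0" and f: "f \<in> L2" and u: "bvp_solution k f u"
  obtains v where "continuous_on {0..1} v"
    and "\<And>x. x \<in> {0<..<1} \<Longrightarrow> (u has_vector_derivative v x) (at x)"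
    and "v 1 = \<i> * k * u 1"
    and "\<And>x. x \<in> {0..1} \<Longrightarrow> v x = exact_derivative k f x"
proof -
  define F where "F x = integral {0..x} f" for x
  define I where "I x = integral {0..x} u" for x
  obtain b where b: "\<And>x. x \<in> {0..1} \<Longrightarrow>
      (u has_vector_derivative b - (F x + of_real (k\<^sup>2) * I x)) (at x within {0..1})"
    using bvp_solution_first_integral[OF f u] unfolding F_def I_def by metis
  have uc: "continuous_on {0..1} u" and u0: "u 0 = 0" and bc: "left_limit (D u) 1 = \<i> * k * u 1"
    using u by (auto simp: bvp_solution_def)
  have fa: "f absolutely_integrable_on {0..1}" by (rule L2_absolutely_integrable[OF f])
  have Fc: "continuous_on {0..1} F"
    unfolding F_def using fa by (intro indefinite_integral_continuous_1) (auto simp: absolutely_integrable_on_def)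
  have Id: "(I has_vector_derivative u x) (at x within {0..1})" if "x \<in> {0..1}" for x
    unfolding I_def[abs_def] by (rule integral_has_vector_derivative[OF uc that])
  have Ic: "continuous_on {0..1} I"
    using Id by (meson continuous_on_eq_continuous_within has_vector_derivative_continuous)
  define v where "v x = b - (F x + of_real (k\<^sup>2) * I x)" for x
  have vc: "continuous_on {0..1} v" unfolding v_def by (intro continuous_intros Fc Ic)
  have ud: "(u has_vector_derivative v x) (at x)" if "x \<in> {0<..<1}" for x
    using b[of x] that unfolding v_def by (simp add: at_within_Icc_at)
  have v1: "v 1 = \<i> * k * u 1"
  proof -
    have "(v \<longlongrightarrow> v 1) (at_left 1)"
      using continuous_on_Icc_at_leftD[OF vc] by simp
    moreover have "\<forall>\<^sub>F x in at_left 1. D u x = v x"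
      unfolding eventually_at_left_field using ud vector_derivative_at
      by (intro exI[of _ 0]) (auto simp: D_def)
    ultimately have "(D u \<longlongrightarrow> v 1) (at_left 1)"
      by (simp add: tendsto_cong)
    then have "left_limit (D u) 1 = v 1"
      unfolding left_limit_def by (intro tendsto_Lim) auto
    then show ?thesis using bc by simp
  qed
  have main: "exp (c * x) * (v x - c * u x) = b - integral {0..x} (\<lambda>y. exp (c * y) * f y)"
    if c: "c\<^sup>2 = - of_real (k\<^sup>2)" and x: "x \<in> {0..1}" for c :: complex and x
  proof -
    \<comment> \<open>\<open>v = q - F\<close>, where q can be differentiated classically, while F
      is a primitive of a merely integrable function and is treated by
      \<open>integral_by_parts_absolutely_integrable\<close>.\<close>
    define q where "q x = b - of_real (k\<^sup>2) * I x" for x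
    have ed: "((\<lambda>x. exp (c * of_real x)) has_vector_derivative c * exp (c * of_real x)) (at x within S)" for x S
      by (auto intro!: derivative_eq_intros has_vector_derivative_real_field)
    have ibp: "integral {0..x} (\<lambda>y. exp (c * y) * f y)
        = exp (c * x) * F x - integral {0..x} (\<lambda>y. c * exp (c * y) * F y)"
      unfolding F_def
      by (rule integral_by_parts_absolutely_integrable[OF fa ed _ x]) (intro continuous_intros)
    have "((\<lambda>x. exp (c * x) * (q x - c * u x)) has_vector_derivative c * exp (c * y) * F y) (at y within {0..x})"
      if y: "y \<in> {0..x}" for y
    proof -
      have y1: "y \<in> {0..1}" using y x by auto
      have "((\<lambda>x. exp (c * x) * (q x - c * u x)) has_vector_derivative
          exp (c * y) * (- of_real (k\<^sup>2) * u y - c * (q y - F y)) + c * exp (c * y) * (q y - c * u y))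
          (at y within {0..1})"
        unfolding q_def using b[OF y1] Id[OF y1]
        by (auto intro!: derivative_eq_intros ed simp: algebra_simps)
      also have "exp (c * y) * (- of_real (k\<^sup>2) * u y - c * (q y - F y)) + c * exp (c * y) * (q y - c * u y)
          = c * exp (c * y) * F y"
        unfolding c[symmetric] by (simp add: algebra_simps power2_eq_square)
      finally show ?thesis
        by (rule has_vector_derivative_within_subset) (use x in auto)
    qed
    then have "((\<lambda>y. c * exp (c * y) * F y) has_integral
        exp (c * x) * (q x - c * u x) - exp (c * 0) * (q 0 - c * u 0)) {0..x}"
      using fundamental_theorem_of_calculus[of 0 x "\<lambda>x. exp (c * of_real x) * (q x - c * u x)"] x by simp
    then have "integral {0..x} (\<lambda>y. c * exp (c * y) * F y) = exp (c * x) * (q x - c * u x) - b"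
      by (simp add: integral_unique q_def I_def u0)
    then show ?thesis unfolding ibp by (simp add: v_def q_def algebra_simps)
  qed
  have cis_exp: "cis (k * x) = exp (\<i> * k * x)" "cis (- (k * x)) = exp (- (\<i> * k) * x)" for x
    by (simp_all add: cis_conv_exp mult_ac)
  have P: "cis (k * x) * (v x - \<i> * k * u x) = b - integral {0..x} (\<lambda>y. cis (k * y) * f y)"
    and M: "cis (- (k * x)) * (v x + \<i> * k * u x) = b - integral {0..x} (\<lambda>y. cis (- (k * y)) * f y)"
    if "x \<in> {0..1}" for x
    using main[of "\<i> * k" x] main[of "- (\<i> * k)" x] that unfolding cis_exp
    by (simp_all add: power_mult_distrib)
  \<comment> \<open>At x = 1 the impedance condition makes v - iku vanish, which identifies the
    integration constant.\<close>
  have b: "b = integral {0..1} (\<lambda>y. cis (k * y) * f y)"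
    using P[of 1] v1 by simp
  show ?thesis
  proof (rule that[OF vc ud v1])
    fix x :: real assume x: "x \<in> {0..1}"
    have "cis (- (k * x)) * (b - integral {0..x} (\<lambda>y. cis (k * y) * f y)) = v x - \<i> * k * u x"
      "cis (k * x) * (b - integral {0..x} (\<lambda>y. cis (- (k * y)) * f y)) = v x + \<i> * k * u x"
      unfolding P[OF x, symmetric] M[OF x, symmetric] by (simp_all add: cis_mult mult.assoc[symmetric])
    then have "v x = (cis (- (k * x)) * (b - integral {0..x} (\<lambda>y. cis (k * y) * f y))
       + cis (k * x) * (b - integral {0..x} (\<lambda>y. cis (- (k * y)) * f y))) / 2" by simp
    then show "v x = exact_derivative k f x"
      unfolding exact_derivative_def b .
  qed
qed

section \<open>The discrete wave number\<close>

text \<open>Rationalizing the root as \<open>a = 2 * t\<^sup>2 / (R + A)\<close> removes the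
  division by \<gamma>. Then \<open>2 \<le> R + A \<le> 8 / 3\<close> holds for both signs of
  \<gamma> and gives the two-sided bound on \<alpha>.\<close>

lemma t_minus_properties:
  fixes \<gamma> t :: real
  assumes t: "0 < t" "t \<le> 1" and \<gamma>: "\<gamma> \<noteq> 0" "\<bar>\<gamma>\<bar> \<le> 1 / 6"
  defines "s \<equiv> t_minus \<gamma> t"
  defines "\<alpha> \<equiv> 2 - 2 * cos s"
  shows "0 < s" "s < pi / 2" "\<gamma> * \<alpha>\<^sup>2 + (1 + t\<^sup>2 / 6) * \<alpha> = t\<^sup>2" "\<alpha> \<le> t\<^sup>2" "3 / 4 * t\<^sup>2 \<le> \<alpha>"
proof -
  define A where "A = 1 + t\<^sup>2 / 6"
  define R where "R = sqrt (A\<^sup>2 + 4 * \<gamma> * t\<^sup>2)"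
  have t2: "0 < t\<^sup>2" "t\<^sup>2 \<le> 1" using t by (auto simp: power_le_one)
  have \<gamma>t: "\<bar>\<gamma> * t\<^sup>2\<bar> \<le> 1 / 6 * t\<^sup>2" unfolding abs_mult using \<gamma> t2 by (simp add: mult_right_mono)
  \<comment> \<open>A^2 - (1 - t^2/6)^2 = 2/3 t^2 and 4 \<gamma> t^2 \<ge> -2/3 t^2: the bound 1/6
    on \<bar>\<gamma>\<bar> is just enough.\<close>
  have lo: "(1 - t\<^sup>2 / 6)\<^sup>2 \<le> A\<^sup>2 + 4 * \<gamma> * t\<^sup>2"
    using \<gamma>t by (auto simp: A_def power2_eq_square algebra_simps abs_le_iff)
  have hi: "A\<^sup>2 + 4 * \<gamma> * t\<^sup>2 \<le> (3 / 2)\<^sup>2"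
  proof -
    have "A\<^sup>2 \<le> (7 / 6)\<^sup>2" using t2 by (intro power_mono) (auto simp: A_def)
    then show ?thesis using \<gamma>t t2 by (auto simp: power2_eq_square abs_le_iff)
  qed
  have R1: "1 - t\<^sup>2 / 6 \<le> R" unfolding R_def using lo by (rule real_le_rsqrt)
  have R2: "R \<le> 3 / 2" unfolding R_def using hi by (intro real_le_lsqrt) auto
  have RR: "R\<^sup>2 = A\<^sup>2 + 4 * \<gamma> * t\<^sup>2"
    unfolding R_def using order_trans[OF zero_le_power2 lo] by simp
  define a where "a = 2 * t\<^sup>2 / (R + A)"
  have RA: "2 \<le> R + A" "R + A \<le> 8 / 3" using R1 R2 t2 by (auto simp: A_def)
  have a1: "a \<le> t\<^sup>2" unfolding a_def using RA t2 by (simp add: divide_le_eq)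
  have a2: "3 / 4 * t\<^sup>2 \<le> a" unfolding a_def using RA t2 by (simp add: le_divide_eq)
  have aeq: "a = (R - A) / (2 * \<gamma>)"
  proof -
    have "(R - A) * (R + A) = 4 * \<gamma> * t\<^sup>2" using RR by (simp add: power2_eq_square algebra_simps)
    then show ?thesis unfolding a_def using RA \<gamma> by (simp add: frac_eq_eq mult_ac)
  qed
  have quad: "\<gamma> * a\<^sup>2 + A * a = t\<^sup>2"
  proof -
    have "2 * \<gamma> * a + A = R" unfolding aeq using \<gamma> by simp
    then have "(2 * \<gamma> * a + A)\<^sup>2 = A\<^sup>2 + 4 * \<gamma> * t\<^sup>2" using RR by simp
    then have "4 * \<gamma> * (\<gamma> * a\<^sup>2 + A * a) = 4 * \<gamma> * t\<^sup>2" by (simp add: power2_eq_square algebra_simps)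
    then show ?thesis using \<gamma> by simp
  qed
  have c: "(4 * \<gamma> + 1 + t\<^sup>2 / 6 - sqrt ((1 + t\<^sup>2 / 6)\<^sup>2 + 4 * \<gamma> * t\<^sup>2)) / (4 * \<gamma>) = 1 - a / 2"
    unfolding aeq R_def A_def using \<gamma> by (simp add: field_simps)
  define s0 where "s0 = arccos (1 - a / 2)"
  have ab: "0 < a" "a \<le> 1" using a1 a2 t2 by linarith+
  have s0: "0 < s0" "s0 < pi / 2" "cos s0 = 1 - a / 2"
  proof -
    show "cos s0 = 1 - a / 2" unfolding s0_def using ab by (intro cos_arccos) auto
    show "0 < s0" unfolding s0_def using arccos_less_arccos[of "1 - a / 2" 1] ab by auto
    show "s0 < pi / 2" unfolding s0_def using arccos_less_arccos[of 0 "1 - a / 2"] ab by auto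
  qed
  have "s = s0"
    unfolding s_def t_minus_def c
  proof (rule the_equality)
    fix r assume r: "0 < r \<and> r < pi / 2 \<and> cos r = 1 - a / 2"
    show "r = s0" by (rule cos_inj_pi) (use r s0 in auto)
  qed (use s0 in auto)
  then have "\<alpha> = a" using s0 by (simp add: \<alpha>_def)
  show "0 < s" "s < pi / 2" using s0 \<open>s = s0\<close> by auto
  show "\<gamma> * \<alpha>\<^sup>2 + (1 + t\<^sup>2 / 6) * \<alpha> = t\<^sup>2" "\<alpha> \<le> t\<^sup>2" "3 / 4 * t\<^sup>2 \<le> \<alpha>"
    using quad a1 a2 \<open>\<alpha> = a\<close> by (auto simp: A_def)
qed

section \<open>Taylor estimates of the phase error\<close>

lemma cos_taylor_6: "\<bar>cos t - (1 - t\<^sup>2 / 2 + t ^ 4 / 24)\<bar> \<le> t ^ 6 / 720" for t :: real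
proof -
  obtain z where z: "cos t = (\<Sum>m<6. cos_coeff m * t ^ m) + cos (z + 1 / 2 * real 6 * pi) / fact 6 * t ^ 6"
    using Maclaurin_cos_expansion[of t 6] by blast
  have "(\<Sum>m<6. cos_coeff m * t ^ m) = 1 - t\<^sup>2 / 2 + t ^ 4 / 24"
    by (simp add: lessThan_nat_numeral cos_coeff_def fact_numeral)
  moreover have "\<bar>cos (z + 1 / 2 * real 6 * pi) / fact 6 * t ^ 6\<bar> \<le> 1 / 720 * t ^ 6"
    unfolding abs_mult abs_divide
    by (intro mult_mono) (auto simp: fact_numeral intro!: divide_right_mono)
  ultimately show ?thesis using z by simp
qed

lemma sin_ge_of_cos:
  fixes s t :: real
  assumes "0 < t" "t \<le> 1" "0 < s" "s < pi / 2" "2 - 2 * cos s \<le> t\<^sup>2" "3 / 4 * t\<^sup>2 \<le> 2 - 2 * cos s"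
  shows "3 / 4 * t \<le> sin s"
proof -
  define a where "a = 2 - 2 * cos s"
  have t2: "t\<^sup>2 \<le> 1" using assms by (simp add: power_le_one)
  have "(sin s)\<^sup>2 = a * (1 - a / 4)"
    unfolding sin_squared_eq a_def by (simp add: power2_eq_square field_simps)
  also have "\<dots> \<ge> (3 / 4 * t\<^sup>2) * (3 / 4)"
    using assms t2 by (intro mult_mono) (auto simp: a_def[symmetric])
  finally have "(3 / 4 * t)\<^sup>2 \<le> (sin s)\<^sup>2" by (simp add: power2_eq_square)
  then show ?thesis
    by (rule power2_le_imp_le) (use assms in \<open>auto intro!: sin_ge_zero\<close>)
qed

text \<open>A residual argument: \<alpha> is a root of the quadratic and a its perturbation. Between
  them the quadratic has slope at least 2/3, since \<bar>\<gamma> (a + \<alpha>)\<bar> \<le> 1/3,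
  and \<bar>a - \<alpha>\<bar> \<ge> 3/2 t \<bar>s - t\<bar> by the mean value theorem for cos. The
  two constants cancel.\<close>

lemma phase_error_le:
  fixes \<gamma> t :: real
  assumes t: "0 < t" "t \<le> 1" and \<gamma>: "\<gamma> \<noteq> 0" "\<bar>\<gamma>\<bar> \<le> 1 / 6"
  defines "a \<equiv> 2 - 2 * cos t"
  shows "\<bar>t_minus \<gamma> t - t\<bar> * t \<le> \<bar>\<gamma> * a\<^sup>2 + (1 + t\<^sup>2 / 6) * a - t\<^sup>2\<bar>"
proof -
  define s where "s = t_minus \<gamma> t"
  define \<alpha> where "\<alpha> = 2 - 2 * cos s"
  note P = t_minus_properties[OF t \<gamma>, folded s_def, folded \<alpha>_def]
  have t2: "0 < t\<^sup>2" "t\<^sup>2 \<le> 1" using t by (auto simp: power_le_one)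
  have a: "0 \<le> a" "a \<le> t\<^sup>2" "3 / 4 * t\<^sup>2 \<le> a"
  proof -
    have "t ^ 4 \<le> t\<^sup>2" "t ^ 6 \<le> t ^ 4"
      using t by (intro power_decreasing; simp)+
    moreover have "0 \<le> t ^ 4" "0 \<le> t ^ 6" by simp_all
    moreover have "cos t - (1 - t\<^sup>2 / 2 + t ^ 4 / 24) \<le> t ^ 6 / 720"
      "- (cos t - (1 - t\<^sup>2 / 2 + t ^ 4 / 24)) \<le> t ^ 6 / 720"
      using cos_taylor_6[of t] unfolding abs_le_iff by auto
    ultimately show "0 \<le> a" "a \<le> t\<^sup>2" "3 / 4 * t\<^sup>2 \<le> a"
      using t2 unfolding a_def by linarith+
  qed
  have "t < pi / 2" using t pi_half_gt_zero pi_gt3 by linarith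
  have sins: "3 / 4 * t \<le> sin s" "3 / 4 * t \<le> sin t"
    using sin_ge_of_cos[OF t] P t \<open>t < pi / 2\<close> a by (auto simp: \<alpha>_def a_def)
  have "3 / 4 * t * \<bar>s - t\<bar> \<le> \<bar>cos s - cos t\<bar>"
  proof -
    have *: "3 / 4 * t * (y - x) \<le> cos x - cos y"
      if xy: "0 < x" "x \<le> y" "y < pi / 2" "3 / 4 * t \<le> sin x" for x y
    proof (cases "x = y")
      case False
      then obtain z where z: "x < z" "z < y" "cos y - cos x = (y - x) * - sin z"
        using MVT2[of x y cos "\<lambda>z. - sin z"] xy by (auto intro!: derivative_eq_intros)
      have "sin x \<le> sin z" by (intro sin_monotone_2pi_le) (use z xy in auto)
      then have "(y - x) * (3 / 4 * t) \<le> (y - x) * sin z"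
        using xy by (intro mult_left_mono) auto
      then show ?thesis using z by (simp add: algebra_simps)
    qed auto
    show ?thesis
    proof (cases "s \<le> t")
      case True
      then show ?thesis using *[of s t] P t sins \<open>t < pi / 2\<close> by (simp add: abs_if)
    next
      case False
      then show ?thesis using *[of t s] P t sins \<open>t < pi / 2\<close> by (simp add: abs_if)
    qed
  qed
  then have "3 / 2 * t * \<bar>s - t\<bar> \<le> \<bar>a - \<alpha>\<bar>" by (simp add: a_def \<alpha>_def abs_if split: if_splits)
  moreover have "2 / 3 * \<bar>a - \<alpha>\<bar> \<le> \<bar>\<gamma> * a\<^sup>2 + (1 + t\<^sup>2 / 6) * a - t\<^sup>2\<bar>"
  proof -
    have "\<bar>\<gamma> * (a + \<alpha>)\<bar> \<le> 1 / 6 * 2" unfolding abs_mult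
      using a P t2 \<gamma> by (intro mult_mono) auto
    then have "2 / 3 \<le> \<gamma> * (a + \<alpha>) + (1 + t\<^sup>2 / 6)" using t2 unfolding abs_le_iff by linarith
    then have "2 / 3 * \<bar>a - \<alpha>\<bar> \<le> \<bar>\<gamma> * (a + \<alpha>) + (1 + t\<^sup>2 / 6)\<bar> * \<bar>a - \<alpha>\<bar>"
      by (intro mult_right_mono) auto
    also have "\<dots> = \<bar>(\<gamma> * (a + \<alpha>) + (1 + t\<^sup>2 / 6)) * (a - \<alpha>)\<bar>" by (simp add: abs_mult)
    also have "(\<gamma> * (a + \<alpha>) + (1 + t\<^sup>2 / 6)) * (a - \<alpha>) = \<gamma> * a\<^sup>2 + (1 + t\<^sup>2 / 6) * a - t\<^sup>2"
    proof -
      have "(\<gamma> * (a + \<alpha>) + (1 + t\<^sup>2 / 6)) * (a - \<alpha>)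
          = (\<gamma> * a\<^sup>2 + (1 + t\<^sup>2 / 6) * a) - (\<gamma> * \<alpha>\<^sup>2 + (1 + t\<^sup>2 / 6) * \<alpha>)"
        by (simp add: power2_eq_square field_simps)
      then show ?thesis using P(3) by simp
    qed
    finally show ?thesis .
  qed
  ultimately show ?thesis by (simp add: s_def mult_ac)
qed

text \<open>The remainder becomes an exact term d t^6, so that the residuals below can be expanded
  as polynomial identities.\<close>

lemma cos_taylor_powers:
  fixes t :: real
  assumes t: "0 < t" "t \<le> 1"
  obtains d where "2 - 2 * cos t = t\<^sup>2 - t ^ 4 / 12 + d * t ^ 6" "\<bar>d\<bar> \<le> 1 / 360"
proof -
  define d where "d = (2 - 2 * cos t - (t\<^sup>2 - t ^ 4 / 12)) / t ^ 6"
  have "2 - 2 * cos t = t\<^sup>2 - t ^ 4 / 12 + d * t ^ 6" unfolding d_def using t by simp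
  moreover have "\<bar>d\<bar> \<le> 1 / 360"
  proof -
    have "\<bar>2 - 2 * cos t - (t\<^sup>2 - t ^ 4 / 12)\<bar> \<le> t ^ 6 / 360"
      using cos_taylor_6[of t] unfolding abs_le_iff by auto
    then show ?thesis using t by (simp add: d_def divide_le_eq)
  qed
  ultimately show ?thesis using that by blast
qed

text \<open>a = t^2 q with q close to 1, so the terms of order t^2 cancel and the residual is t^4
  times a bounded factor; \<open>phase_error_le\<close> costs one power of t.\<close>

lemma phase_error_cubic:
  fixes \<gamma> t :: real
  assumes t: "0 < t" "t \<le> 1" and \<gamma>: "\<gamma> \<noteq> 0" "\<bar>\<gamma>\<bar> \<le> 1 / 6"
  shows "\<bar>t_minus \<gamma> t - t\<bar> \<le> t ^ 3"
proof -
  obtain d where d: "2 - 2 * cos t = t\<^sup>2 - t ^ 4 / 12 + d * t ^ 6" "\<bar>d\<bar> \<le> 1 / 360"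
    using cos_taylor_powers[OF t] by blast
  define q where "q = 1 - t\<^sup>2 / 12 + d * t ^ 4"
  have t2: "0 < t\<^sup>2" "t\<^sup>2 \<le> 1" "0 \<le> t ^ 4" "t ^ 4 \<le> 1" using t by (auto simp: power_le_one)
  have dt: "\<bar>d * t\<^sup>2\<bar> \<le> 1 / 360 * 1" "\<bar>d * t ^ 4\<bar> \<le> 1 / 360 * 1"
    unfolding abs_mult by (intro mult_mono; use d t2 in simp)+
  have a: "2 - 2 * cos t = t\<^sup>2 * q" unfolding d(1) q_def by (simp add: eval_nat_numeral algebra_simps)
  have q: "\<bar>q\<bar> \<le> 1 + 1 / 360" using dt t2 unfolding q_def abs_le_iff by linarith
  have q2: "q\<^sup>2 \<le> (1 + 1 / 360)\<^sup>2" using power_mono[OF q, of 2] by simp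
  have gq: "\<bar>\<gamma> * q\<^sup>2\<bar> \<le> 1 / 6 * (1 + 1 / 360)\<^sup>2"
    unfolding abs_mult by (intro mult_mono) (use \<gamma> q2 in auto)
  have "\<gamma> * (2 - 2 * cos t)\<^sup>2 + (1 + t\<^sup>2 / 6) * (2 - 2 * cos t) - t\<^sup>2
      = t ^ 4 * (\<gamma> * q\<^sup>2 + q / 6 - 1 / 12 + d * t\<^sup>2)"
    unfolding a by (simp add: q_def power2_eq_square eval_nat_numeral field_simps)
  also have "\<bar>\<dots>\<bar> \<le> t ^ 4 * 1"
    unfolding abs_mult
  proof (intro mult_mono)
    show "\<bar>\<gamma> * q\<^sup>2 + q / 6 - 1 / 12 + d * t\<^sup>2\<bar> \<le> 1"
      using gq q dt unfolding abs_le_iff by (simp add: power2_eq_square)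
  qed auto
  finally have "\<bar>t_minus \<gamma> t - t\<bar> * t \<le> t ^ 3 * t"
    using phase_error_le[OF t \<gamma>] by (simp add: eval_nat_numeral)
  then show ?thesis using t by (metis mult_le_cancel_right_pos)
qed

text \<open>The coefficient of t^4 in the residual is \<gamma> + 1/6 - 1/12 = \<gamma> + 1/12. The
  choice \<gamma> = -1/12 removes it and leaves t^6.\<close>

lemma phase_error_quintic:
  fixes t :: real
  assumes t: "0 < t" "t \<le> 1"
  shows "\<bar>t_minus (- 1 / 12) t - t\<bar> \<le> t ^ 5"
proof -
  obtain d where d: "2 - 2 * cos t = t\<^sup>2 - t ^ 4 / 12 + d * t ^ 6" "\<bar>d\<bar> \<le> 1 / 360"
    using cos_taylor_powers[OF t] by blast
  define r where "r = - 1 / 12 + d * t\<^sup>2"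
  have t2: "0 < t\<^sup>2" "t\<^sup>2 \<le> 1" "0 \<le> t ^ 4" "t ^ 4 \<le> 1" using t by (auto simp: power_le_one)
  have dt: "\<bar>d * t\<^sup>2\<bar> \<le> 1 / 360 * 1"
    unfolding abs_mult by (intro mult_mono; use d t2 in simp)+
  have a: "2 - 2 * cos t = t\<^sup>2 + t ^ 4 * r" unfolding d(1) r_def by (simp add: eval_nat_numeral algebra_simps)
  have r: "\<bar>r\<bar> \<le> 1" using dt unfolding r_def abs_le_iff by linarith
  have "\<bar>t\<^sup>2 * r\<^sup>2\<bar> \<le> 1 * 1" unfolding abs_mult by (intro mult_mono) (use t2 r in \<open>auto simp: abs_square_le_1\<close>)
  then have r2: "\<bar>t\<^sup>2 * r\<^sup>2\<bar> \<le> 1" by simp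
  have "(- 1 / 12) * (2 - 2 * cos t)\<^sup>2 + (1 + t\<^sup>2 / 6) * (2 - 2 * cos t) - t\<^sup>2
      = t ^ 6 * (d - t\<^sup>2 * r\<^sup>2 / 12)"
  proof -
    have "t ^ 4 * r = - (t ^ 4 / 12) + d * t ^ 6"
      unfolding r_def by (simp add: eval_nat_numeral algebra_simps)
    then show ?thesis
      unfolding a by (simp add: power2_eq_square eval_nat_numeral algebra_simps)
  qed
  also have "\<bar>\<dots>\<bar> \<le> t ^ 6 * 1"
    unfolding abs_mult
  proof (intro mult_mono)
    show "\<bar>d - t\<^sup>2 * r\<^sup>2 / 12\<bar> \<le> 1"
      using r2 d unfolding abs_le_iff by linarith
  qed auto
  finally have "\<bar>t_minus (- 1 / 12) t - t\<bar> * t \<le> t ^ 5 * t"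
    using phase_error_le[OF t, of "- 1 / 12"] by (simp add: eval_nat_numeral)
  then show ?thesis using t by (metis mult_le_cancel_right_pos)
qed

text \<open>The residual is affine in \<gamma> and \<open>gamma_o t\<close> is its zero, the value
  without phase error. Taylor expansion enters only through 2 (1 - cos t) \<le> t^2.\<close>

lemma phase_error_gamma_o:
  fixes \<gamma> t :: real
  assumes t: "0 < t" "t \<le> 1" and \<gamma>: "\<gamma> \<noteq> 0" "\<bar>\<gamma>\<bar> \<le> 1 / 6"
  shows "\<bar>t_minus \<gamma> t - t\<bar> \<le> \<bar>\<gamma> - gamma_o t\<bar> * t ^ 3"
proof -
  define w where "w = 1 - cos t"
  have "cos t < cos 0" by (rule cos_monotone_0_pi) (use t pi_gt3 in auto)
  then have w: "w > 0" by (simp add: w_def)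
  have c: "cos t = 1 - w" by (simp add: w_def)
  have wt: "2 * w \<le> t\<^sup>2"
  proof -
    have "t ^ 6 \<le> t ^ 4" using t by (intro power_decreasing) auto
    moreover have "0 \<le> t ^ 4" by simp
    ultimately show ?thesis using cos_taylor_6[of t] unfolding w_def abs_le_iff by auto
  qed
  have "\<gamma> * (2 - 2 * cos t)\<^sup>2 + (1 + t\<^sup>2 / 6) * (2 - 2 * cos t) - t\<^sup>2 = (\<gamma> - gamma_o t) * (2 * w)\<^sup>2"
    unfolding gamma_o_def c using w by (simp add: field_simps power2_eq_square)
  also have "\<bar>\<dots>\<bar> \<le> \<bar>\<gamma> - gamma_o t\<bar> * (t\<^sup>2)\<^sup>2"
  proof -
    have "(2 * w)\<^sup>2 \<le> (t\<^sup>2)\<^sup>2" using w wt by (intro power_mono) auto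
    then show ?thesis unfolding abs_mult abs_power2 by (rule mult_left_mono) simp
  qed
  finally have "\<bar>t_minus \<gamma> t - t\<bar> * t \<le> (\<bar>\<gamma> - gamma_o t\<bar> * t ^ 3) * t"
    using phase_error_le[OF t \<gamma>] by (simp add: eval_nat_numeral mult_ac)
  then show ?thesis using t by (metis mult_le_cancel_right_pos)
qed

section \<open>Stability of the nodal recurrence\<close>

text \<open>Together with the upward shift below, this bounds the off-diagonal part of a second
  difference by 2 in the discrete l2 norm. The condition at 0 is met by W.\<close>

lemma L2_set_shift_down_le:
  fixes x :: "nat \<Rightarrow> real"
  assumes "x 0 = 0"
  shows "L2_set (\<lambda>j. x (j - 1)) {1..n} \<le> L2_set x {1..n}"
proof -
  have "(\<Sum>j\<in>{1..n}. (x (j - 1))\<^sup>2) = (\<Sum>j\<in>{..<n}. (x j)\<^sup>2)"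
    by (rule sum.reindex_bij_witness[of _ Suc "\<lambda>j. j - 1"]) auto
  also have "\<dots> \<le> (\<Sum>j\<in>{0..n}. (x j)\<^sup>2)"
    by (rule sum_mono2) auto
  also have "\<dots> = (\<Sum>j\<in>{1..n}. (x j)\<^sup>2)"
    using assms by (simp add: sum.atLeast_Suc_atMost)
  finally show ?thesis by (simp add: L2_set_def)
qed

lemma L2_set_shift_up_le:
  fixes x :: "nat \<Rightarrow> real"
  shows "L2_set (\<lambda>j. if j < n then x (j + 1) else 0) {1..n} \<le> L2_set x {1..n}"
proof -
  have "(\<Sum>j\<in>{1..n}. (if j < n then x (j + 1) else 0)\<^sup>2) = (\<Sum>j\<in>{1..<n}. (x (j + 1))\<^sup>2)"
    by (rule sum.mono_neutral_cong_right) auto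
  also have "\<dots> = (\<Sum>j\<in>{2..n}. (x j)\<^sup>2)"
    by (rule sum.reindex_bij_witness[of _ "\<lambda>j. j - 1" Suc]) auto
  also have "\<dots> \<le> (\<Sum>j\<in>{1..n}. (x j)\<^sup>2)"
    by (rule sum_mono2) auto
  finally show ?thesis by (simp add: L2_set_def)
qed

text \<open>The finite element equations in terms of the nodal values \<open>U\<close> and their second differences
  \<open>E\<close>; at the last node \<open>E\<close> encodes the fictitious value \<open>U (n + 1) = (1 + \<i>t) U n\<close>.
  The numbers \<open>-\<alpha>\<close>, \<open>-\<beta>\<close> are the roots of the symbol \<open>\<gamma>X\<^sup>2 - (1 + t\<^sup>2/6)X - t\<^sup>2\<close> of the scheme:
  \<open>\<alpha>\<close> belongs to the propagating, \<open>\<beta>\<close> to the evanescent mode.\<close>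

locale cip_recurrence =
  fixes n :: nat and t \<gamma> s \<alpha> \<beta> :: real and U E b :: "nat \<Rightarrow> complex"
  assumes n: "1 \<le> n" and t: "0 < t" "t \<le> 1" and \<gamma>: "\<gamma> \<noteq> 0" "\<bar>\<gamma>\<bar> \<le> 1 / 6"
    and s: "0 < s" "s < pi / 2"
    and \<alpha>: "\<alpha> = 2 - 2 * cos s" "\<gamma> * \<alpha>\<^sup>2 + (1 + t\<^sup>2 / 6) * \<alpha> = t\<^sup>2" "\<alpha> \<le> t\<^sup>2" "3 / 4 * t\<^sup>2 \<le> \<alpha>"
    and \<beta>: "\<beta> = - (t\<^sup>2 / (\<gamma> * \<alpha>))"
    and U0: "U 0 = 0" and E0: "E 0 = 0"
    and E_inner: "\<And>j. 1 \<le> j \<Longrightarrow> j < n \<Longrightarrow> E j = U (j - 1) - 2 * U j + U (j + 1)"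
    and E_last: "E n = U (n - 1) - (1 - \<i> * t) * U n"
    and row_inner: "\<And>j. 1 \<le> j \<Longrightarrow> j < n \<Longrightarrow>
      \<gamma> * (E (j - 1) - 2 * E j + E (j + 1)) - of_real (1 + t\<^sup>2 / 6) * E j - of_real (t\<^sup>2) * U j = b j"
    and row_last: "\<gamma> * (E (n - 1) - (1 - \<i> * t) * E n) - of_real (1 + t\<^sup>2 / 6) * E n
      - of_real (t\<^sup>2) * U n + of_real (t\<^sup>2) * (1 / 2 + \<i> * t / 6) * U n = b n"
begin

definition Y :: "nat \<Rightarrow> complex" where "Y j = U j + E j / \<beta>"
definition W :: "nat \<Rightarrow> complex" where "W j = E j + \<alpha> * U j"
text \<open>By \<open>vieta\<close>, this is -1 / (\<gamma> \<beta>), the scaling of the load in the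
  equation for Y. It tends to 1 as t tends to 0.\<close>

definition lam :: complex where "lam = of_real (\<alpha> / t\<^sup>2)"
text \<open>\<open>b 0\<close> does not enter the recurrence; adding the load of the hat function at \<open>0\<close> completes the
  partition of unity in the sums below and is harmless because \<open>Y\<close> vanishes there.\<close>

definition amplitude :: complex where "amplitude = Y 1 + lam * b 0"
definition residual :: "real \<Rightarrow> nat \<Rightarrow> complex" where
  "residual \<sigma> j = amplitude - lam * (\<Sum>m\<le>j. b m * cis (real m * \<sigma>))"
text \<open>Two sizes of the load: W is controlled in l2, whereas the waves, having kernels of
  modulus 1, are controlled by the l1 size \<open>load\<close>.\<close>

definition load2 :: real where "load2 = L2_set (\<lambda>j. norm (b j)) {1..n}"
definition load :: real where "load = (\<Sum>m\<le>n. norm (b m))"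

section \<open>Roots of the symbol and factorization of the rows\<close>

lemma t2: "0 < t\<^sup>2" "t\<^sup>2 \<le> 1"
  using t by (auto simp: power_le_one)

lemma \<alpha>_bounds: "0 < \<alpha>" "\<alpha> \<le> 1"
  using \<alpha>(3,4) t2 by linarith+

lemma \<alpha>_div_t2: "0 \<le> \<alpha> / t\<^sup>2" "\<alpha> / t\<^sup>2 \<le> 1"
  using \<alpha>_bounds \<alpha>(3) t2 by (auto simp: divide_le_eq)

lemma \<beta>_nonzero: "\<beta> \<noteq> 0"
  using \<gamma> \<alpha>_bounds t2 by (simp add: \<beta>)

lemma vieta: "\<gamma> * (\<alpha> + \<beta>) = - (1 + t\<^sup>2 / 6)" "\<gamma> * \<alpha> * \<beta> = - t\<^sup>2"
proof -
  have "\<alpha> * (\<gamma> * (\<alpha> + \<beta>)) = \<gamma> * \<alpha>\<^sup>2 - t\<^sup>2"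
    using \<gamma> \<alpha>_bounds by (simp add: \<beta> power2_eq_square algebra_simps)
  also have "\<dots> = \<alpha> * - (1 + t\<^sup>2 / 6)"
    using \<alpha>(2) by (simp add: algebra_simps)
  finally show "\<gamma> * (\<alpha> + \<beta>) = - (1 + t\<^sup>2 / 6)" using \<alpha>_bounds by simp
  show "\<gamma> * \<alpha> * \<beta> = - t\<^sup>2" using \<gamma> \<alpha>_bounds by (simp add: \<beta>)
qed

text \<open>\<beta> has the sign opposite to \<gamma>, so only its modulus is available. The factor
  6/5 is \<bar>\<beta>\<bar> / (\<bar>\<beta>\<bar> - 1) at the worst value \<bar>\<beta>\<bar> =
  6.\<close>

lemma \<beta>_bounds: "6 \<le> \<bar>\<beta>\<bar>" "5 \<le> \<bar>\<beta> - \<alpha>\<bar>" "\<bar>\<beta>\<bar> \<le> 6 / 5 * \<bar>\<beta> - \<alpha>\<bar>"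
proof -
  have "6 * \<bar>\<gamma> * \<alpha>\<bar> \<le> 6 * (1 / 6 * \<alpha>)"
    unfolding abs_mult using \<gamma> \<alpha>_bounds by (simp add: mult_right_mono)
  then have "6 * \<bar>\<gamma> * \<alpha>\<bar> \<le> t\<^sup>2" using \<alpha>(3) by linarith
  then show 6: "6 \<le> \<bar>\<beta>\<bar>" using \<gamma> \<alpha>_bounds by (simp add: \<beta> abs_divide le_divide_eq)
  have "\<bar>\<beta>\<bar> \<le> \<bar>\<beta> - \<alpha>\<bar> + 1" using \<alpha>_bounds by linarith
  with 6 show "5 \<le> \<bar>\<beta> - \<alpha>\<bar>" "\<bar>\<beta>\<bar> \<le> 6 / 5 * \<bar>\<beta> - \<alpha>\<bar>" by (simp_all add: field_simps)
qed

lemma \<beta>_\<alpha>_nonzero: "complex_of_real \<beta> - complex_of_real \<alpha> \<noteq> 0"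
  using \<beta>_bounds(2) by (simp flip: of_real_diff)

text \<open>Stated for either ordering of \<alpha> and \<beta>: (\<alpha>, \<beta>) gives the
  equation for \<beta> Y, (\<beta>, \<alpha>) that for W. The last row factors too because
  \<open>E n\<close> is formed from U just as the boundary row acts on E; only the defect of the
  half hat is left over.\<close>

lemma factored_rows:
  fixes x y :: real and X :: "nat \<Rightarrow> complex"
  assumes "\<gamma> * (x + y) = - (1 + t\<^sup>2 / 6)" "\<gamma> * x * y = - t\<^sup>2"
  defines "X \<equiv> \<lambda>j. E j + y * U j"
  shows "1 \<le> j \<Longrightarrow> j < n \<Longrightarrow> \<gamma> * (X (j - 1) - 2 * X j + X (j + 1) + x * X j) = b j"
    and "\<gamma> * (X (n - 1) - (1 - \<i> * t) * X n + x * X n)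
      = b n - of_real (t\<^sup>2) * (1 / 2 + \<i> * t / 6) * U n"
proof -
  have v: "of_real \<gamma> * (of_real x + of_real y) = - (of_real (1 + t\<^sup>2 / 6) :: complex)"
    "of_real \<gamma> * of_real x * of_real y = - (of_real (t\<^sup>2) :: complex)"
    by (metis assms(1) of_real_add of_real_minus of_real_mult)
      (metis assms(2) of_real_minus of_real_mult)
  show "\<gamma> * (X (j - 1) - 2 * X j + X (j + 1) + x * X j) = b j" if "1 \<le> j" "j < n"
  proof -
    have "\<gamma> * (X (j - 1) - 2 * X j + X (j + 1) + x * X j)
      = \<gamma> * (E (j - 1) - 2 * E j + E (j + 1)) + (of_real \<gamma> * (of_real x + of_real y)) * E j
        + (of_real \<gamma> * of_real x * of_real y) * U j"
      unfolding X_def E_inner[OF that] by (simp add: algebra_simps)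
    then show ?thesis unfolding v using row_inner[OF that] by (simp only: mult_minus_left diff_conv_add_uminus)
  qed
  have "\<gamma> * (X (n - 1) - (1 - \<i> * t) * X n + x * X n)
    = \<gamma> * (E (n - 1) - (1 - \<i> * t) * E n) + (of_real \<gamma> * (of_real x + of_real y)) * E n
      + (of_real \<gamma> * of_real x * of_real y) * U n
      + of_real \<gamma> * of_real y * (U (n - 1) - (1 - \<i> * t) * U n - E n)"
    unfolding X_def by (simp add: algebra_simps)
  also have "\<dots> = b n - of_real (t\<^sup>2) * (1 / 2 + \<i> * t / 6) * U n"
    unfolding v
  proof -
    have z: "U (n - 1) - (1 - \<i> * t) * U n - E n = 0" by (simp add: E_last)
    have aux: "P + - A * e + - T * u + g * 0 = r - c" if "P - A * e - T * u + c = r"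
      for P A e T u g c r :: complex
      using that by (auto simp: algebra_simps)
    show "of_real \<gamma> * (E (n - 1) - (1 - \<i> * t) * E n) + - of_real (1 + t\<^sup>2 / 6) * E n
      + - of_real (t\<^sup>2) * U n + of_real \<gamma> * of_real y * (U (n - 1) - (1 - \<i> * t) * U n - E n)
      = b n - of_real (t\<^sup>2) * (1 / 2 + \<i> * t / 6) * U n"
      unfolding z by (rule aux[OF row_last])
  qed
  finally show "\<gamma> * (X (n - 1) - (1 - \<i> * t) * X n + x * X n)
      = b n - of_real (t\<^sup>2) * (1 / 2 + \<i> * t / 6) * U n" .
qed

lemma \<beta>_Y: "\<beta> * Y j = E j + \<beta> * U j"
  using \<beta>_nonzero by (simp add: Y_def distrib_left)

lemma divide_by_\<gamma>\<beta>:
  assumes "of_real \<gamma> * of_real \<beta> * x = (r :: complex)"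
  shows "x = - lam * r"
proof -
  have "\<gamma> * \<beta> * (\<alpha> / t\<^sup>2) = -1" using vieta(2) t2 by (simp add: field_simps)
  then have "of_real \<gamma> * of_real \<beta> * lam = (-1 :: complex)"
    unfolding lam_def by (metis of_real_1 of_real_minus of_real_mult)
  then have "of_real \<gamma> * of_real \<beta> * x = of_real \<gamma> * of_real \<beta> * (- lam * r)"
    using assms by (metis mult.assoc mult_1 mult_minus_left mult_minus_right minus_minus)
  moreover have "of_real \<gamma> * of_real \<beta> \<noteq> (0 :: complex)" using \<gamma> \<beta>_nonzero by simp
  ultimately show ?thesis using mult_left_cancel by blast
qed

lemma Y_rec:
  assumes "1 \<le> j" "j < n"
  shows "Y (j - 1) - 2 * Y j + Y (j + 1) + \<alpha> * Y j = - lam * b j"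
  by (rule divide_by_\<gamma>\<beta>)
    (use factored_rows(1)[OF vieta assms, folded \<beta>_Y] in \<open>simp add: algebra_simps\<close>)

lemma Y_last:
  "Y (n - 1) - (1 - \<i> * t) * Y n + \<alpha> * Y n = - lam * b n + \<alpha> * (1 / 2 + \<i> * t / 6) * U n"
proof -
  have "Y (n - 1) - (1 - \<i> * t) * Y n + \<alpha> * Y n
    = - lam * (b n - of_real (t\<^sup>2) * (1 / 2 + \<i> * t / 6) * U n)"
    by (rule divide_by_\<gamma>\<beta>)
      (use factored_rows(2)[OF vieta, folded \<beta>_Y] in \<open>simp add: algebra_simps\<close>)
  also have "\<dots> = - lam * b n + of_real (\<alpha> / t\<^sup>2 * t\<^sup>2) * (1 / 2 + \<i> * t / 6) * U n"
    unfolding lam_def by (simp add: algebra_simps)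
  also have "\<alpha> / t\<^sup>2 * t\<^sup>2 = \<alpha>" using t2 by simp
  finally show ?thesis .
qed

lemma U_eq: "(\<beta> - \<alpha>) * U j = \<beta> * Y j - W j"
  using \<beta>_nonzero by (simp add: Y_def W_def algebra_simps)

lemma Y0: "Y 0 = 0" and W0: "W 0 = 0"
  by (simp_all add: Y_def W_def U0 E0)

lemma cis_sum: "cis s + cis (- s) = 2 - \<alpha>"
  by (simp add: \<alpha> complex_eq_iff)

text \<open>The second-order operator factors: with Z j = Y (j+1) - cis \<sigma> Y j, the recurrence
  for Y says that Z j - cis (-\<sigma>) Z (j-1) is a load, and cis (j \<sigma>) is the summation
  factor of this first-order recurrence. For \<sigma> = s this is the discrete analogue of cis(kx)
  (u' - iku).\<close>

lemma residual_eq: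
  assumes \<sigma>: "\<sigma> = s \<or> \<sigma> = - s" and "j < n"
  shows "cis (real j * \<sigma>) * (Y (j + 1) - cis \<sigma> * Y j) = residual \<sigma> j"
  using \<open>j < n\<close>
proof (induction j)
  case 0
  then show ?case by (simp add: residual_def amplitude_def Y0)
next
  case (Suc j)
  have rec: "Y (j + 2) = (cis \<sigma> + cis (- \<sigma>)) * Y (j + 1) - Y j - lam * b (Suc j)"
  proof -
    have cs: "cis \<sigma> + cis (- \<sigma>) = 2 - \<alpha>" using \<sigma> cis_sum by (auto simp: add.commute)
    show ?thesis unfolding cs using Y_rec[of "Suc j"] Suc.prems by (simp add: algebra_simps)
  qed
  have "cis (real (Suc j) * \<sigma>) * (Y (Suc j + 1) - cis \<sigma> * Y (Suc j))
      = cis (real (Suc j) * \<sigma>) * (cis (- \<sigma>) * Y (j + 1) - Y j) - lam * (b (Suc j) * cis (real (Suc j) * \<sigma>))"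
  proof -
    have "Y (Suc j + 1) - cis \<sigma> * Y (Suc j)
        = (cis (- \<sigma>) * Y (j + 1) - Y j) - lam * b (Suc j)"
      using rec by (simp add: algebra_simps)
    then show ?thesis by (simp only: right_diff_distrib mult_ac)
  qed
  also have "cis (real (Suc j) * \<sigma>) * (cis (- \<sigma>) * Y (j + 1) - Y j) = cis (real j * \<sigma>) * (Y (j + 1) - cis \<sigma> * Y j)"
  proof -
    have "cis (real (Suc j) * \<sigma>) = cis (real j * \<sigma>) * cis \<sigma>" by (simp add: cis_mult algebra_simps)
    moreover have "cis \<sigma> * cis (- \<sigma>) = 1" by (simp add: cis_mult)
    ultimately show ?thesis by (simp add: algebra_simps)
  qed
  also have "\<dots> = residual \<sigma> j" using Suc by simp
  finally show ?case by (simp add: residual_def algebra_simps)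
qed

text \<open>There is no \<open>Y (n + 1)\<close>: the first-order recurrence runs up to n - 1, and
  the last step is taken from the boundary row \<open>Y_last\<close>.\<close>

lemma residual_last:
  assumes \<sigma>: "\<sigma> = s \<or> \<sigma> = - s"
  shows "residual \<sigma> n = cis (real n * \<sigma>)
    * (cis (- \<sigma>) * Y n - \<alpha> * (1 / 2 + \<i> * t / 6) * U n - (1 - \<i> * t - \<alpha>) * Y n)"
proof -
  obtain m where m: "n = Suc m" using n by (cases n) auto
  have "residual \<sigma> n = residual \<sigma> m - lam * b n * cis (real n * \<sigma>)"
    unfolding m by (simp add: residual_def algebra_simps)
  also have "residual \<sigma> m = cis (real m * \<sigma>) * (Y n - cis \<sigma> * Y m)"
    using residual_eq[OF \<sigma>, of m] m by simp
  also have "\<dots> = cis (real n * \<sigma>) * (cis (- \<sigma>) * Y n - Y m)"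
  proof -
    have "cis (real n * \<sigma>) = cis (real m * \<sigma>) * cis \<sigma>" by (simp add: m cis_mult algebra_simps)
    moreover have "cis \<sigma> * cis (- \<sigma>) = 1" by (simp add: cis_mult)
    ultimately show ?thesis by (simp add: algebra_simps)
  qed
  also have "Y m = - lam * b n + \<alpha> * (1 / 2 + \<i> * t / 6) * U n + (1 - \<i> * t - \<alpha>) * Y n"
    using Y_last by (simp add: m algebra_simps)
  finally show ?thesis by (simp add: algebra_simps)
qed

text \<open>The two first-order differences are combined with the weights 1 / (1 + cis s) and 1 / (1
  + cis (-s)), whose sum is 1. These stay near 1/2, whereas solving for Y itself would require
  division by sin s.\<close>

lemma difference_Y:
  assumes "j < n"
  shows "Y (j + 1) - Y j = cis (- (real j * s)) * residual s j / (1 + cis s)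
    + cis (real j * s) * residual (- s) j / (1 + cis (- s))"
proof -
  have c: "cos s > 0" using s by (intro cos_gt_zero) auto
  have nz: "1 + cis s \<noteq> 0" "1 + cis (- s) \<noteq> 0" using c by (auto simp: complex_eq_iff)
  have "cis (- (real j * s)) * residual s j = Y (j + 1) - cis s * Y j"
    "cis (real j * s) * residual (- s) j = Y (j + 1) - cis (- s) * Y j"
    using assms by (simp_all add: cis_mult mult.assoc[symmetric] flip: residual_eq)
  moreover have "Y (j + 1) - Y j = (Y (j + 1) - cis s * Y j) / (1 + cis s)
    + (Y (j + 1) - cis (- s) * Y j) / (1 + cis (- s))"
  proof -
    have cc: "cis s * cis (- s) = 1" by (simp add: cis_mult)
    have "(Y (j + 1) - cis s * Y j) * (1 + cis (- s)) + (Y (j + 1) - cis (- s) * Y j) * (1 + cis s)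
      = (Y (j + 1) - Y j) * (2 + cis s + cis (- s)) + 2 * Y j * (1 - cis s * cis (- s))"
      by (simp add: algebra_simps)
    also have "\<dots> = (Y (j + 1) - Y j) * ((1 + cis s) * (1 + cis (- s)))"
      using cc by (simp add: algebra_simps)
    finally show ?thesis using nz by (simp add: add_frac_eq eq_divide_eq)
  qed
  ultimately show ?thesis by simp
qed

lemma difference_U:
  "(\<beta> - \<alpha>) * (U (j + 1) - U j) = \<beta> * (Y (j + 1) - Y j) - (W (j + 1) - W j)"
proof -
  have "(\<beta> - \<alpha>) * (U (j + 1) - U j) = (\<beta> - \<alpha>) * U (j + 1) - (\<beta> - \<alpha>) * U j"
    by (rule right_diff_distrib)
  also have "\<dots> = (\<beta> * Y (j + 1) - W (j + 1)) - (\<beta> * Y j - W j)" by (simp only: U_eq)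
  finally show ?thesis by (simp add: algebra_simps)
qed


section \<open>A priori bounds for the evanescent mode and at the right end\<close>

lemma norm_half_plus: "norm (1 / 2 + \<i> * t / 6 :: complex) \<le> 53 / 100"
proof -
  have "(norm (1 / 2 + \<i> * t / 6 :: complex))\<^sup>2 = 1 / 4 + t\<^sup>2 / 36"
    by (simp add: cmod_def power2_eq_square)
  also have "\<dots> \<le> (53 / 100)\<^sup>2" using t2 by (simp add: power2_eq_square)
  finally show ?thesis by (rule power2_le_imp_le) simp
qed

lemma norm_U_last: "norm (U n) \<le> 6 / 5 * norm (Y n) + norm (W n) / 5"
proof -
  have "U n = (\<beta> * Y n - W n) / (\<beta> - \<alpha>)"
    using U_eq[of n] \<beta>_\<alpha>_nonzero by (simp add: eq_divide_eq mult.commute)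
  then have "norm (U n) = norm (\<beta> * Y n - W n) / \<bar>\<beta> - \<alpha>\<bar>"
    by (simp add: norm_divide flip: of_real_diff)
  also have "\<dots> \<le> (\<bar>\<beta>\<bar> * norm (Y n) + norm (W n)) / \<bar>\<beta> - \<alpha>\<bar>"
    using norm_triangle_ineq4[of "\<beta> * Y n" "W n"] by (intro divide_right_mono) (auto simp: norm_mult)
  also have "\<dots> = \<bar>\<beta>\<bar> / \<bar>\<beta> - \<alpha>\<bar> * norm (Y n) + norm (W n) / \<bar>\<beta> - \<alpha>\<bar>"
    by (simp add: add_divide_distrib)
  also have "\<dots> \<le> 6 / 5 * norm (Y n) + norm (W n) / 5"
  proof (intro add_mono mult_right_mono)
    show "\<bar>\<beta>\<bar> / \<bar>\<beta> - \<alpha>\<bar> \<le> 6 / 5" using \<beta>_bounds by (simp add: divide_le_eq)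
    show "norm (W n) / \<bar>\<beta> - \<alpha>\<bar> \<le> norm (W n) / 5" using \<beta>_bounds by (intro divide_left_mono) auto
  qed auto
  finally show ?thesis .
qed

text \<open>Diagonal dominance: \<open>\<bar>\<beta>\<bar> \<ge> 6\<close>, while the second difference operator has norm at most 4.\<close>

lemma W_bound_aux:
  "L2_set (\<lambda>j. norm (W j)) {1..n} \<le> 3 * load2 + 159 / 100 * \<alpha> * norm (U n)"
proof -
  define w where "w = L2_set (\<lambda>j. norm (W j)) {1..n}"
  define c :: complex where "c = of_real (t\<^sup>2) * (1 / 2 + \<i> * t / 6) * U n"
  have vieta': "\<gamma> * (\<beta> + \<alpha>) = - (1 + t\<^sup>2 / 6)" "\<gamma> * \<beta> * \<alpha> = - t\<^sup>2"
    using vieta by (simp_all add: algebra_simps)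
  note rows = factored_rows[OF vieta', folded W_def]
  have norm1: "norm (1 - \<i> * t :: complex) \<le> 2"
    using norm_triangle_ineq4[of 1 "\<i> * of_real t :: complex"] t by (simp add: norm_mult)
  have pointwise: "\<bar>\<beta>\<bar> * norm (W j) \<le> (((1 / \<bar>\<gamma>\<bar>) * norm (b j) + (if j = n then norm c / \<bar>\<gamma>\<bar> else 0))
      + 2 * norm (W j)) + (norm (W (j - 1)) + (if j < n then norm (W (j + 1)) else 0))"
    if "j \<in> {1..n}" for j
  proof (cases "j < n")
    case True
    have "\<gamma> * (W (j - 1) - 2 * W j + W (j + 1) + \<beta> * W j) = b j"
      using rows(1)[of j] that True by simp
    then have "\<beta> * W j = b j / \<gamma> + 2 * W j - W (j - 1) - W (j + 1)"
      using \<gamma> by (simp add: field_simps)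
    also have "norm \<dots> \<le> norm (b j / \<gamma>) + norm (2 * W j) + norm (W (j - 1)) + norm (W (j + 1))"
      by (rule order_trans[OF norm_triangle_ineq4 add_right_mono[OF order_trans[OF norm_triangle_ineq4
            add_right_mono[OF norm_triangle_ineq]]]])
    finally show ?thesis using True by (simp add: norm_mult norm_divide)
  next
    case False
    then have j: "j = n" using that by auto
    have "\<gamma> * (W (n - 1) - (1 - \<i> * t) * W n + \<beta> * W n) = b n - c"
      using rows(2) by (simp add: c_def)
    then have "\<beta> * W n = b n / \<gamma> - c / \<gamma> + (1 - \<i> * t) * W n - W (n - 1)"
      using \<gamma> by (simp add: field_simps)
    also have "norm \<dots> \<le> norm (b n / \<gamma>) + norm (c / \<gamma>) + norm ((1 - \<i> * t) * W n) + norm (W (n - 1))"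
      by (rule order_trans[OF norm_triangle_ineq4 add_right_mono[OF order_trans[OF norm_triangle_ineq
            add_right_mono[OF norm_triangle_ineq4]]]])
    also have "norm ((1 - \<i> * t) * W n) \<le> 2 * norm (W n)"
      unfolding norm_mult using norm1 by (rule mult_right_mono) simp
    finally show ?thesis by (simp add: j norm_mult norm_divide)
  qed
  have "\<bar>\<beta>\<bar> * w = L2_set (\<lambda>j. \<bar>\<beta>\<bar> * norm (W j)) {1..n}"
    by (simp add: w_def L2_set_right_distrib)
  also have "\<dots> \<le> L2_set (\<lambda>j. (((1 / \<bar>\<gamma>\<bar>) * norm (b j) + (if j = n then norm c / \<bar>\<gamma>\<bar> else 0))
      + 2 * norm (W j)) + (norm (W (j - 1)) + (if j < n then norm (W (j + 1)) else 0))) {1..n}"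
    by (rule L2_set_mono) (use pointwise in auto)
  also have "\<dots> \<le> ((L2_set (\<lambda>j. (1 / \<bar>\<gamma>\<bar>) * norm (b j)) {1..n}
      + L2_set (\<lambda>j. if j = n then norm c / \<bar>\<gamma>\<bar> else 0) {1..n}) + L2_set (\<lambda>j. 2 * norm (W j)) {1..n})
      + (L2_set (\<lambda>j. norm (W (j - 1))) {1..n} + L2_set (\<lambda>j. if j < n then norm (W (j + 1)) else 0) {1..n})"
    by (intro order_trans[OF L2_set_triangle_ineq] add_mono order_refl)
  also have "L2_set (\<lambda>j. (1 / \<bar>\<gamma>\<bar>) * norm (b j)) {1..n} = (1 / \<bar>\<gamma>\<bar>) * load2"
    unfolding load2_def by (rule L2_set_right_distrib[symmetric]) simp
  also have "L2_set (\<lambda>j. 2 * norm (W j)) {1..n} = 2 * w"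
    unfolding w_def by (rule L2_set_right_distrib[symmetric]) simp
  also have "L2_set (\<lambda>j. if j = n then norm c / \<bar>\<gamma>\<bar> else 0) {1..n} = norm c / \<bar>\<gamma>\<bar>"
    using n by (simp add: L2_set_def if_distrib[of "\<lambda>x. x\<^sup>2"] cong: if_cong)
  also have "L2_set (\<lambda>j. norm (W (j - 1))) {1..n} \<le> w"
    unfolding w_def using L2_set_shift_down_le[of "\<lambda>j. norm (W j)"] W0 by simp
  also have "L2_set (\<lambda>j. if j < n then norm (W (j + 1)) else 0) {1..n} \<le> w"
    unfolding w_def using L2_set_shift_up_le[of n "\<lambda>j. norm (W j)"] by simp
  finally have 1: "\<bar>\<beta>\<bar> * w \<le> (1 / \<bar>\<gamma>\<bar>) * load2 + norm c / \<bar>\<gamma>\<bar> + 4 * w"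
    by simp
  have w: "0 \<le> w" by (simp add: w_def)
  have "6 * w \<le> \<bar>\<beta>\<bar> * w" using \<beta>_bounds(1) w by (rule mult_right_mono)
  \<comment> \<open>Absorbing 4 w must not lose the factor \<bar>\<beta>\<bar>, which has to cancel
    1 / \<bar>\<gamma>\<bar> below. Since 4 w is at most two thirds of \<bar>\<beta>\<bar> w, a
    factor 3 suffices.\<close>
  moreover have "6 * w \<le> z \<Longrightarrow> z \<le> 3 * (z - 4 * w)" for z by simp
  ultimately have "\<bar>\<beta>\<bar> * w \<le> 3 * (\<bar>\<beta>\<bar> * w - 4 * w)" by blast
  also have "\<dots> \<le> 3 * ((1 / \<bar>\<gamma>\<bar>) * (load2 + norm c))"
  proof -
    have "3 * (z - 4 * w) \<le> 3 * (x + y)" if "z \<le> x + y + 4 * w" for x y z using that by simp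
    from this[OF 1] show ?thesis by (simp add: distrib_left)
  qed
  also have "1 / \<bar>\<gamma>\<bar> = \<bar>\<beta>\<bar> * (\<alpha> / t\<^sup>2)"
    using \<alpha>_bounds t2 \<gamma> by (simp add: \<beta> abs_mult)
  finally have "\<bar>\<beta>\<bar> * w \<le> \<bar>\<beta>\<bar> * (3 * (\<alpha> / t\<^sup>2) * (load2 + norm c))"
    by (simp add: mult_ac)
  then have "w \<le> 3 * (\<alpha> / t\<^sup>2) * (load2 + norm c)"
    by (rule mult_left_le_imp_le) (use \<beta>_nonzero in simp)
  also have "\<dots> = 3 * (\<alpha> / t\<^sup>2) * load2 + 3 * (\<alpha> / t\<^sup>2) * norm c"
    by (rule distrib_left)
  also have "3 * (\<alpha> / t\<^sup>2) * load2 \<le> 3 * load2"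
    using \<alpha>_div_t2 by (intro mult_right_mono) (auto simp: load2_def)
  also have "3 * (\<alpha> / t\<^sup>2) * norm c = 3 * \<alpha> * norm (1 / 2 + \<i> * t / 6 :: complex) * norm (U n)"
    using t2 by (simp add: c_def norm_mult norm_power)
  also have "\<dots> \<le> 3 * \<alpha> * (53 / 100) * norm (U n)"
    using \<alpha>_bounds by (intro mult_right_mono mult_left_mono norm_half_plus) auto
  finally show ?thesis by (simp add: w_def)
qed

text \<open>The squares of t - \<alpha> t/6 and of sin s are polynomials in \<alpha> by the
  quadratic equation, and their difference is of order \<alpha>^2. Dividing by the sum of the two
  numbers, at least (5/6 + 3/4) t, leaves order t^3.\<close>

lemma phase_defect: "\<bar>t - \<alpha> * t / 6 - sin s\<bar> \<le> 176 / 1000 * t ^ 3"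
proof -
  let ?x = "t - \<alpha> * t / 6"
  have sin: "3 / 4 * t \<le> sin s" using sin_ge_of_cos[OF t s] \<alpha> by simp
  have "\<alpha> * t \<le> 1 * t" using \<alpha>_bounds t by (intro mult_right_mono) auto
  then have x: "5 / 6 * t \<le> ?x" by simp
  have "?x\<^sup>2 = (1 - \<alpha> / 6) * (t\<^sup>2 - t\<^sup>2 * \<alpha> / 6)" by (simp add: power2_eq_square field_simps)
  also have "t\<^sup>2 - t\<^sup>2 * \<alpha> / 6 = \<gamma> * \<alpha>\<^sup>2 + \<alpha>" using \<alpha>(2) by (simp add: field_simps)
  finally have x2: "?x\<^sup>2 = (1 - \<alpha> / 6) * (\<gamma> * \<alpha>\<^sup>2 + \<alpha>)" .
  have s2: "(sin s)\<^sup>2 = \<alpha> - \<alpha>\<^sup>2 / 4"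
    unfolding sin_squared_eq \<alpha>(1) by (simp add: power2_eq_square field_simps)
  have "(?x - sin s) * (?x + sin s) = ?x\<^sup>2 - (sin s)\<^sup>2" by (simp add: power2_eq_square algebra_simps)
  also have "\<dots> = \<alpha>\<^sup>2 * (1 / 12 + \<gamma> - \<gamma> * \<alpha> / 6)"
    unfolding x2 s2 by (simp add: power2_eq_square field_simps)
  finally have "\<bar>?x - sin s\<bar> * \<bar>?x + sin s\<bar> = \<alpha>\<^sup>2 * \<bar>1 / 12 + \<gamma> - \<gamma> * \<alpha> / 6\<bar>"
    by (simp flip: abs_mult add: abs_mult)
  also have "\<dots> \<le> (t\<^sup>2)\<^sup>2 * (10 / 36)"
  proof (intro mult_mono power_mono)
    have "\<bar>\<gamma> * \<alpha>\<bar> \<le> 1 / 6 * 1" unfolding abs_mult using \<gamma> \<alpha>_bounds by (intro mult_mono) auto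
    then show "\<bar>1 / 12 + \<gamma> - \<gamma> * \<alpha> / 6\<bar> \<le> 10 / 36" using \<gamma> unfolding abs_le_iff by linarith
  qed (use \<alpha> \<alpha>_bounds in auto)
  also have "(t\<^sup>2)\<^sup>2 = t ^ 3 * t" by (simp add: eval_nat_numeral)
  finally have "\<bar>?x - sin s\<bar> * \<bar>?x + sin s\<bar> \<le> t ^ 3 * t * (10 / 36)" .
  moreover have "\<bar>?x - sin s\<bar> * (19 / 12 * t) \<le> \<bar>?x - sin s\<bar> * \<bar>?x + sin s\<bar>"
  proof (rule mult_left_mono)
    show "19 / 12 * t \<le> \<bar>?x + sin s\<bar>" using x sin by linarith
  qed simp
  ultimately have "(\<bar>?x - sin s\<bar> * (19 / 12)) * t \<le> (t ^ 3 * (10 / 36)) * t" by (simp add: mult_ac)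
  then have "\<bar>?x - sin s\<bar> * (19 / 12) \<le> t ^ 3 * (10 / 36)" using t by simp
  moreover have "0 \<le> t ^ 3" using t by simp
  moreover have "x \<le> 176 / 1000 * y" if "x * (19 / 12) \<le> y * (10 / 36)" "0 \<le> y" for x y :: real
    using that by simp
  ultimately show ?thesis by blast
qed

text \<open>With \<open>Y n\<close> in place of \<open>U n\<close> the bracket in
  \<open>residual_last\<close> collapses to i (t - \<alpha> t/6 - sin s) \<open>Y n\<close>, so the
  discrete wave meets the discrete impedance condition to third order. The other term is the price
  of the replacement: 106/1000 = 53/100 / 5, with 5 from \<bar>\<beta> - \<alpha>\<bar> \<ge>
  5.\<close>

lemma residual_last_le:
  "norm (residual s n) \<le> 176 / 1000 * t ^ 3 * norm (Y n) + 106 / 1000 * \<alpha> * (\<alpha> * norm (Y n) + norm (W n))"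
proof -
  let ?c = "1 / 2 + \<i> * t / 6 :: complex"
  have U: "U n = Y n + (\<alpha> * Y n - W n) / (\<beta> - \<alpha>)"
    using U_eq[of n] \<beta>_\<alpha>_nonzero by (simp add: field_simps)
  have cis: "cis (- s) = 1 - \<alpha> / 2 - \<i> * sin s" by (simp add: complex_eq_iff \<alpha>(1) field_simps)
  have "cis (- s) * Y n - \<alpha> * ?c * U n - (1 - \<i> * t - \<alpha>) * Y n
    = \<i> * of_real (t - \<alpha> * t / 6 - sin s) * Y n - \<alpha> * ?c * ((\<alpha> * Y n - W n) / (\<beta> - \<alpha>))"
    unfolding cis U by (simp add: algebra_simps)
  then have "norm (residual s n) = norm (\<i> * of_real (t - \<alpha> * t / 6 - sin s) * Y n
      - \<alpha> * ?c * ((\<alpha> * Y n - W n) / (\<beta> - \<alpha>)))"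
    using residual_last[of s] by (simp add: norm_mult)
  also have "\<dots> \<le> norm (\<i> * of_real (t - \<alpha> * t / 6 - sin s) * Y n)
      + norm (\<alpha> * ?c * ((\<alpha> * Y n - W n) / (\<beta> - \<alpha>)))"
    by (rule norm_triangle_ineq4)
  also have "norm (\<i> * of_real (t - \<alpha> * t / 6 - sin s) * Y n) = \<bar>t - \<alpha> * t / 6 - sin s\<bar> * norm (Y n)"
    unfolding norm_mult norm_of_real by simp
  also have "\<dots> \<le> 176 / 1000 * t ^ 3 * norm (Y n)"
    by (intro mult_right_mono phase_defect) auto
  also have "norm (\<alpha> * ?c * ((\<alpha> * Y n - W n) / (\<beta> - \<alpha>))) = \<alpha> * norm ?c * (norm (\<alpha> * Y n - W n) / \<bar>\<beta> - \<alpha>\<bar>)"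
    using \<alpha>_bounds by (simp add: norm_mult norm_divide flip: of_real_diff)
  also have "\<dots> \<le> \<alpha> * (53 / 100) * ((\<alpha> * norm (Y n) + norm (W n)) / 5)"
  proof (intro mult_mono frac_le norm_half_plus)
    show "norm (\<alpha> * Y n - W n) \<le> \<alpha> * norm (Y n) + norm (W n)"
      using norm_triangle_ineq4[of "\<alpha> * Y n" "W n"] \<alpha>_bounds by (simp add: norm_mult)
  qed (use \<alpha>_bounds \<beta>_bounds in auto)
  finally show ?thesis by (simp add: algebra_simps)
qed

lemma load_bounds:
  "0 \<le> load" "load2 \<le> load"
  "norm (lam * (\<Sum>m\<le>n. b m * cis (real m * \<sigma>))) \<le> load"
proof -
  show l0: "0 \<le> load" by (simp add: load_def sum_nonneg)
  have "load2 \<le> (\<Sum>j\<in>{1..n}. norm (b j))" unfolding load2_def by (rule L2_set_le_sum) auto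
  also have "\<dots> \<le> load" unfolding load_def by (rule sum_mono2) auto
  finally show "load2 \<le> load" .
  have "norm (\<Sum>m\<le>n. b m * cis (real m * \<sigma>)) \<le> load"
    unfolding load_def by (rule order_trans[OF norm_sum]) (simp add: norm_mult)
  then have "norm lam * norm (\<Sum>m\<le>n. b m * cis (real m * \<sigma>)) \<le> 1 * load"
    using \<alpha>_div_t2 l0 by (intro mult_mono) (auto simp: lam_def simp del: of_real_divide)
  then show "norm (lam * (\<Sum>m\<le>n. b m * cis (real m * \<sigma>))) \<le> load"
    by (simp only: norm_mult mult_1)
qed

text \<open>Both directions meet the same boundary row, so in a suitable combination of the two
  residuals at n the boundary terms cancel and 2 i sin s \<open>Y n\<close> remains. The unknown
  amplitude is traded for \<open>residual s n\<close>.\<close>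

lemma Y_last_bound_aux: "sin s * norm (Y n) \<le> norm (residual s n) + load"
proof -
  have sin: "0 \<le> sin s" using s by (intro sin_ge_zero) auto
  have "cis (real n * s) * residual (- s) n - cis (- (real n * s)) * residual s n
      = (cis s - cis (- s)) * Y n"
  proof -
    have cc: "cis (real n * s) * cis (- (real n * s)) = 1" by (simp add: cis_mult)
    have r: "cis (- (real n * s)) * residual s n
        = cis (- s) * Y n - \<alpha> * (1 / 2 + \<i> * t / 6) * U n - (1 - \<i> * t - \<alpha>) * Y n"
      "cis (real n * s) * residual (- s) n
        = cis s * Y n - \<alpha> * (1 / 2 + \<i> * t / 6) * U n - (1 - \<i> * t - \<alpha>) * Y n"
      using residual_last[of s] residual_last[of "- s"]
      by (simp_all add: cis_mult mult.assoc[symmetric])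
    show ?thesis unfolding r by (simp add: algebra_simps)
  qed
  also have "cis s - cis (- s) = 2 * \<i> * sin s" by (simp add: complex_eq_iff)
  finally have "2 * sin s * norm (Y n) = norm (cis (real n * s) * residual (- s) n - cis (- (real n * s)) * residual s n)"
    using sin by (simp add: norm_mult)
  also have "\<dots> \<le> norm (residual (- s) n) + norm (residual s n)"
    by (rule order_trans[OF norm_triangle_ineq4]) (simp add: norm_mult)
  finally have 1: "2 * sin s * norm (Y n) \<le> norm (residual (- s) n) + norm (residual s n)" .
  have "norm (residual (- s) n) \<le> norm amplitude + load"
    unfolding residual_def by (rule order_trans[OF norm_triangle_ineq4 add_left_mono[OF load_bounds(3)]])
  moreover have "norm amplitude \<le> norm (residual s n) + load"
  proof -
    have "amplitude = residual s n + lam * (\<Sum>m\<le>n. b m * cis (real m * s))"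
      by (simp add: residual_def)
    then show ?thesis by (elim ssubst, intro order_trans[OF norm_triangle_ineq add_left_mono[OF load_bounds(3)]])
  qed
  ultimately show ?thesis using 1 by linarith
qed

text \<open>The residual at n is bounded through t |Y n| and the load, and t |Y n| through the
  residual and the load. Neither bound is closed by itself; together they absorb t |Y n|, and the
  bound for W follows.\<close>

lemma stability:
  "norm (residual s n) \<le> 6 * t\<^sup>2 * load"
  "L2_set (\<lambda>j. norm (W j)) {1..n} \<le> 5 * load2 + 26 * t * load"
proof -
  define w where "w = L2_set (\<lambda>j. norm (W j)) {1..n}"
  define B where "B = load2"
  define y where "y = norm (Y n)"
  have nn: "0 \<le> w" "0 \<le> B" "0 \<le> y" by (simp_all add: w_def B_def load2_def y_def)
  have Wn: "norm (W n) \<le> w"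
    unfolding w_def using member_le_L2_set[of "{1..n}" n "\<lambda>j. norm (W j)"] n by simp
  have pw: "\<alpha> * y \<le> y" "\<alpha> * w \<le> w" "0 \<le> \<alpha> * y"
    using \<alpha>_bounds nn by (auto simp: mult_left_le_one_le)
  have W': "w \<le> 3 * B + 159 / 100 * (\<alpha> * norm (U n))"
    using W_bound_aux by (simp add: w_def B_def mult.assoc)
  have "\<alpha> * norm (U n) \<le> \<alpha> * (6 / 5 * y + w / 5)"
    using norm_U_last Wn \<alpha>_bounds by (intro mult_left_mono) (auto simp: y_def)
  also have "\<dots> = 6 / 5 * (\<alpha> * y) + 1 / 5 * (\<alpha> * w)" by (simp add: algebra_simps)
  finally have "w \<le> 3 * B + 159 / 100 * (6 / 5 * (\<alpha> * y) + 1 / 5 * w)"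
    by (intro order_trans[OF W' add_left_mono[OF mult_left_mono[OF order_trans[OF _ add_left_mono]]]])
      (use pw in auto)
  \<comment> \<open>Here w stands on both sides, on the right with the factor 159/500; dividing by 1
    - 159/500 gives the two constants.\<close>
  then have w: "w \<le> 44 / 10 * B + 28 / 10 * (\<alpha> * y)" using nn pw by (simp add: algebra_simps)
  have sin: "3 / 4 * t \<le> sin s" using sin_ge_of_cos[OF t s] \<alpha> by simp
  have res: "norm (residual s n) \<le> t\<^sup>2 * (579 / 1000 * (t * y) + 467 / 1000 * load)"
  proof -
    have "norm (residual s n) \<le> 176 / 1000 * t ^ 3 * y + 106 / 1000 * \<alpha> * (\<alpha> * y + w)"
      unfolding y_def using \<alpha>_bounds Wn
      by (intro order_trans[OF residual_last_le] add_left_mono mult_left_mono) auto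
    also have "106 / 1000 * \<alpha> * (\<alpha> * y + w) \<le> 106 / 1000 * t\<^sup>2 * (\<alpha> * y + w)"
      using \<alpha> nn pw by (intro mult_right_mono) auto
    also have "\<dots> \<le> 106 / 1000 * t\<^sup>2 * (38 / 10 * (t * y) + 44 / 10 * load)"
    proof (intro mult_left_mono)
      have "t\<^sup>2 \<le> t" using t by (simp add: power2_eq_square mult_left_le)
      then have "\<alpha> * y \<le> t * y" using \<alpha>(3) nn by (intro mult_right_mono) auto
      then show "\<alpha> * y + w \<le> 38 / 10 * (t * y) + 44 / 10 * load"
        using w load_bounds(2) by (simp add: B_def)
    qed auto
    also have "176 / 1000 * t ^ 3 * y = t\<^sup>2 * (176 / 1000 * (t * y))"
      by (simp add: eval_nat_numeral)
    finally have "norm (residual s n) \<le> t\<^sup>2 * (176 / 1000 * (t * y) + 106 / 1000 * (38 / 10 * (t * y) + 44 / 10 * load))"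
      by (simp add: algebra_simps)
    also have "\<dots> \<le> t\<^sup>2 * (579 / 1000 * (t * y) + 467 / 1000 * load)"
    proof (rule mult_left_mono)
      have "176 / 1000 * p + 106 / 1000 * (38 / 10 * p + 44 / 10 * l) \<le> 579 / 1000 * p + 467 / 1000 * l"
        if "0 \<le> p" "0 \<le> l" for p l :: real using that by (simp add: algebra_simps)
      then show "176 / 1000 * (t * y) + 106 / 1000 * (38 / 10 * (t * y) + 44 / 10 * load)
          \<le> 579 / 1000 * (t * y) + 467 / 1000 * load"
        using t nn load_bounds(1) by simp
    qed simp
    finally show ?thesis .
  qed
  \<comment> \<open>The absorption: 579/1000 on the right is smaller than the 3/4 on the left, and
    (1 + 467/1000) / (3/4 - 579/1000) < 9.\<close>
  have ty: "t * y \<le> 9 * load"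
  proof -
    have "3 / 4 * t * y \<le> sin s * y" using sin nn by (intro mult_right_mono) auto
    also have "\<dots> \<le> norm (residual s n) + load" using Y_last_bound_aux by (simp add: y_def)
    also have "\<dots> \<le> 1 * (579 / 1000 * (t * y) + 467 / 1000 * load) + load"
      using t2 t nn load_bounds(1) by (intro add_right_mono order_trans[OF res] mult_right_mono) auto
    finally show ?thesis using load_bounds(1) by (simp add: algebra_simps)
  qed
  have "norm (residual s n) \<le> t\<^sup>2 * (579 / 1000 * (9 * load) + 467 / 1000 * load)"
    using ty by (intro order_trans[OF res] mult_left_mono) auto
  also have "\<dots> \<le> t\<^sup>2 * (6 * load)" using load_bounds(1) by (intro mult_left_mono) auto
  finally show "norm (residual s n) \<le> 6 * t\<^sup>2 * load" by simp
  have "\<alpha> * y \<le> t\<^sup>2 * y" using \<alpha> nn by (intro mult_right_mono) auto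
  also have "\<dots> = t * (t * y)" by (simp add: power2_eq_square)
  also have "\<dots> \<le> t * (9 * load)" using ty t by (intro mult_left_mono) auto
  finally have "\<alpha> * y \<le> 9 * (t * load)" by simp
  moreover have "0 \<le> t * load" using t load_bounds(1) by simp
  ultimately show "L2_set (\<lambda>j. norm (W j)) {1..n} \<le> 5 * load2 + 26 * t * load"
    using w nn unfolding w_def[symmetric] B_def[symmetric] by simp
qed

end

section \<open>Assembly of the finite element equations\<close>

definition clamp01 :: "real \<Rightarrow> real" where "clamp01 z = max 0 (min 1 z)"

text \<open>Writing hat functions as differences of ramps makes their partial sums telescope.\<close>

definition hat :: "nat \<Rightarrow> nat \<Rightarrow> real \<Rightarrow> real" where
  "hat n m x = clamp01 (real m + 1 - real n * x) - clamp01 (real m - real n * x)"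

abbreviation "cell n j \<equiv> {node n j..node n (Suc j)}"
abbreviation "open_cell n j \<equiv> {node n j<..<node n (Suc j)}"

lemma node_0 [simp]: "node n 0 = 0" and node_n: "n \<ge> 1 \<Longrightarrow> node n n = 1"
  by (simp_all add: node_def)

lemma node_less: "n \<ge> 1 \<Longrightarrow> node n j < node n (Suc j)"
  by (simp add: node_def divide_strict_right_mono)

lemma node_le_iff: "n \<ge> 1 \<Longrightarrow> node n i \<le> node n j \<longleftrightarrow> i \<le> j"
  by (simp add: node_def divide_le_cancel)

lemma node_Suc_diff: "node n (Suc j) - node n j = 1 / real n"
  by (simp add: node_def diff_divide_distrib[symmetric])

lemma element_subset: "n \<ge> 1 \<Longrightarrow> j < n \<Longrightarrow> cell n j \<subseteq> {0..1}"
  by (auto simp: node_def field_simps intro: order_trans)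

lemma continuous_hat: "continuous_on S (hat n m)"
  unfolding hat_def clamp01_def by (intro continuous_intros)

text \<open>The sum telescopes down to \<open>clamp01 (- real n * x)\<close>, which is 0 because x
  \<ge> 0. The hat at node 0 has to be included.\<close>

lemma sum_hat:
  assumes "0 \<le> x"
  shows "(\<Sum>m\<le>j. hat n m x) = clamp01 (real j + 1 - real n * x)"
proof -
  have "0 \<le> real n * x" using assms by simp
  then show ?thesis by (induction j) (auto simp: hat_def clamp01_def)
qed

lemma hat_nonneg: "0 \<le> hat n m x" and hat_le_1: "hat n m x \<le> 1"
  by (auto simp: hat_def clamp01_def)

lemma hat_outside: "\<bar>real n * x - real m\<bar> \<ge> 1 \<Longrightarrow> hat n m x = 0"
  by (auto simp: hat_def clamp01_def)

lemma hat_node: "n \<ge> 1 \<Longrightarrow> hat n m (node n j) = of_bool (j = m)"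
  by (auto simp: hat_def clamp01_def node_def)

lemma hat_in_V:
  assumes "n \<ge> 1" "m \<ge> 1"
  shows "(\<lambda>x. complex_of_real (hat n m x)) \<in> V n"
  unfolding V_def
proof (intro CollectI conjI ballI)
  show "continuous_on {0..1} (\<lambda>x. complex_of_real (hat n m x))"
    by (intro continuous_intros continuous_hat)
  show "complex_of_real (hat n m 0) = 0"
    using assms by (simp add: hat_def clamp01_def)
  fix j assume j: "j \<in> {1..n}"
  have x: "real j - 1 \<le> real n * x" "real n * x \<le> real j"
    if "x \<in> {node n (j - 1)<..<node n j}" for x
    using that j assms by (auto simp: node_def field_simps of_nat_diff)
  have ramp: "\<exists>a b :: real. \<forall>x\<in>{node n (j - 1)<..<node n j}. clamp01 (real i - real n * x) = a + b * x" for i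
  proof -
    consider "i < j" | "i = j" | "i > j" by linarith
    then show ?thesis
    proof cases
      case 1
      then have "clamp01 (real i - real n * x) = 0 + 0 * x" if "x \<in> {node n (j - 1)<..<node n j}" for x
        using x[OF that] by (simp add: clamp01_def)
      then show ?thesis by blast
    next
      case 2
      then have "clamp01 (real i - real n * x) = real i + (- real n) * x" if "x \<in> {node n (j - 1)<..<node n j}" for x
        using x[OF that] by (simp add: clamp01_def)
      then show ?thesis by blast
    next
      case 3
      then have "clamp01 (real i - real n * x) = 1 + 0 * x" if "x \<in> {node n (j - 1)<..<node n j}" for x
        using x[OF that] by (simp add: clamp01_def)
      then show ?thesis by blast
    qed
  qed
  obtain a b a' b' where ab:
    "\<And>x. x \<in> {node n (j - 1)<..<node n j} \<Longrightarrow> clamp01 (real (Suc m) - real n * x) = a + b * x"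
    "\<And>x. x \<in> {node n (j - 1)<..<node n j} \<Longrightarrow> clamp01 (real m - real n * x) = a' + b' * x"
    using ramp[of "Suc m"] ramp[of m] by blast
  have "complex_of_real (hat n m x) = of_real (a - a') + of_real (b - b') * of_real x"
    if "x \<in> {node n (j - 1)<..<node n j}" for x
  proof -
    have "hat n m x = (a - a') + (b - b') * x"
      using ab[OF that] by (simp add: hat_def algebra_simps)
    then show ?thesis by simp
  qed
  then show "\<exists>a b. \<forall>x\<in>{node n (j - 1)<..<node n j}. complex_of_real (hat n m x) = a + b * complex_of_real x"
    by blast
qed

text \<open>Membership in \<open>V\<close> speaks of open elements only; continuity carries the
  affine formula to the nodes, whose values then determine its coefficients.\<close>

lemma V_element:
  fixes v :: "real \<Rightarrow> complex"
  assumes v: "v \<in> V n" and n: "n \<ge> 1" and j: "j < n" and x: "x \<in> cell n j"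
  shows "v x = v (node n j) + (real n * x - real j) * (v (node n (Suc j)) - v (node n j))"
proof -
  have "\<forall>j\<in>{1..n}. \<exists>a b. \<forall>x\<in>{node n (j - 1)<..<node n j}. v x = a + b * of_real x"
    using v unfolding V_def by blast
  from bspec[OF this, of "Suc j"]
  have "\<exists>a b. \<forall>x\<in>open_cell n j. v x = a + b * of_real x"
    using j by simp
  then obtain a b where ab: "\<And>x. x \<in> open_cell n j \<Longrightarrow> v x - (a + b * of_real x) = 0"
    by auto
  have cl: "closure (open_cell n j) = cell n j"
    using node_less[OF n] by simp
  have c: "continuous_on (closure (open_cell n j)) (\<lambda>x. v x - (a + b * of_real x))"
    unfolding cl using v element_subset[OF n j]
    by (auto simp: V_def intro!: continuous_intros intro: continuous_on_subset)
  have eq: "v x = a + b * of_real x" if "x \<in> cell n j" for x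
    using continuous_constant_on_closure[OF c ab, of x] that cl by simp
  have mem: "node n j \<in> cell n j" "node n (Suc j) \<in> cell n j"
    using node_less[OF n, of j] by auto
  have d: "v (node n (Suc j)) - v (node n j) = b / of_nat n"
    unfolding eq[OF mem(1)] eq[OF mem(2)] by (simp add: node_def add_divide_distrib distrib_left)
  show ?thesis
    unfolding d unfolding eq[OF x] eq[OF mem(1)] using n by (simp add: node_def field_simps)
qed

lemma V_derivative:
  fixes v :: "real \<Rightarrow> complex"
  assumes v: "v \<in> V n" and n: "n \<ge> 1" and j: "j < n" and x: "x \<in> open_cell n j"
  shows "(v has_vector_derivative of_nat n * (v (node n (Suc j)) - v (node n j))) (at x)"
proof (rule has_vector_derivative_transform_within_open[of _ _ _ "open_cell n j"])
  show "((\<lambda>x. v (node n j) + (real n * x - real j) * (v (node n (Suc j)) - v (node n j)))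
      has_vector_derivative of_nat n * (v (node n (Suc j)) - v (node n j))) (at x)"
    by (auto intro!: derivative_eq_intros simp: scaleR_conv_of_real)
  fix y assume "y \<in> open_cell n j"
  then show "v (node n j) + (real n * y - real j) * (v (node n (Suc j)) - v (node n j)) = v y"
    using V_element[OF v n j, of y] by simp
qed (use x in simp_all)

lemma left_limit_eq:
  assumes "a < b" "continuous_on {a..b} g" "\<And>x. x \<in> {a<..<b} \<Longrightarrow> w x = g x"
  shows "left_limit w b = g b"
proof -
  have "(g \<longlongrightarrow> g b) (at_left b)" using continuous_on_Icc_at_leftD assms by blast
  moreover have "\<forall>\<^sub>F x in at_left b. w x = g x"
    unfolding eventually_at_left_field using assms by (intro exI[of _ a]) auto
  ultimately show ?thesis unfolding left_limit_def by (intro tendsto_Lim) (auto simp: tendsto_cong)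
qed

lemma right_limit_eq:
  assumes "a < b" "continuous_on {a..b} g" "\<And>x. x \<in> {a<..<b} \<Longrightarrow> w x = g x"
  shows "right_limit w a = g a"
proof -
  have "(g \<longlongrightarrow> g a) (at_right a)" using continuous_on_Icc_at_rightD assms by blast
  moreover have "\<forall>\<^sub>F x in at_right a. w x = g x"
    unfolding eventually_at_right_field using assms by (intro exI[of _ b]) auto
  ultimately show ?thesis unfolding right_limit_def by (intro tendsto_Lim) (auto simp: tendsto_cong)
qed

text \<open>The nodes form a null set. In this way integrals involving \<open>D v\<close>, which has
  no meaningful value at a kink, reduce to integrals of continuous functions on closed
  cells.\<close>

lemma piecewise_continuous_integral:
  fixes g :: "real \<Rightarrow> complex"
  assumes n: "n \<ge> 1"
    and G: "\<And>j. j < n \<Longrightarrow> continuous_on (cell n j) (G j)"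
    and eq: "\<And>j x. j < n \<Longrightarrow> x \<in> open_cell n j \<Longrightarrow> g x = G j x"
  shows "g absolutely_integrable_on {0..1}"
    and "(LINT x|lebesgue_on {0<..<1}. g x) = (\<Sum>j<n. integral (cell n j) (G j))"
proof -
  have el: "g absolutely_integrable_on cell n j"
    and eli: "integral (cell n j) g = integral (cell n j) (G j)"
    if j: "j < n" for j
  proof -
    have neg: "negligible {node n j, node n (Suc j)}" by simp
    have *: "g x = G j x" if "x \<in> cell n j - {node n j, node n (Suc j)}" for x
      using eq[OF j, of x] that by auto
    show "g absolutely_integrable_on cell n j"
      by (rule absolutely_integrable_spike[OF absolutely_integrable_continuous_real[OF G[OF j]] neg *])
    show "integral (cell n j) g = integral (cell n j) (G j)"
      by (rule integral_spike[OF neg]) (use * in auto)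
  qed
  have *: "g absolutely_integrable_on {0..node n m} \<and> integral {0..node n m} g
      = (\<Sum>j<m. integral (cell n j) (G j))" if "m \<le> n" for m
    using that
  proof (induction m)
    case 0
    then show ?case by (simp add: absolutely_integrable_negligible)
  next
    case (Suc m)
    have un: "{0..node n (Suc m)} = {0..node n m} \<union> cell n m"
      using node_less[OF n, of m] node_le_iff[OF n, of 0 m] by auto
    have a: "g absolutely_integrable_on {0..node n (Suc m)}"
      unfolding un using Suc el by (intro absolutely_integrable_Un) auto
    moreover have "integral {0..node n (Suc m)} g = integral {0..node n m} g + integral (cell n m) g"
      using Henstock_Kurzweil_Integration.integral_combine[of 0 "node n m" "node n (Suc m)" g]
        node_less[OF n, of m] node_le_iff[OF n, of 0 m] a by (auto simp: absolutely_integrable_on_def)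
    ultimately show ?case using Suc eli[of m] by simp
  qed
  then have 1: "g absolutely_integrable_on {0..1}"
    and 2: "integral {0..1} g = (\<Sum>j<n. integral (cell n j) (G j))"
    using *[of n] node_n[OF n] by auto
  show "g absolutely_integrable_on {0..1}" by (rule 1)
  show "(LINT x|lebesgue_on {0<..<1}. g x) = (\<Sum>j<n. integral (cell n j) (G j))"
    using lebesgue_on_eq_integral[OF 1] 2 by simp
qed

lemma integral_const_element:
  "n \<ge> 1 \<Longrightarrow> integral (cell n j) (\<lambda>_. c :: complex) = c / of_nat n"
  using node_less[of n j] by (simp add: node_Suc_diff scaleR_conv_of_real)

lemma integral_product_element:
  fixes a b c d :: complex
  assumes n: "n \<ge> 1"
  shows "integral (cell n j)
      (\<lambda>x. (a + (real n * x - real j) * (b - a)) * (c + (real n * x - real j) * (d - c)))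
    = (2 * a * c + a * d + b * c + 2 * b * d) / (6 * of_nat n)" (is "integral _ ?f = _")
proof (rule integral_unique)
  define p where "p x = complex_of_real (real n * x - real j)" for x
  define P where "P x = (a * c * p x + (a * (d - c) + (b - a) * c) * (p x)\<^sup>2 / 2
    + (b - a) * (d - c) * (p x) ^ 3 / 3) / of_nat n" for x
  have "(?f has_integral P (node n (Suc j)) - P (node n j)) (cell n j)"
  proof (rule fundamental_theorem_of_calculus)
    show "node n j \<le> node n (Suc j)" using node_less[OF n, of j] by simp
    fix x :: real
    have p: "(p has_vector_derivative of_nat n) (at x within S)" for S
      unfolding p_def by (auto intro!: derivative_eq_intros simp: scaleR_conv_of_real)
    have p2: "((\<lambda>x. (p x)\<^sup>2) has_vector_derivative of_nat n * (2 * p x)) (at x within S)" for S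
      unfolding power2_eq_square using has_vector_derivative_mult[OF p p] by (simp add: algebra_simps)
    have p3: "((\<lambda>x. (p x) ^ 3) has_vector_derivative of_nat n * (3 * (p x)\<^sup>2)) (at x within S)" for S
      unfolding power3_eq_cube using has_vector_derivative_mult[OF has_vector_derivative_mult[OF p p] p]
      by (simp add: algebra_simps power2_eq_square)
    have "(P has_vector_derivative (a * c * of_nat n + (a * (d - c) + (b - a) * c) * (of_nat n * (2 * p x)) / 2
        + (b - a) * (d - c) * (of_nat n * (3 * (p x)\<^sup>2)) / 3) / of_nat n) (at x within cell n j)"
      unfolding P_def
      by (intro has_vector_derivative_divide has_vector_derivative_add has_vector_derivative_mult_right p p2 p3)
    also have "(a * c * of_nat n + (a * (d - c) + (b - a) * c) * (of_nat n * (2 * p x)) / 2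
        + (b - a) * (d - c) * (of_nat n * (3 * (p x)\<^sup>2)) / 3) / of_nat n
      = (a + p x * (b - a)) * (c + p x * (d - c))"
      using n by (simp add: field_simps power2_eq_square)
    finally show "(P has_vector_derivative ?f x) (at x within cell n j)"
      by (simp add: p_def)
  qed
  moreover have "p (node n (Suc j)) = 1" "p (node n j) = 0"
    using n by (simp_all add: p_def node_def)
  ultimately show "(?f has_integral (2 * a * c + a * d + b * c + 2 * b * d) / (6 * of_nat n)) (cell n j)"
    by (simp add: P_def field_simps)
qed

section \<open>Stiffness, mass and penalty terms\<close>

lemma L2_inner_D_V:
  assumes u: "u \<in> V n" and v: "v \<in> V n" and n: "n \<ge> 1"
  shows "L2_inner (D u) (D v)
    = of_nat n * (\<Sum>j<n. (u (node n (Suc j)) - u (node n j)) * cnj (v (node n (Suc j)) - v (node n j)))"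
proof -
  have "L2_inner (D u) (D v) = (\<Sum>j<n. integral (cell n j)
      (\<lambda>_. of_nat n * (u (node n (Suc j)) - u (node n j)) * cnj (of_nat n * (v (node n (Suc j)) - v (node n j)))))"
    unfolding L2_inner_def
    by (rule piecewise_continuous_integral(2)[OF n])
      (auto simp: D_def vector_derivative_at[OF V_derivative[OF u n]] vector_derivative_at[OF V_derivative[OF v n]])
  then show ?thesis
    unfolding integral_const_element[OF n] using n by (simp add: sum_distrib_left mult_ac)
qed

lemma L2_inner_V:
  assumes u: "u \<in> V n" and v: "v \<in> V n" and n: "n \<ge> 1"
  shows "L2_inner u v = (\<Sum>j<n. 2 * u (node n j) * cnj (v (node n j)) + u (node n j) * cnj (v (node n (Suc j)))
    + u (node n (Suc j)) * cnj (v (node n j)) + 2 * u (node n (Suc j)) * cnj (v (node n (Suc j)))) / (6 * of_nat n)"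
proof -
  have "L2_inner u v = (\<Sum>j<n. integral (cell n j)
      (\<lambda>x. (u (node n j) + (real n * x - real j) * (u (node n (Suc j)) - u (node n j)))
        * (cnj (v (node n j)) + (real n * x - real j) * (cnj (v (node n (Suc j))) - cnj (v (node n j))))))"
    unfolding L2_inner_def
  proof (rule piecewise_continuous_integral(2)[OF n])
    fix j x assume j: "j < n" and x: "x \<in> open_cell n j"
    have x': "x \<in> cell n j" using x by auto
    show "u x * cnj (v x) = (u (node n j) + (real n * x - real j) * (u (node n (Suc j)) - u (node n j)))
        * (cnj (v (node n j)) + (real n * x - real j) * (cnj (v (node n (Suc j))) - cnj (v (node n j))))"
      unfolding V_element[OF u n j x'] V_element[OF v n j x'] by simp
  qed (intro continuous_intros)
  then show ?thesis
    unfolding integral_product_element[OF n] by (simp add: sum_divide_distrib)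
qed

lemma V_limits:
  assumes v: "v \<in> V n" and n: "n \<ge> 1" and j: "j < n"
  shows "left_limit (D v) (node n (Suc j)) = of_nat n * (v (node n (Suc j)) - v (node n j))"
    and "right_limit (D v) (node n j) = of_nat n * (v (node n (Suc j)) - v (node n j))"
proof -
  have D: "D v x = of_nat n * (v (node n (Suc j)) - v (node n j))" if "x \<in> open_cell n j" for x
    unfolding D_def by (rule vector_derivative_at[OF V_derivative[OF v n j that]])
  show "left_limit (D v) (node n (Suc j)) = of_nat n * (v (node n (Suc j)) - v (node n j))"
    by (rule left_limit_eq[OF node_less[OF n] _ D]) auto
  show "right_limit (D v) (node n j) = of_nat n * (v (node n (Suc j)) - v (node n j))"
    by (rule right_limit_eq[OF node_less[OF n] _ D]) auto
qed

lemma sum_of_bool_less: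
  fixes c :: "nat \<Rightarrow> complex"
  shows "(\<Sum>j<n. c j * of_bool (j = m)) = (if m < n then c m else 0)"
    and "1 \<le> m \<Longrightarrow> m \<le> n \<Longrightarrow> (\<Sum>j<n. c j * of_bool (Suc j = m)) = c (m - 1)"
proof -
  show "(\<Sum>j<n. c j * of_bool (j = m)) = (if m < n then c m else 0)"
    by (simp add: of_bool_def if_distrib[of "\<lambda>x. _ * x"] cong: if_cong)
  assume m: "1 \<le> m" "m \<le> n"
  then have "Suc j = m \<longleftrightarrow> j = m - 1" for j by auto
  then show "(\<Sum>j<n. c j * of_bool (Suc j = m)) = c (m - 1)"
    using m by (simp add: of_bool_def if_distrib[of "\<lambda>x. _ * x"] cong: if_cong)
qed

lemma sum_of_bool_inner:
  fixes c :: "nat \<Rightarrow> complex"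
  shows "(\<Sum>j\<in>{1..<n}. c j * of_bool (j = m)) = (if 1 \<le> m \<and> m < n then c m else 0)"
    and "(\<Sum>j\<in>{1..<n}. c j * of_bool (Suc j = m)) = (if 2 \<le> m \<and> m \<le> n then c (m - 1) else 0)"
    and "1 \<le> m \<Longrightarrow> (\<Sum>j\<in>{1..<n}. c j * of_bool (j - 1 = m)) = (if Suc m < n then c (Suc m) else 0)"
proof -
  show 1: "(\<Sum>j\<in>{1..<n}. c j * of_bool (j = m)) = (if 1 \<le> m \<and> m < n then c m else 0)" for m
    by (simp add: of_bool_def if_distrib[of "\<lambda>x. _ * x"] cong: if_cong)
  have "(\<Sum>j\<in>{1..<n}. c j * of_bool (Suc j = m)) = (\<Sum>j\<in>{1..<n}. c j * of_bool (j = m - 1))"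
    by (rule sum.cong) auto
  then show "(\<Sum>j\<in>{1..<n}. c j * of_bool (Suc j = m)) = (if 2 \<le> m \<and> m \<le> n then c (m - 1) else 0)"
    using 1[of "m - 1"] by auto
  assume "1 \<le> m"
  have "(\<Sum>j\<in>{1..<n}. c j * of_bool (j - 1 = m)) = (\<Sum>j\<in>{1..<n}. c j * of_bool (j = Suc m))"
    by (rule sum.cong) auto
  then show "(\<Sum>j\<in>{1..<n}. c j * of_bool (j - 1 = m)) = (if Suc m < n then c (Suc m) else 0)"
    using 1[of "Suc m"] by auto
qed

lemma jump_V:
  fixes v :: "real \<Rightarrow> complex"
  assumes v: "v \<in> V n" and n: "n \<ge> 1" and j: "1 \<le> j" "j < n"
  shows "jump n (D v) j = - of_nat n * (v (node n (j - 1)) - 2 * v (node n j) + v (node n (Suc j)))"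
proof -
  have "left_limit (D v) (node n j) = of_nat n * (v (node n j) - v (node n (j - 1)))"
    using V_limits(1)[OF v n, of "j - 1"] j by simp
  then show ?thesis
    unfolding jump_def using V_limits(2)[OF v n j(2)] by (simp add: algebra_simps)
qed

lemma left_limit_V_at_1:
  fixes v :: "real \<Rightarrow> complex"
  assumes v: "v \<in> V n" and n: "n \<ge> 1"
  shows "left_limit (D v) 1 = of_nat n * (v 1 - v (node n (n - 1)))"
  using V_limits(1)[OF v n, of "n - 1"] n node_n[OF n] by simp

text \<open>The method is tested with hats and divided by n. \<open>E 0 = 0\<close> expresses that
  no jump is penalized at x = 0, and the impedance term at 1 acts as one more jump, -n
  \<open>E n\<close>. So the penalty contributes a second difference of E in every row, in the last
  one with the same fictitious value as for U.\<close>

lemma cip_rows: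
  fixes uh f :: "real \<Rightarrow> complex" and k \<gamma> :: real and n :: nat and U E b :: "nat \<Rightarrow> complex"
  assumes n: "n \<ge> 1" and f: "f \<in> L2" and sol: "cip_solution n \<gamma> k f uh"
  defines "t \<equiv> k / real n"
  defines "U \<equiv> \<lambda>j. uh (node n j)"
  defines "E \<equiv> \<lambda>j. if j = 0 then 0 else if j < n then U (j - 1) - 2 * U j + U (j + 1)
    else U (n - 1) - (1 - \<i> * of_real t) * U n"
  defines "b \<equiv> \<lambda>m. integral {0..1} (\<lambda>x. of_real (hat n m x) * f x) / of_nat n"
  shows "U 0 = 0"
    and "1 \<le> m \<Longrightarrow> m < n \<Longrightarrow> \<gamma> * (E (m - 1) - 2 * E m + E (m + 1)) - of_real (1 + t\<^sup>2 / 6) * E m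
      - of_real (t\<^sup>2) * U m = b m"
    and "\<gamma> * (E (n - 1) - (1 - \<i> * t) * E n) - of_real (1 + t\<^sup>2 / 6) * E n
      - of_real (t\<^sup>2) * U n + of_real (t\<^sup>2) * (1 / 2 + \<i> * t / 6) * U n = b n"
proof -
  have uh: "uh \<in> V n" using sol by (simp add: cip_solution_def)
  show "U 0 = 0" using uh by (simp add: U_def V_def)
  have U1: "uh 1 = U n" using node_n[OF n] by (simp add: U_def)
  have Uf: "uh (node n j) = U j" for j by (simp add: U_def)
  have cb: "cnj (of_bool P) = of_bool P" for P by (cases P) auto
  define N where "N = complex_of_nat n"
  have N: "N \<noteq> 0" using n by (simp add: N_def)
  define T where "T = complex_of_real t"
  have k: "complex_of_real k = N * T" using n by (simp add: N_def T_def t_def)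
  have \<gamma>h: "complex_of_real (\<gamma> * (1 / real n)) = of_real \<gamma> / N" by (simp add: N_def)
  have En: "E n = U (n - 1) - (1 - \<i> * T) * U n" using n by (simp add: E_def T_def)
  \<comment> \<open>One formula for all rows: the conditionals drop the neighbours that are missing
    near the right end, and the \<open>of_bool\<close> terms confine the boundary contribution to
    the last two rows.\<close>
  have weak: "b m = (U m - U (m - 1) - (if m < n then U (m + 1) - U m else 0))
      - T\<^sup>2 / 6 * ((if m < n then 2 * U m + U (m + 1) else 0) + (U (m - 1) + 2 * U m))
      - \<i> * T * U n * of_bool (m = n)
      + of_real \<gamma> * ((if Suc m < n then E (Suc m) else 0) - 2 * (if m < n then E m else 0) + E (m - 1)
        - E n * (of_bool (m = n) - of_bool (Suc m = n) - \<i> * T * of_bool (m = n)))"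
    if m: "1 \<le> m" "m \<le> n" for m
  proof -
    define v where "v x = complex_of_real (hat n m x)" for x
    have v: "v \<in> V n" unfolding v_def by (rule hat_in_V[OF n m(1)])
    have vn: "v (node n j) = of_bool (j = m)" for j by (simp add: v_def hat_node[OF n])
    have v1: "v 1 = of_bool (m = n)" using vn[of n] node_n[OF n] by auto
    have rhs: "L2_inner f v = N * b m"
    proof -
      have "L2_inner f v = (LINT x|lebesgue_on {0<..<1}. of_real (hat n m x) * f x)"
        unfolding L2_inner_def v_def by (simp add: mult.commute)
      also have "\<dots> = integral {0..1} (\<lambda>x. of_real (hat n m x) * f x)"
        by (intro lebesgue_on_eq_integral absolutely_integrable_continuous_mult L2_absolutely_integrable f
            continuous_intros continuous_hat)
      finally show ?thesis using N by (simp add: b_def N_def)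
    qed
    have stiff: "L2_inner (D uh) (D v) = N * (U m - U (m - 1) - (if m < n then U (m + 1) - U m else 0))"
    proof -
      have "L2_inner (D uh) (D v) = N * ((\<Sum>j<n. (U (Suc j) - U j) * of_bool (Suc j = m))
          - (\<Sum>j<n. (U (Suc j) - U j) * of_bool (j = m)))"
        unfolding L2_inner_D_V[OF uh v n] vn Uf N_def
        by (simp only: complex_cnj_diff cb right_diff_distrib sum_subtractf)
      then show ?thesis using m unfolding sum_of_bool_less(1) sum_of_bool_less(2)[OF m] by simp
    qed
    have mass: "L2_inner uh v = ((if m < n then 2 * U m + U (m + 1) else 0) + (U (m - 1) + 2 * U m)) / (6 * N)"
    proof -
      have "L2_inner uh v = ((\<Sum>j<n. (2 * U j + U (Suc j)) * of_bool (j = m))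
          + (\<Sum>j<n. (U j + 2 * U (Suc j)) * of_bool (Suc j = m))) / (6 * N)"
        unfolding L2_inner_V[OF uh v n] vn Uf cb N_def sum.distrib[symmetric]
        by (intro arg_cong2[where f = "(/)"] sum.cong refl) (simp only: algebra_simps)
      then show ?thesis using m unfolding sum_of_bool_less(1) sum_of_bool_less(2)[OF m] by simp
    qed
    have ju: "jump n (D uh) j = - N * E j" if "j \<in> {1..<n}" for j
      using jump_V[OF uh n, of j] that by (auto simp: N_def E_def U_def)
    have jv: "jump n (D v) j = - N * (of_bool (j - 1 = m) - 2 * of_bool (j = m) + of_bool (Suc j = m))"
      if "j \<in> {1..<n}" for j
      using jump_V[OF v n, of j] that by (auto simp: N_def vn)
    have cnjN: "cnj N = N" by (simp add: N_def)
    have interior: "(\<Sum>j\<in>{1..<n}. of_real (\<gamma> * (1 / real n)) * jump n (D uh) j * cnj (jump n (D v) j))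
        = of_real \<gamma> * N * ((if Suc m < n then E (Suc m) else 0) - 2 * (if m < n then E m else 0) + E (m - 1))"
    proof -
      have "(\<Sum>j\<in>{1..<n}. of_real (\<gamma> * (1 / real n)) * jump n (D uh) j * cnj (jump n (D v) j))
        = (\<Sum>j\<in>{1..<n}. of_real \<gamma> * N * (E j * of_bool (j - 1 = m) - 2 * (E j * of_bool (j = m)) + E j * of_bool (Suc j = m)))"
      proof (rule sum.cong[OF refl])
        fix j assume j: "j \<in> {1..<n}"
        show "of_real (\<gamma> * (1 / real n)) * jump n (D uh) j * cnj (jump n (D v) j)
          = of_real \<gamma> * N * (E j * of_bool (j - 1 = m) - 2 * (E j * of_bool (j = m)) + E j * of_bool (Suc j = m))"
          unfolding ju[OF j] jv[OF j] \<gamma>h using N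
          by (simp add: cnjN field_simps del: of_bool_eq_iff)
      qed
      also have "\<dots> = of_real \<gamma> * N * ((\<Sum>j\<in>{1..<n}. E j * of_bool (j - 1 = m))
          - 2 * (\<Sum>j\<in>{1..<n}. E j * of_bool (j = m)) + (\<Sum>j\<in>{1..<n}. E j * of_bool (Suc j = m)))"
        by (simp only: sum_distrib_left[symmetric] sum.distrib sum_subtractf)
      also have "(\<Sum>j\<in>{1..<n}. E j * of_bool (Suc j = m)) = E (m - 1)"
        unfolding sum_of_bool_inner(2) using m by (cases "m = 1") (auto simp: E_def)
      finally show ?thesis
        unfolding sum_of_bool_inner(1) sum_of_bool_inner(3)[OF m(1)] using m by simp
    qed
    have bu: "left_limit (D uh) 1 - \<i> * of_real k * uh 1 = - N * E n"
      unfolding left_limit_V_at_1[OF uh n] U1 k En by (simp add: N_def U_def algebra_simps)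
    \<comment> \<open>Here the form being non-Hermitian matters: conjugating the whole factor would
      give 1 + iT instead of 1 - iT, and the last row would no longer repeat for E the pattern of
      \<open>E n\<close>.\<close>
    have bv: "cnj (left_limit (D v) 1) - \<i> * of_real k * cnj (v 1)
        = N * (of_bool (m = n) - of_bool (Suc m = n) - \<i> * T * of_bool (m = n))"
    proof -
      have "n - 1 = m \<longleftrightarrow> Suc m = n" using n by auto
      then show ?thesis
        unfolding left_limit_V_at_1[OF v n] v1 vn k using cnjN
        by (simp add: N_def algebra_simps)
    qed
    have "N * b m = a_form n \<gamma> k uh v"
      using sol v rhs by (simp add: cip_solution_def)
    also have "\<dots> = N * ((U m - U (m - 1) - (if m < n then U (m + 1) - U m else 0))
      - T\<^sup>2 / 6 * ((if m < n then 2 * U m + U (m + 1) else 0) + (U (m - 1) + 2 * U m))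
      - \<i> * T * U n * of_bool (m = n)
      + of_real \<gamma> * ((if Suc m < n then E (Suc m) else 0) - 2 * (if m < n then E m else 0) + E (m - 1)
        - E n * (of_bool (m = n) - of_bool (Suc m = n) - \<i> * T * of_bool (m = n))))"
    proof -
      define p q r where "p = U m - U (m - 1) - (if m < n then U (m + 1) - U m else 0)"
        and "q = (if m < n then 2 * U m + U (m + 1) else 0) + (U (m - 1) + 2 * U m)"
        and "r = (if Suc m < n then E (Suc m) else 0) - 2 * (if m < n then E m else 0) + E (m - 1)"
      define d where "d = (of_bool (m = n) :: complex)"
      define e where "e = (of_bool (Suc m = n) :: complex)"
      have cd: "cnj d = d" by (simp add: d_def)
      have "N * p - (N * T)\<^sup>2 * (q / (6 * N)) - \<i> * (N * T) * U n * cnj d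
          + (of_real \<gamma> * N * r + of_real \<gamma> / N * (- N * E n) * (N * (d - e - \<i> * T * d)))
        = N * (p - T\<^sup>2 / 6 * q - \<i> * T * U n * d + of_real \<gamma> * (r - E n * (d - e - \<i> * T * d)))"
        unfolding cd using N by (simp add: field_simps power2_eq_square)
      then show ?thesis
        unfolding a_form_def J_def Let_def stiff mass interior bu bv
        unfolding \<gamma>h U1 v1 k p_def[symmetric] q_def[symmetric] r_def[symmetric] d_def[symmetric] e_def[symmetric] .
    qed
    finally show ?thesis using N by simp
  qed
  have Tt: "of_real (1 + t\<^sup>2 / 6) = 1 + T\<^sup>2 / 6" "of_real (t\<^sup>2) = T\<^sup>2" by (simp_all add: T_def)
  show "\<gamma> * (E (m - 1) - 2 * E m + E (m + 1)) - of_real (1 + t\<^sup>2 / 6) * E m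
      - of_real (t\<^sup>2) * U m = b m" if m: "1 \<le> m" "m < n"
  proof -
    have "E m = U (m - 1) - 2 * U m + U (m + 1)" using m by (simp add: E_def)
    then have U: "U (m + 1) = E m - U (m - 1) + 2 * U m" by simp
    \<comment> \<open>The sum over jumps stops at n - 1; in row n - 1 the missing \<open>E n\<close>
      is supplied by the boundary term.\<close>
    have "(if Suc m < n then E (Suc m) else 0) + E n * of_bool (Suc m = n) = E (m + 1)"
      using m by (cases "Suc m = n") auto
    then have E: "(if Suc m < n then E (Suc m) else 0) = E (m + 1) - E n * of_bool (Suc m = n)"
      by (rule eq_diff_eq[THEN iffD2])
    show ?thesis
      unfolding Tt weak[OF m(1) less_imp_le[OF m(2)]] E U using m by (simp add: field_simps)
  qed
  \<comment> \<open>Eliminating \<open>U (n - 1)\<close> through \<open>E n\<close> shows the effect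
    of the half hat: \<open>U n\<close> keeps only the coefficient -t^2 (1/2 - it/6), which is
    recorded as a correction to -t^2.\<close>
  have U: "U (n - 1) = E n + (1 - \<i> * T) * U n" using En by simp
  have bn: "b n = U n - U (n - 1) - T\<^sup>2 / 6 * (U (n - 1) + 2 * U n) - \<i> * T * U n
      + of_real \<gamma> * (E (n - 1) - E n * (1 - \<i> * T))"
    using weak[of n] n by simp
  show "\<gamma> * (E (n - 1) - (1 - \<i> * t) * E n) - of_real (1 + t\<^sup>2 / 6) * E n
      - of_real (t\<^sup>2) * U n + of_real (t\<^sup>2) * (1 / 2 + \<i> * t / 6) * U n = b n"
    unfolding bn Tt T_def[symmetric] U by (simp add: field_simps power2_eq_square)
qed

section \<open>Comparison of the discrete and the exact solution\<close>

definition hat_integral :: "nat \<Rightarrow> (real \<Rightarrow> complex) \<Rightarrow> nat \<Rightarrow> complex" where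
  "hat_integral n f m = integral {0..1} (\<lambda>y. of_real (hat n m y) * f y)"

definition mass_on :: "(real \<Rightarrow> complex) \<Rightarrow> real \<Rightarrow> real \<Rightarrow> real" where
  "mass_on f a b = integral {a..b} (\<lambda>y. norm (f y))"

lemma mass_on_integrable:
  fixes f :: "real \<Rightarrow> complex"
  assumes "f absolutely_integrable_on {0..1}" "{a..b} \<subseteq> {0..1}"
  shows "(\<lambda>y. norm (f y)) integrable_on {a..b}"
proof -
  have "(\<lambda>y. norm (f y)) integrable_on {0..1}" using assms(1) by (simp add: absolutely_integrable_on_def)
  then show ?thesis by (rule integrable_on_subinterval) (rule assms(2))
qed

lemma mass_on_nonneg: "0 \<le> mass_on f a b"
  unfolding mass_on_def
  by (cases "(\<lambda>y. norm (f y)) integrable_on {a..b}")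
    (auto intro: Henstock_Kurzweil_Integration.integral_nonneg simp: not_integrable_integral)

lemma mass_on_restrict:
  assumes "f absolutely_integrable_on {0..1}" "{a..b} \<subseteq> {0..1}"
  shows "((\<lambda>y. of_bool (y \<in> {a..b}) * norm (f y)) has_integral mass_on f a b) {0..1}"
proof -
  have "((\<lambda>y. norm (f y)) has_integral mass_on f a b) {a..b}"
    unfolding mass_on_def using mass_on_integrable[OF assms] by blast
  then have "((\<lambda>y. if y \<in> {a..b} then norm (f y) else 0) has_integral mass_on f a b) {0..1}"
    unfolding has_integral_restrict[OF assms(2)] .
  then show ?thesis by (rule has_integral_eq[rotated]) auto
qed

text \<open>Separates uniform errors, paid with the L1 norm of f, from errors of size 1 on a few
  intervals, paid with local masses. It serves the comparison of loads and, with \<delta> = 0, the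
  support of a hat.\<close>

lemma norm_integral_le_weighted:
  assumes f: "f absolutely_integrable_on {0..1}" and i: "(\<lambda>y. w y * f y) integrable_on {0..1}"
    and K: "\<And>i. i \<in> I \<Longrightarrow> {l i..r i} \<subseteq> {0..1}" and fin: "finite I"
    and w: "\<And>y. y \<in> {0..1} \<Longrightarrow> norm (w y) \<le> \<delta> + (\<Sum>i\<in>I. of_bool (y \<in> {l i..r i}))"
  shows "norm (integral {0..1} (\<lambda>y. w y * f y :: complex)) \<le> \<delta> * mass_on f 0 1 + (\<Sum>i\<in>I. mass_on f (l i) (r i))"
proof -
  have "((\<lambda>y. norm (f y)) has_integral mass_on f 0 1) {0..1}"
    unfolding mass_on_def using mass_on_integrable[OF f] by blast
  then have B: "((\<lambda>y. \<delta> * norm (f y) + (\<Sum>i\<in>I. of_bool (y \<in> {l i..r i}) * norm (f y)))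
      has_integral \<delta> * mass_on f 0 1 + (\<Sum>i\<in>I. mass_on f (l i) (r i))) {0..1}"
    by (intro has_integral_add has_integral_mult_right has_integral_sum fin mass_on_restrict f K)
  have "norm (integral {0..1} (\<lambda>y. w y * f y))
      \<le> integral {0..1} (\<lambda>y. \<delta> * norm (f y) + (\<Sum>i\<in>I. of_bool (y \<in> {l i..r i}) * norm (f y)))"
  proof (rule integral_norm_bound_integral[OF i])
    show "(\<lambda>y. \<delta> * norm (f y) + (\<Sum>i\<in>I. of_bool (y \<in> {l i..r i}) * norm (f y))) integrable_on {0..1}"
      using B by blast
    fix y :: real assume y: "y \<in> {0..1}"
    have "norm (w y * f y) \<le> (\<delta> + (\<Sum>i\<in>I. of_bool (y \<in> {l i..r i}))) * norm (f y)"
      unfolding norm_mult using w[OF y] by (rule mult_right_mono) simp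
    then show "norm (w y * f y) \<le> \<delta> * norm (f y) + (\<Sum>i\<in>I. of_bool (y \<in> {l i..r i}) * norm (f y))"
      unfolding distrib_right sum_distrib_right .
  qed
  then show ?thesis using integral_unique[OF B] by simp
qed

lemma hat_product_integrable:
  assumes "f absolutely_integrable_on {0..1}"
  shows "(\<lambda>y. of_real (hat n m y) * f y :: complex) integrable_on {0..1}"
  using absolutely_integrable_continuous_mult[OF assms continuous_on_of_real[OF continuous_hat]]
  by (simp add: absolutely_integrable_on_def)

text \<open>A partial sum of hats is a continuous cut-off: it differs from the indicator of {0..x}
  only on the ramp {l..r}. Freezing the phase g at a node is an error only on the support of the hat
  there. Free l and r cover both a cell and a sum without ramp.\<close>

lemma load_comparison:
  fixes f g :: "real \<Rightarrow> complex" and c :: "nat \<Rightarrow> complex"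
  assumes f: "f absolutely_integrable_on {0..1}"
    and g: "continuous_on {0..1} g" "\<And>y. norm (g y) \<le> 1"
    and c: "\<And>m y. m \<le> j \<Longrightarrow> y \<in> {0..1} \<Longrightarrow> \<bar>real n * y - real m\<bar> \<le> 1 \<Longrightarrow> norm (c m - g y) \<le> \<delta>"
    and \<delta>: "0 \<le> \<delta>" and lr: "{l..r} \<subseteq> {0..1}" and x: "x \<in> {0..1}"
    and ramp: "\<And>y. y \<in> {0..1} \<Longrightarrow> y \<notin> {l..r} \<Longrightarrow> clamp01 (real j + 1 - real n * y) = of_bool (y \<le> x)"
  shows "norm ((\<Sum>m\<le>j. hat_integral n f m * c m) - integral {0..x} (\<lambda>y. g y * f y))
    \<le> \<delta> * mass_on f 0 1 + mass_on f l r"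
proof -
  define w where "w y = (\<Sum>m\<le>j. of_real (hat n m y) * c m) - of_bool (y \<le> x) * g y" for y
  have s1: "((\<lambda>y. \<Sum>m\<le>j. of_real (hat n m y) * f y * c m) has_integral (\<Sum>m\<le>j. hat_integral n f m * c m)) {0..1}"
    unfolding hat_integral_def
    by (intro has_integral_sum has_integral_mult_left integrable_integral hat_product_integrable f) simp
  have s2: "((\<lambda>y. of_bool (y \<le> x) * (g y * f y)) has_integral integral {0..x} (\<lambda>y. g y * f y)) {0..1}"
  proof -
    have sub: "{0..x} \<subseteq> {0..1}" using x by auto
    have "(\<lambda>y. g y * f y) integrable_on {0..x}"
      using absolutely_integrable_continuous_mult[OF f g(1)] integrable_on_subinterval[OF _ sub]
      by (auto simp: absolutely_integrable_on_def)
    then have "((\<lambda>y. if y \<in> {0..x} then g y * f y else 0) has_integral integral {0..x} (\<lambda>y. g y * f y)) {0..1}"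
      unfolding has_integral_restrict[OF sub] by (rule integrable_integral)
    then show ?thesis by (rule has_integral_eq[rotated]) auto
  qed
  have wi: "((\<lambda>y. w y * f y) has_integral
      (\<Sum>m\<le>j. hat_integral n f m * c m) - integral {0..x} (\<lambda>y. g y * f y)) {0..1}"
  proof (rule has_integral_eq[OF _ has_integral_diff[OF s1 s2]])
    fix y
    have "(\<Sum>m\<le>j. of_real (hat n m y) * f y * c m) = (\<Sum>m\<le>j. of_real (hat n m y) * c m) * f y"
      unfolding sum_distrib_right by (rule sum.cong) (simp_all add: mult_ac)
    then show "(\<Sum>m\<le>j. of_real (hat n m y) * f y * c m) - of_bool (y \<le> x) * (g y * f y) = w y * f y"
      by (simp add: w_def left_diff_distrib)
  qed
  have "norm (w y) \<le> \<delta> + (\<Sum>i\<in>{()}. of_bool (y \<in> {l..r}))" if y: "y \<in> {0..1}" for y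
  proof -
    define S where "S = (\<Sum>m\<le>j. hat n m y)"
    have S: "S = clamp01 (real j + 1 - real n * y)" unfolding S_def using y by (intro sum_hat) auto
    then have S01: "0 \<le> S" "S \<le> 1" by (auto simp: clamp01_def)
    have "w y = (\<Sum>m\<le>j. of_real (hat n m y) * (c m - g y)) + of_real (S - of_bool (y \<le> x)) * g y"
      unfolding w_def S_def by (simp add: right_diff_distrib left_diff_distrib sum_subtractf sum_distrib_right)
    also have "norm \<dots> \<le> norm (\<Sum>m\<le>j. of_real (hat n m y) * (c m - g y)) + norm (of_real (S - of_bool (y \<le> x)) * g y)"
      by (rule norm_triangle_ineq)
    also have "norm (\<Sum>m\<le>j. of_real (hat n m y) * (c m - g y)) \<le> (\<Sum>m\<le>j. hat n m y * \<delta>)"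
    proof (intro sum_norm_le)
      fix m assume "m \<in> {..j}"
      then show "norm (of_real (hat n m y) * (c m - g y)) \<le> hat n m y * \<delta>"
        using c[of m y] y hat_nonneg[of n m y] hat_outside[of n y m]
        by (cases "\<bar>real n * y - real m\<bar> \<le> 1") (auto simp: norm_mult intro!: mult_left_mono)
    qed
    also have "\<dots> = S * \<delta>" by (simp add: S_def sum_distrib_right)
    also have "\<dots> \<le> \<delta>" using S01 \<delta> by (simp add: mult_left_le_one_le)
    also have "norm (of_real (S - of_bool (y \<le> x)) * g y) \<le> \<bar>S - of_bool (y \<le> x)\<bar> * 1"
      unfolding norm_mult norm_of_real by (intro mult_left_mono g) auto
    also have "\<bar>S - of_bool (y \<le> x)\<bar> * 1 \<le> of_bool (y \<in> {l..r})"
      using S01 ramp[OF y] S by (cases "y \<in> {l..r}") auto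
    finally show ?thesis by simp
  qed
  then show ?thesis
    using norm_integral_le_weighted[OF f, of w "{()}" "\<lambda>_. l" "\<lambda>_. r" \<delta>] wi lr
    by (simp add: integral_unique has_integral_integrable)
qed

lemma sum_norm_hat_integral_le:
  assumes f: "f absolutely_integrable_on {0..1}"
  shows "(\<Sum>m\<le>n. norm (hat_integral n f m)) \<le> mass_on f 0 1"
proof -
  have i: "(\<lambda>y. hat n m y * norm (f y)) integrable_on {0..1}" for m
    using absolutely_integrable_bounded_measurable_product_real[of "hat n m" "{0..1}" "\<lambda>y. norm (f y)"]
      set_integrable_norm[OF f] continuous_hat
    by (auto simp: absolutely_integrable_on_def continuous_imp_measurable_on_sets_lebesgue compact_imp_bounded
        compact_continuous_image)
  have "norm (hat_integral n f m) \<le> integral {0..1} (\<lambda>y. hat n m y * norm (f y))" for m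
    unfolding hat_integral_def
    by (rule integral_norm_bound_integral[OF hat_product_integrable[OF f] i])
      (simp add: norm_mult hat_nonneg)
  then have "(\<Sum>m\<le>n. norm (hat_integral n f m)) \<le> (\<Sum>m\<le>n. integral {0..1} (\<lambda>y. hat n m y * norm (f y)))"
    by (intro sum_mono)
  also have "\<dots> = integral {0..1} (\<lambda>y. \<Sum>m\<le>n. hat n m y * norm (f y))"
    by (rule integral_sum[symmetric]) (auto intro: i)
  also have "\<dots> \<le> mass_on f 0 1"
    unfolding mass_on_def
  proof (rule integral_le)
    show "(\<lambda>y. \<Sum>m\<le>n. hat n m y * norm (f y)) integrable_on {0..1}" by (intro integrable_sum i) auto
    show "(\<lambda>y. norm (f y)) integrable_on {0..1}" using mass_on_integrable[OF f] by blast
    fix y :: real assume y: "y \<in> {0..1}"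
    have "(\<Sum>m\<le>n. hat n m y) \<le> 1" using y by (subst sum_hat) (auto simp: clamp01_def)
    then have "(\<Sum>m\<le>n. hat n m y) * norm (f y) \<le> 1 * norm (f y)" by (rule mult_right_mono) simp
    then show "(\<Sum>m\<le>n. hat n m y * norm (f y)) \<le> norm (f y)" by (simp add: sum_distrib_right)
  qed
  finally show ?thesis .
qed

text \<open>The last hat has only its left cell inside the interval, hence the case
  distinction.\<close>

lemma hat_integral_local:
  assumes f: "f absolutely_integrable_on {0..1}" and n: "n \<ge> 1" and m: "1 \<le> m" "m \<le> n"
  shows "norm (hat_integral n f m)
    \<le> mass_on f (node n (m - 1)) (node n m) + (if m < n then mass_on f (node n m) (node n (Suc m)) else 0)"
proof -
  define I where "I = (if m < n then {m - 1, m} else {m - 1})"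
  have sm: "Suc (m - Suc 0) = m" using m by simp
  have fin: "finite I" by (simp add: I_def)
  have I: "i < n" if "i \<in> I" for i using that m n by (auto simp: I_def split: if_splits)
  have "norm (hat_integral n f m) \<le> 0 * mass_on f 0 1 + (\<Sum>i\<in>I. mass_on f (node n i) (node n (Suc i)))"
    unfolding hat_integral_def
  proof (rule norm_integral_le_weighted[OF f hat_product_integrable[OF f] _ fin])
    show "cell n i \<subseteq> {0..1}" if "i \<in> I" for i by (rule element_subset[OF n I[OF that]])
    fix y :: real assume y: "y \<in> {0..1}"
    show "norm (complex_of_real (hat n m y)) \<le> 0 + (\<Sum>i\<in>I. of_bool (y \<in> cell n i))"
    proof (cases "\<exists>i\<in>I. y \<in> cell n i")
      case True
      then obtain i where i: "i \<in> I" "y \<in> cell n i" by blast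
      have "(1::real) = of_bool (y \<in> cell n i)" using i by simp
      also have "\<dots> \<le> (\<Sum>i\<in>I. of_bool (y \<in> cell n i))"
        by (rule member_le_sum[OF i(1) _ fin]) simp
      finally show ?thesis using hat_le_1[of n m y] hat_nonneg[of n m y] by simp
    next
      case False
      have "y < node n (m - 1) \<or> y > node n m" using False by (auto simp: I_def not_le sm split: if_splits)
      moreover have "m < n \<Longrightarrow> y < node n m \<or> y > node n (Suc m)"
        using False by (auto simp: I_def not_le sm split: if_splits)
      ultimately have "\<bar>real n * y - real m\<bar> \<ge> 1"
        using n m y by (cases "m < n") (auto simp: node_def field_simps of_nat_diff)
      then show ?thesis by (simp add: hat_outside sum_nonneg)
    qed
  qed
  also have "(\<Sum>i\<in>I. mass_on f (node n i) (node n (Suc i)))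
      = mass_on f (node n (m - 1)) (node n m) + (if m < n then mass_on f (node n m) (node n (Suc m)) else 0)"
    using m by (auto simp: I_def sm)
  finally show ?thesis by simp
qed

section \<open>Cauchy-Schwarz on elements\<close>

lemma L2_norm_squared:
  assumes "f \<in> L2"
  shows "(L2_norm f)\<^sup>2 = integral {0..1} (\<lambda>x. (norm (f x))\<^sup>2)" "0 \<le> L2_norm f"
    "(\<lambda>x. (norm (f x))\<^sup>2) integrable_on {0..1}"
proof -
  have i: "integrable (lebesgue_on {0<..<1}) (\<lambda>x. (norm (f x))\<^sup>2)" using assms by (simp add: L2_def)
  then show i': "(\<lambda>x. (norm (f x))\<^sup>2) integrable_on {0..1}"
    using integrable_on_lebesgue_on[OF i] integrable_on_open_interval_real by auto
  have "L2_inner f f = (LINT x|lebesgue_on {0<..<1}. of_real ((norm (f x))\<^sup>2))"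
    unfolding L2_inner_def by (intro Bochner_Integration.integral_cong refl) (rule complex_norm_square[symmetric])
  also have "\<dots> = of_real (LINT x|lebesgue_on {0<..<1}. (norm (f x))\<^sup>2)"
    by (rule integral_complex_of_real)
  also have "(LINT x|lebesgue_on {0<..<1}. (norm (f x))\<^sup>2) = integral {0..1} (\<lambda>x. (norm (f x))\<^sup>2)"
    using lebesgue_integral_eq_integral[OF i] integral_open_interval_real[of 0 1 "\<lambda>x. (norm (f x))\<^sup>2"] by simp
  finally have e: "Re (L2_inner f f) = integral {0..1} (\<lambda>x. (norm (f x))\<^sup>2)" by simp
  moreover have "0 \<le> integral {0..1} (\<lambda>x. (norm (f x))\<^sup>2)"
    by (rule Henstock_Kurzweil_Integration.integral_nonneg[OF i']) simp
  ultimately show "(L2_norm f)\<^sup>2 = integral {0..1} (\<lambda>x. (norm (f x))\<^sup>2)" "0 \<le> L2_norm f"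
    by (simp_all add: L2_norm_def)
qed

text \<open>From the nonnegativity of the integral of (|f| - c)^2, where c is the mean of |f| on the
  interval.\<close>

lemma mass_on_squared_le:
  assumes f: "f \<in> L2" and ab: "a < b" "{a..b} \<subseteq> {0..1}"
  shows "(mass_on f a b)\<^sup>2 \<le> (b - a) * integral {a..b} (\<lambda>x. (norm (f x))\<^sup>2)"
proof -
  define c where "c = mass_on f a b / (b - a)"
  have i1: "(\<lambda>x. norm (f x)) integrable_on {a..b}"
    by (rule mass_on_integrable[OF L2_absolutely_integrable[OF f] ab(2)])
  have i2: "(\<lambda>x. (norm (f x))\<^sup>2) integrable_on {a..b}"
    using integrable_on_subinterval[OF L2_norm_squared(3)[OF f] ab(2)] .
  have "((\<lambda>x. (norm (f x))\<^sup>2 - 2 * c * norm (f x) + c\<^sup>2) has_integral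
      integral {a..b} (\<lambda>x. (norm (f x))\<^sup>2) - 2 * c * mass_on f a b + (b - a) *\<^sub>R c\<^sup>2) {a..b}"
    unfolding mass_on_def
    by (intro has_integral_add has_integral_diff has_integral_mult_right integrable_integral i1 i2
        has_integral_const_real[of "c\<^sup>2" a b, simplified content_real[OF less_imp_le[OF ab(1)]]])
  then have "0 \<le> integral {a..b} (\<lambda>x. (norm (f x))\<^sup>2) - 2 * c * mass_on f a b + (b - a) *\<^sub>R c\<^sup>2"
  proof (rule has_integral_nonneg)
    fix x
    show "0 \<le> (norm (f x))\<^sup>2 - 2 * c * norm (f x) + c\<^sup>2"
      using sum_squares_bound[of "norm (f x)" c] by (simp add: mult_ac)
  qed
  also have "\<dots> = integral {a..b} (\<lambda>x. (norm (f x))\<^sup>2) - (mass_on f a b)\<^sup>2 / (b - a)"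
  proof -
    have "I - 2 * (m / L) * m + L *\<^sub>R (m / L)\<^sup>2 = I - m\<^sup>2 / L" if "L > 0" for I m L :: real
      using that by (simp add: power2_eq_square field_simps)
    then show ?thesis using ab unfolding c_def by simp
  qed
  finally show ?thesis using ab by (simp add: field_simps)
qed

lemma sum_mass_squared_le:
  assumes f: "f \<in> L2" and n: "n \<ge> 1"
  shows "(\<Sum>j<n. (mass_on f (node n j) (node n (Suc j)))\<^sup>2) \<le> (L2_norm f)\<^sup>2 / real n"
proof -
  have "(\<Sum>j<n. (mass_on f (node n j) (node n (Suc j)))\<^sup>2)
      \<le> (\<Sum>j<n. 1 / real n * integral (cell n j) (\<lambda>x. (norm (f x))\<^sup>2))"
    using mass_on_squared_le[OF f node_less[OF n] element_subset[OF n]]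
    by (intro sum_mono) (auto simp: node_Suc_diff)
  also have "\<dots> = (\<Sum>j<n. integral (cell n j) (\<lambda>x. (norm (f x))\<^sup>2)) / real n"
    by (simp add: sum_divide_distrib)
  also have "(\<Sum>j<m. integral (cell n j) (\<lambda>x. (norm (f x))\<^sup>2))
      = integral {0..node n m} (\<lambda>x. (norm (f x))\<^sup>2)" if "m \<le> n" for m
    using that
  proof (induction m)
    case (Suc m)
    have "{0..node n (Suc m)} \<subseteq> {0..1}"
      using element_subset[OF n, of m] Suc.prems node_less[OF n, of m] by auto
    then show ?case
      using Suc Henstock_Kurzweil_Integration.integral_combine[of 0 "node n m" "node n (Suc m)" "\<lambda>x. (norm (f x))\<^sup>2"]
        node_less[OF n, of m] node_le_iff[OF n, of 0 m] integrable_on_subinterval[OF L2_norm_squared(3)[OF f]]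
      by simp
  qed simp
  from this[of n] have "(\<Sum>j<n. integral (cell n j) (\<lambda>x. (norm (f x))\<^sup>2)) = (L2_norm f)\<^sup>2"
    using node_n[OF n] L2_norm_squared(1)[OF f] by simp
  finally show ?thesis .
qed

section \<open>Elementary bounds for complex exponentials\<close>

lemma norm_cis_diff_le: "norm (cis a - cis b) \<le> \<bar>a - b\<bar>"
proof -
  have "cis a - cis b = cis ((a + b) / 2) * (cis ((a - b) / 2) - cis (- ((a - b) / 2)))"
    by (simp add: right_diff_distrib cis_mult field_simps)
  also have "cis ((a - b) / 2) - cis (- ((a - b) / 2)) = 2 * \<i> * sin ((a - b) / 2)"
    by (simp add: complex_eq_iff)
  finally have "norm (cis a - cis b) = 2 * \<bar>sin ((a - b) / 2)\<bar>" by (simp add: norm_mult)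
  also have "\<dots> \<le> 2 * \<bar>(a - b) / 2\<bar>" using abs_sin_x_le_abs_x[of "(a - b) / 2"] by simp
  finally show ?thesis by simp
qed

lemma norm_inverse_one_plus_cis:
  assumes "\<bar>s\<bar> < pi / 2"
  shows "norm (1 / (1 + cis s)) \<le> 1" "norm (1 / (1 + cis s) - 1 / 2) \<le> \<bar>s\<bar> / 2"
proof -
  have c: "0 < cos s" using assms by (intro cos_gt_zero_pi) auto
  have "1 \<le> Re (1 + cis s)" using c by simp
  also have "\<dots> \<le> norm (1 + cis s)" by (rule complex_Re_le_cmod)
  finally have g1: "1 \<le> norm (1 + cis s)" .
  then show "norm (1 / (1 + cis s)) \<le> 1" by (simp add: norm_divide divide_le_eq)
  have nz: "1 + cis s \<noteq> 0" using g1 by auto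
  have "1 / (1 + cis s) - 1 / 2 = (cis 0 - cis s) / (2 * (1 + cis s))"
    using nz by (simp add: diff_frac_eq)
  then have "norm (1 / (1 + cis s) - 1 / 2) = norm (cis 0 - cis s) / (2 * norm (1 + cis s))"
    by (simp only: norm_divide norm_mult norm_numeral)
  also have "\<dots> \<le> \<bar>s\<bar> / 2"
    using norm_cis_diff_le[of 0 s] g1 by (intro frac_le) auto
  finally show "norm (1 / (1 + cis s) - 1 / 2) \<le> \<bar>s\<bar> / 2" .
qed

lemma norm_product_diff_le:
  fixes a b x y :: complex
  assumes "norm (a - b) \<le> \<epsilon>" "norm (x - y) \<le> \<eta>" "norm a \<le> 1" "norm y \<le> \<mu>"
  shows "norm (a * x - b * y) \<le> \<eta> + \<epsilon> * \<mu>"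
proof -
  have "a * x - b * y = a * (x - y) + (a - b) * y" by (simp add: algebra_simps)
  also have "norm \<dots> \<le> norm a * norm (x - y) + norm (a - b) * norm y"
    by (metis norm_mult norm_triangle_ineq)
  also have "\<dots> \<le> 1 * \<eta> + \<epsilon> * \<mu>"
    using assms by (intro add_mono mult_mono) (auto intro: order_trans[OF norm_ge_zero])
  finally show ?thesis by simp
qed

lemma cip_recurrence_instance:
  fixes f uh :: "real \<Rightarrow> complex" and k \<gamma> t s :: real and n :: nat
  assumes n: "n \<ge> 1" and t: "t = k / real n" "0 < t" "t \<le> 1" and \<gamma>: "\<gamma> \<noteq> 0" "\<bar>\<gamma>\<bar> \<le> 1 / 6"
    and f: "f \<in> L2" and sol: "cip_solution n \<gamma> k f uh" and s: "s = t_minus \<gamma> t"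
  obtains E where "cip_recurrence n t \<gamma> s (2 - 2 * cos s) (- (t\<^sup>2 / (\<gamma> * (2 - 2 * cos s))))
      (\<lambda>j. uh (node n j)) E (\<lambda>m. hat_integral n f m / of_nat n)"
proof
  let ?U = "\<lambda>j. uh (node n j)"
  let ?E = "\<lambda>j. if j = 0 then 0 else if j < n then ?U (j - 1) - 2 * ?U j + ?U (j + 1)
    else ?U (n - 1) - (1 - \<i> * of_real t) * ?U n"
  note P = t_minus_properties[OF t(2,3) \<gamma>, folded s]
  note rows = cip_rows[OF n f sol, folded t(1) hat_integral_def]
  show "cip_recurrence n t \<gamma> s (2 - 2 * cos s) (- (t\<^sup>2 / (\<gamma> * (2 - 2 * cos s)))) ?U ?E
      (\<lambda>m. hat_integral n f m / of_nat n)"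
    by unfold_locales (rule n t \<gamma> P refl rows | assumption | (use n in simp; fail))+
qed

text \<open>Multiplied by n, the formula for the differences of Y has the shape of
  \<open>exact_derivative\<close>. Three errors arise: phases and amplitude, uniformly of order
  \<delta>; the switch of the kernel inside the element of x, which costs the mass of that element;
  and the evanescent part w, bounded only in square sum.\<close>

lemma error_on_element:
  fixes f uh v :: "real \<Rightarrow> complex" and k \<gamma> t s \<delta> :: real and n :: nat
  assumes n: "n \<ge> 1" and k: "k \<ge> 1" and t: "t = k / real n" "t \<le> 1"
    and \<gamma>: "\<gamma> \<noteq> 0" "\<bar>\<gamma>\<bar> \<le> 1 / 6"
    and f: "f \<in> L2" and sol: "cip_solution n \<gamma> k f uh" and s: "s = t_minus \<gamma> t"
    and \<delta>: "\<delta> = t + \<bar>real n * s - k\<bar>"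
    and v: "\<And>x. x \<in> {0..1} \<Longrightarrow> v x = exact_derivative k f x"
  obtains w where "\<And>j. 0 \<le> w j"
    and "(\<Sum>j<n. (w j)\<^sup>2) \<le> 250 * real n * \<delta>\<^sup>2 * (L2_norm f)\<^sup>2"
    and "\<And>j x. j < n \<Longrightarrow> x \<in> cell n j \<Longrightarrow>
      norm (v x - of_nat n * (uh (node n (Suc j)) - uh (node n j)))
      \<le> 33 * \<delta> * L2_norm f + 5 * mass_on f (node n j) (node n (Suc j)) + w j"
proof -
  have t0: "0 < t" using n k by (simp add: t)
  define \<alpha> where "\<alpha> = 2 - 2 * cos s"
  define \<beta> where "\<beta> = - (t\<^sup>2 / (\<gamma> * \<alpha>))"
  define b where "b m = hat_integral n f m / of_nat n" for m
  obtain E where "cip_recurrence n t \<gamma> s \<alpha> \<beta> (\<lambda>j. uh (node n j)) E b"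
    using cip_recurrence_instance[OF n t(1) t0 t(2) \<gamma> f sol s]
    unfolding \<alpha>_def[symmetric] \<beta>_def[symmetric] b_def[abs_def, symmetric] by blast
  then interpret R: cip_recurrence n t \<gamma> s \<alpha> \<beta> "\<lambda>j. uh (node n j)" E b .
  define N where "N = complex_of_nat n"
  have N: "N \<noteq> 0" and normN: "norm N = real n" using n by (simp_all add: N_def)
  define M where "M = mass_on f 0 1"
  define L where "L = \<alpha> / t\<^sup>2"
  define P where "P = integral {0..1} (\<lambda>y. cis (k * y) * f y)"
  define I where "I \<sigma> x = integral {0..x} (\<lambda>y. cis (\<sigma> * k * y) * f y)" for \<sigma> x
  define S where "S \<sigma> j = (\<Sum>m\<le>j. hat_integral n f m * cis (real m * (\<sigma> * s)))" for \<sigma> j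
  have fa: "f absolutely_integrable_on {0..1}" by (rule L2_absolutely_integrable[OF f])
  have Mnn: "0 \<le> M" by (simp add: M_def mass_on_nonneg)
  have MN: "M \<le> L2_norm f"
  proof -
    have "M\<^sup>2 \<le> (L2_norm f)\<^sup>2"
      using mass_on_squared_le[OF f, of 0 1] L2_norm_squared(1)[OF f] by (simp add: M_def)
    then show ?thesis using L2_norm_squared(2)[OF f] by (rule power2_le_imp_le)
  qed
  have \<delta>t: "t \<le> \<delta>" and \<delta>0: "0 \<le> \<delta>" using t0 by (auto simp: \<delta>)
  have t2: "t\<^sup>2 \<le> t" "t\<^sup>2 \<le> 1" "0 < t\<^sup>2" using t0 t(2) by (auto simp: power2_eq_square mult_left_le mult_le_one)
  have st: "\<bar>s - t\<bar> * real n = \<bar>real n * s - k\<bar>"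
  proof -
    have "(s - t) * real n = real n * s - k" using n by (simp add: t field_simps)
    then show ?thesis by (metis abs_mult abs_of_nat)
  qed
  have s2: "\<bar>s\<bar> \<le> 2 * \<delta>"
  proof -
    define y where "y = \<bar>real n * s - k\<bar>"
    have "\<bar>s - t\<bar> * 1 \<le> \<bar>s - t\<bar> * real n" using n by (intro mult_left_mono) auto
    then have "\<bar>s - t\<bar> \<le> y" by (simp add: st y_def)
    moreover have "0 \<le> y" by (simp add: y_def)
    ultimately show ?thesis unfolding \<delta> y_def[symmetric] distrib_left using t0 by linarith
  qed
  have L: "0 \<le> L" "L \<le> 1" "1 - L \<le> t\<^sup>2 / 3"
  proof -
    show "0 \<le> L" "L \<le> 1" using R.\<alpha>_div_t2 by (simp_all add: L_def)
    have "t\<^sup>2 - \<alpha> = \<gamma> * \<alpha>\<^sup>2 + t\<^sup>2 * \<alpha> / 6" using R.\<alpha>(2) by (simp add: field_simps)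
    also have "\<dots> \<le> 1 / 6 * (t\<^sup>2 * t\<^sup>2) + t\<^sup>2 * t\<^sup>2 / 6"
    proof (rule add_mono)
      have "\<alpha>\<^sup>2 \<le> t\<^sup>2 * t\<^sup>2"
        unfolding power2_eq_square[of \<alpha>] using R.\<alpha>(3) R.\<alpha>_bounds by (intro mult_mono) auto
      then show "\<gamma> * \<alpha>\<^sup>2 \<le> 1 / 6 * (t\<^sup>2 * t\<^sup>2)"
        using \<gamma>(2) by (intro order_trans[OF mult_right_mono mult_left_mono]) auto
      show "t\<^sup>2 * \<alpha> / 6 \<le> t\<^sup>2 * t\<^sup>2 / 6"
        using R.\<alpha>(3) by (intro divide_right_mono mult_left_mono) auto
    qed
    finally have "t\<^sup>2 - \<alpha> \<le> (t\<^sup>2 / 3) * t\<^sup>2" by (simp add: algebra_simps)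
    then have "(t\<^sup>2 - \<alpha>) / t\<^sup>2 \<le> t\<^sup>2 / 3" using t2 by (simp only: divide_le_eq if_True)
    then show "1 - L \<le> t\<^sup>2 / 3" using t2 by (simp add: L_def diff_divide_distrib)
  qed
  \<comment> \<open>On the support of hat m, replacing y by the node costs t, while the mismatch m
    \<bar>s - t\<bar> accumulates along the interval up to n \<bar>s - t\<bar> = \<bar>ns - k\<bar>.
    This is how the error of the discrete wave number enters.\<close>
  have phase: "norm (cis (real m * (\<sigma> * s)) - cis (\<sigma> * k * y)) \<le> \<delta>"
    if "m \<le> n" "\<bar>real n * y - real m\<bar> \<le> 1" "\<bar>\<sigma>\<bar> = 1" for m y \<sigma>
  proof -
    have "real m * (\<sigma> * s) - \<sigma> * k * y = \<sigma> * (real m * (s - t) - t * (real n * y - real m))"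
      using n by (simp add: t field_simps)
    then have "\<bar>real m * (\<sigma> * s) - \<sigma> * k * y\<bar> = \<bar>real m * (s - t) - t * (real n * y - real m)\<bar>"
      using that by (simp add: abs_mult)
    also have "\<dots> \<le> real m * \<bar>s - t\<bar> + t * \<bar>real n * y - real m\<bar>"
      using t0 abs_triangle_ineq4[of "real m * (s - t)" "t * (real n * y - real m)"] by (simp add: abs_mult)
    also have "\<dots> \<le> real n * \<bar>s - t\<bar> + t * 1"
      using that t0 by (intro add_mono mult_mono) auto
    also have "\<dots> = \<delta>" using st by (simp add: \<delta> mult.commute)
    finally show ?thesis using norm_cis_diff_le order_trans by blast
  qed
  have SP: "norm (S 1 n - P) \<le> \<delta> * M"
  proof -
    \<comment> \<open>For j = n the hats sum to 1 on all of [0,1], so the ramp is the degenerate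
      interval {1..1}, of mass 0.\<close>
    have "norm (S 1 n - integral {0..1} (\<lambda>y. cis (k * y) * f y)) \<le> \<delta> * mass_on f 0 1 + mass_on f 1 1"
      unfolding S_def
      by (rule load_comparison[OF fa _ _ _ \<delta>0])
        (use phase[of _ _ 1] n in \<open>auto intro!: continuous_intros simp: clamp01_def\<close>)
    then show ?thesis by (simp add: P_def M_def mass_on_def)
  qed
  have SI: "norm (S \<sigma> j - I \<sigma> x) \<le> \<delta> * M + mass_on f (node n j) (node n (Suc j))"
    if j: "j < n" and x: "x \<in> cell n j" and \<sigma>: "\<bar>\<sigma>\<bar> = 1" for j x \<sigma>
    unfolding S_def I_def M_def
  proof (rule load_comparison[OF fa _ _ _ \<delta>0 element_subset[OF n j]])
    show "norm (cis (real m * (\<sigma> * s)) - cis (\<sigma> * k * y)) \<le> \<delta>"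
      if "m \<le> j" "\<bar>real n * y - real m\<bar> \<le> 1" for m y
      using phase[of m y \<sigma>] that j \<sigma> by simp
    show "x \<in> {0..1}" using x element_subset[OF n j] by blast
    fix y assume "y \<in> {0..1}" "y \<notin> cell n j"
    then consider "y < node n j" | "y > node n (Suc j)" by fastforce
    then show "clamp01 (real j + 1 - real n * y) = of_bool (y \<le> x)"
    proof cases
      case 1
      then have "real n * y \<le> real j" using n by (simp add: node_def field_simps)
      then show ?thesis using 1 x by (simp add: clamp01_def)
    next
      case 2
      then have "real j + 1 \<le> real n * y" using n by (simp add: node_def field_simps)
      then show ?thesis using 2 x by (simp add: clamp01_def)
    qed
  qed (auto intro!: continuous_intros)
  have Snorm: "norm (S \<sigma> j) \<le> M" if "j \<le> n" for \<sigma> j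
  proof -
    have "norm (S \<sigma> j) \<le> (\<Sum>m\<le>j. norm (hat_integral n f m))"
      unfolding S_def by (rule order_trans[OF norm_sum]) (simp add: norm_mult)
    also have "\<dots> \<le> (\<Sum>m\<le>n. norm (hat_integral n f m))" using that by (intro sum_mono2) auto
    also have "\<dots> \<le> M" unfolding M_def by (rule sum_norm_hat_integral_le[OF fa])
    finally show ?thesis .
  qed
  have LS: "norm (of_real L * S \<sigma> j - S \<sigma> j) \<le> t\<^sup>2 / 3 * M" if "j \<le> n" for \<sigma> j
  proof -
    have "of_real L * S \<sigma> j - S \<sigma> j = - (of_real (1 - L) * S \<sigma> j)" by (simp add: algebra_simps)
    then have "norm (of_real L * S \<sigma> j - S \<sigma> j) = \<bar>1 - L\<bar> * norm (S \<sigma> j)"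
      by (simp only: norm_minus_cancel norm_mult norm_of_real)
    also have "\<dots> \<le> t\<^sup>2 / 3 * M" using L Snorm[OF that] by (intro mult_mono) auto
    finally show ?thesis .
  qed
  have res: "N * R.residual (\<sigma> * s) j = N * R.amplitude - of_real L * S \<sigma> j" for \<sigma> j
  proof -
    have "N * (\<Sum>m\<le>j. b m * cis (real m * (\<sigma> * s))) = S \<sigma> j"
      unfolding S_def b_def sum_distrib_left using N by (intro sum.cong) (auto simp: N_def)
    then show ?thesis
      unfolding R.residual_def L_def R.lam_def by (simp add: right_diff_distrib mult.left_commute)
  qed
  have load: "R.load * real n \<le> M"
  proof -
    have "R.load * real n = (\<Sum>m\<le>n. norm (hat_integral n f m))"
      unfolding R.load_def b_def sum_distrib_right using n by (intro sum.cong) (auto simp: norm_divide)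
    then show ?thesis using sum_norm_hat_integral_le[OF fa, of n] by (simp add: M_def)
  qed
  \<comment> \<open>Since the residual at n is small, the amplitude is essentially the full load
    sum, just as the exact solution has the coefficient P.\<close>
  have amp: "norm (N * R.amplitude - P) \<le> (\<delta> + 7 * t\<^sup>2) * M"
  proof -
    have "N * R.amplitude - P = N * R.residual s n + ((of_real L * S 1 n - S 1 n) + (S 1 n - P))"
      using res[of 1 n] by simp
    also have "norm \<dots> \<le> norm (N * R.residual s n) + (norm (of_real L * S 1 n - S 1 n) + norm (S 1 n - P))"
      by (intro order_trans[OF norm_triangle_ineq] add_left_mono norm_triangle_ineq)
    also have "norm (N * R.residual s n) \<le> 6 * t\<^sup>2 * M"
    proof -
      have "norm (N * R.residual s n) \<le> real n * (6 * t\<^sup>2 * R.load)"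
        unfolding norm_mult normN by (intro mult_left_mono R.stability(1)) auto
      also have "\<dots> = 6 * t\<^sup>2 * (R.load * real n)" by simp
      also have "\<dots> \<le> 6 * t\<^sup>2 * M" using load by (intro mult_left_mono) auto
      finally show ?thesis .
    qed
    also have "norm (of_real L * S 1 n - S 1 n) \<le> t\<^sup>2 / 3 * M" by (rule LS) simp
    also note SP
    finally have "norm (N * R.amplitude - P) \<le> 6 * t\<^sup>2 * M + (t\<^sup>2 / 3 * M + \<delta> * M)" by simp
    also have "\<dots> \<le> (\<delta> + 7 * t\<^sup>2) * M"
      using mult_nonneg_nonneg[of "t\<^sup>2" M] Mnn by (simp add: algebra_simps)
    finally show ?thesis .
  qed
  define K where "K j = mass_on f (node n j) (node n (Suc j))" for j
  have Knn: "0 \<le> K j" for j by (simp add: K_def mass_on_nonneg)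
  have resid: "norm (N * R.residual (\<sigma> * s) j - (P - I \<sigma> x)) \<le> 10 * \<delta> * M + K j"
    if j: "j < n" and x: "x \<in> cell n j" and \<sigma>: "\<bar>\<sigma>\<bar> = 1" for j x \<sigma>
  proof -
    have "N * R.residual (\<sigma> * s) j - (P - I \<sigma> x)
      = (N * R.amplitude - P) - ((of_real L * S \<sigma> j - S \<sigma> j) + (S \<sigma> j - I \<sigma> x))"
      unfolding res by simp
    also have "norm \<dots> \<le> norm (N * R.amplitude - P) + (norm (of_real L * S \<sigma> j - S \<sigma> j) + norm (S \<sigma> j - I \<sigma> x))"
      by (intro order_trans[OF norm_triangle_ineq4] add_left_mono norm_triangle_ineq)
    also have "\<dots> \<le> (\<delta> + 7 * t\<^sup>2) * M + (t\<^sup>2 / 3 * M + (\<delta> * M + K j))"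
      using j by (intro add_mono amp LS SI[OF that, folded K_def]) auto
    also have "\<dots> = (2 * \<delta> + 22 / 3 * t\<^sup>2) * M + K j" by (simp add: algebra_simps)
    also have "\<dots> \<le> (10 * \<delta>) * M + K j"
      using t2 \<delta>t \<delta>0 Mnn by (intro add_right_mono mult_right_mono) auto
    finally show ?thesis by simp
  qed
  have Inorm: "norm (I \<sigma> x) \<le> M" if x: "x \<in> {0..1}" for \<sigma> x
  proof -
    have sub: "{0..x} \<subseteq> {0..1}" using x by auto
    have "norm (I \<sigma> x) \<le> integral {0..x} (\<lambda>y. norm (f y))"
      unfolding I_def
    proof (rule integral_norm_bound_integral)
      show "(\<lambda>y. cis (\<sigma> * k * y) * f y) integrable_on {0..x}"
      proof (rule integrable_on_subinterval[OF _ sub])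
        have "continuous_on {0..1} (\<lambda>y. cis (\<sigma> * k * y))" by (intro continuous_intros)
        then show "(\<lambda>y. cis (\<sigma> * k * y) * f y) integrable_on {0..1}"
          using absolutely_integrable_continuous_mult[OF fa] by (simp add: absolutely_integrable_on_def)
      qed
      show "(\<lambda>y. norm (f y)) integrable_on {0..x}" by (rule mass_on_integrable[OF fa sub])
    qed (simp add: norm_mult)
    also have "\<dots> \<le> M"
      unfolding M_def mass_on_def
      by (rule integral_subset_le[OF sub mass_on_integrable[OF fa sub] mass_on_integrable[OF fa]]) auto
    finally show ?thesis .
  qed
  have PI: "P = I 1 1" by (simp add: P_def I_def)
  have PInorm: "norm (P - I \<sigma> x) \<le> 2 * M" if "x \<in> {0..1}" for \<sigma> x
    using norm_triangle_ineq4[of P "I \<sigma> x"] Inorm[OF that, of \<sigma>] Inorm[of 1 1] unfolding PI by simp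
  \<comment> \<open>One travelling component. The prefactors differ by at most 3/2 \<delta>: the
    weight 1 / (1 + cis (\<sigma> s)) is within \<bar>s\<bar>/2 \<le> \<delta> of 1/2, and the
    phases contribute \<delta>/2. Times the bound 2 M for \<open>P - I \<sigma> x\<close> this adds
    3 \<delta> M to the error of the residual.\<close>
  have wave: "norm (cis (- (real j * (\<sigma> * s))) / (1 + cis (\<sigma> * s)) * (N * R.residual (\<sigma> * s) j)
      - cis (- (\<sigma> * k * x)) / 2 * (P - I \<sigma> x)) \<le> 13 * \<delta> * M + K j"
    if j: "j < n" and x: "x \<in> cell n j" and \<sigma>: "\<bar>\<sigma>\<bar> = 1" for j x \<sigma>
  proof -
    have x01: "x \<in> {0..1}" using x element_subset[OF n j] by blast
    have \<sigma>s: "\<bar>\<sigma> * s\<bar> < pi / 2" using \<sigma> R.s by (simp add: abs_mult)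
    have "norm (cis (- (real j * (\<sigma> * s))) / (1 + cis (\<sigma> * s)) - cis (- (\<sigma> * k * x)) / 2) \<le> 3 / 2 * \<delta>"
    proof -
      have "cis (- (real j * (\<sigma> * s))) / (1 + cis (\<sigma> * s)) - cis (- (\<sigma> * k * x)) / 2
        = cis (- (real j * (\<sigma> * s))) * (1 / (1 + cis (\<sigma> * s)) - 1 / 2)
          + (cis (real j * (- \<sigma> * s)) - cis (- \<sigma> * k * x)) / 2"
        by (simp add: algebra_simps diff_divide_distrib)
      also have "norm \<dots> \<le> norm (1 / (1 + cis (\<sigma> * s)) - 1 / 2)
          + norm (cis (real j * (- \<sigma> * s)) - cis (- \<sigma> * k * x)) / 2"
        by (rule order_trans[OF norm_triangle_ineq]) (simp add: norm_mult norm_divide)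
      also have "\<dots> \<le> \<bar>\<sigma> * s\<bar> / 2 + \<delta> / 2"
      proof (intro add_mono divide_right_mono norm_inverse_one_plus_cis \<sigma>s)
        have "\<bar>real n * x - real j\<bar> \<le> 1" using x n by (simp add: node_def field_simps)
        then show "norm (cis (real j * (- \<sigma> * s)) - cis (- \<sigma> * k * x)) \<le> \<delta>"
          using phase[of j x "- \<sigma>"] j \<sigma> by simp
      qed simp
      also have "\<dots> \<le> 3 / 2 * \<delta>" using s2 \<sigma> by (simp add: abs_mult)
      finally show ?thesis .
    qed
    then have "norm (cis (- (real j * (\<sigma> * s))) / (1 + cis (\<sigma> * s)) * (N * R.residual (\<sigma> * s) j)
        - cis (- (\<sigma> * k * x)) / 2 * (P - I \<sigma> x)) \<le> (10 * \<delta> * M + K j) + 3 / 2 * \<delta> * (2 * M)"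
    proof (rule norm_product_diff_le[OF _ resid[OF that] _ PInorm[OF x01]])
      show "norm (cis (- (real j * (\<sigma> * s))) / (1 + cis (\<sigma> * s))) \<le> 1"
        using norm_inverse_one_plus_cis(1)[OF \<sigma>s] by (simp add: norm_divide)
    qed
    then show ?thesis by (simp add: mult_ac)
  qed
  have dY: "norm (N * (R.Y (j + 1) - R.Y j) - v x) \<le> 26 * \<delta> * M + 2 * K j"
    if j: "j < n" and x: "x \<in> cell n j" for j x
  proof -
    have x01: "x \<in> {0..1}" using x element_subset[OF n j] by blast
    have "v x = cis (- (1 * k * x)) / 2 * (P - I 1 x) + cis (- (-1 * k * x)) / 2 * (P - I (-1) x)"
      using v[OF x01] by (simp add: exact_derivative_def P_def I_def add_divide_distrib)
    moreover have "N * (R.Y (j + 1) - R.Y j)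
      = cis (- (real j * (1 * s))) / (1 + cis (1 * s)) * (N * R.residual (1 * s) j)
        + cis (- (real j * (-1 * s))) / (1 + cis (-1 * s)) * (N * R.residual (-1 * s) j)"
      unfolding R.difference_Y[OF j] by (simp add: distrib_left mult_ac)
    ultimately have "N * (R.Y (j + 1) - R.Y j) - v x
      = (cis (- (real j * (1 * s))) / (1 + cis (1 * s)) * (N * R.residual (1 * s) j)
          - cis (- (1 * k * x)) / 2 * (P - I 1 x))
        + (cis (- (real j * (-1 * s))) / (1 + cis (-1 * s)) * (N * R.residual (-1 * s) j)
          - cis (- (-1 * k * x)) / 2 * (P - I (-1) x))"
      by simp
    also have "norm \<dots> \<le> (13 * \<delta> * M + K j) + (13 * \<delta> * M + K j)"
      by (intro order_trans[OF norm_triangle_ineq] add_mono wave j x) auto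
    finally show ?thesis by (simp add: mult_ac)
  qed
  have vnorm: "norm (v x) \<le> 2 * M" if x: "x \<in> {0..1}" for x
  proof -
    have "v x = (cis (- (k * x)) * (P - I 1 x) + cis (k * x) * (P - I (-1) x)) / 2"
      using v[OF x] by (simp add: exact_derivative_def P_def I_def)
    then have "norm (v x) = norm (cis (- (k * x)) * (P - I 1 x) + cis (k * x) * (P - I (-1) x)) / 2"
      by (simp only: norm_divide norm_numeral)
    also have "\<dots> \<le> (norm (P - I 1 x) + norm (P - I (-1) x)) / 2"
      by (intro divide_right_mono order_trans[OF norm_triangle_ineq]) (simp_all add: norm_mult)
    finally have "norm (v x) \<le> (norm (P - I 1 x) + norm (P - I (-1) x)) / 2" .
    then show ?thesis using PInorm[OF x, of 1] PInorm[OF x, of "-1"] by argo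
  qed
  \<comment> \<open>W enters the slope of \<open>uh\<close> with the factor n / (\<beta> -
    \<alpha>), and \<bar>\<beta> - \<alpha>\<bar> \<ge> 5.\<close>
  define w where "w j = (if j < n then real n / 5 * (norm (R.W (Suc j)) + norm (R.W j)) else 0)" for j
  show ?thesis
  proof
    show "0 \<le> w j" for j by (simp add: w_def)
    have "norm (v x - N * (uh (node n (Suc j)) - uh (node n j))) \<le> 33 * \<delta> * M + 5 * K j + w j"
      if j: "j < n" and x: "x \<in> cell n j" for j x
    proof -
      have x01: "x \<in> {0..1}" using x element_subset[OF n j] by blast
      define d where "d = N * (R.Y (j + 1) - R.Y j)"
      define W where "W = N * (R.W (j + 1) - R.W j)"
      have ba: "norm (complex_of_real \<beta> - complex_of_real \<alpha>) = \<bar>\<beta> - \<alpha>\<bar>" by (simp flip: of_real_diff)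
      have "(\<beta> - \<alpha>) * (N * (uh (node n (Suc j)) - uh (node n j))) = \<beta> * d - W"
        using arg_cong[OF R.difference_U[of j], of "\<lambda>z. N * z"] by (simp add: d_def W_def algebra_simps)
      \<comment> \<open>As \<beta> is unbounded when \<gamma> tends to 0, the factor \<beta> -
        \<alpha> is kept to the end and cancelled there. The leftover \<alpha> v is harmless because
        \<alpha> \<le> t^2 \<le> \<delta>.\<close>
      then have "(\<beta> - \<alpha>) * (v x - N * (uh (node n (Suc j)) - uh (node n j)))
        = (\<beta> - \<alpha>) * v x - (\<beta> * d - W)"
        by (simp add: right_diff_distrib)
      also have "\<dots> = W - (\<beta> * (d - v x) + \<alpha> * v x)" by (simp add: algebra_simps)
      finally have "\<bar>\<beta> - \<alpha>\<bar> * norm (v x - N * (uh (node n (Suc j)) - uh (node n j)))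
        = norm (W - (\<beta> * (d - v x) + \<alpha> * v x))"
        unfolding ba[symmetric] norm_mult[symmetric] by simp
      also have "\<dots> \<le> norm W + (norm (\<beta> * (d - v x)) + norm (\<alpha> * v x))"
        by (intro order_trans[OF norm_triangle_ineq4] add_left_mono norm_triangle_ineq)
      also have "\<dots> = norm W + (\<bar>\<beta>\<bar> * norm (d - v x) + \<alpha> * norm (v x))"
        using R.\<alpha>_bounds by (simp add: norm_mult)
      also have "\<dots> \<le> norm W + ((6 / 5 * \<bar>\<beta> - \<alpha>\<bar>) * (26 * \<delta> * M + 2 * K j) + \<delta> * (2 * M))"
        using R.\<beta>_bounds R.\<alpha>_bounds R.\<alpha>(3) t2 \<delta>t \<delta>0 dY[OF j x] vnorm[OF x01]
        by (intro add_mono mult_mono order_refl) (auto simp: d_def)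
      also have "\<dots> \<le> \<bar>\<beta> - \<alpha>\<bar> * (norm W / 5) + ((6 / 5 * \<bar>\<beta> - \<alpha>\<bar>) * (26 * \<delta> * M + 2 * K j)
          + \<bar>\<beta> - \<alpha>\<bar> * (2 / 5 * \<delta> * M))"
      proof (intro add_mono order_refl)
        have 5: "5 * z \<le> \<bar>\<beta> - \<alpha>\<bar> * z" if "0 \<le> z" for z using R.\<beta>_bounds(2) that by (rule mult_right_mono)
        show "norm W \<le> \<bar>\<beta> - \<alpha>\<bar> * (norm W / 5)" using 5[of "norm W / 5"] by simp
        show "\<delta> * (2 * M) \<le> \<bar>\<beta> - \<alpha>\<bar> * (2 / 5 * \<delta> * M)" using 5[of "2 / 5 * \<delta> * M"] \<delta>0 Mnn by simp
      qed
      also have "\<dots> = \<bar>\<beta> - \<alpha>\<bar> * (norm W / 5 + 6 / 5 * (26 * \<delta> * M + 2 * K j) + 2 / 5 * \<delta> * M)"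
        by (simp add: algebra_simps)
      finally have "norm (v x - N * (uh (node n (Suc j)) - uh (node n j)))
          \<le> norm W / 5 + 6 / 5 * (26 * \<delta> * M + 2 * K j) + 2 / 5 * \<delta> * M"
        by (rule mult_left_le_imp_le) (use R.\<beta>_bounds in linarith)
      also have "norm W / 5 \<le> w j"
      proof -
        have "norm W = real n * norm (R.W (Suc j) - R.W j)" by (simp add: W_def norm_mult normN)
        also have "\<dots> \<le> real n * (norm (R.W (Suc j)) + norm (R.W j))"
          by (intro mult_left_mono norm_triangle_ineq4) auto
        finally show ?thesis using j by (simp add: w_def)
      qed
      also have "w j + 6 / 5 * (26 * \<delta> * M + 2 * K j) + 2 / 5 * \<delta> * M \<le> 33 * \<delta> * M + 5 * K j + w j"
        using mult_nonneg_nonneg[OF \<delta>0 Mnn] Knn[of j] by (simp add: algebra_simps)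
      finally show ?thesis by simp
    qed
    moreover have "33 * \<delta> * M \<le> 33 * \<delta> * L2_norm f" using MN \<delta>0 by (intro mult_left_mono) auto
    ultimately show "norm (v x - of_nat n * (uh (node n (Suc j)) - uh (node n j)))
      \<le> 33 * \<delta> * L2_norm f + 5 * mass_on f (node n j) (node n (Suc j)) + w j"
      if "j < n" "x \<in> cell n j" for j x
      using that unfolding N_def K_def by fastforce
    show "(\<Sum>j<n. (w j)\<^sup>2) \<le> 250 * real n * \<delta>\<^sup>2 * (L2_norm f)\<^sup>2"
    proof -
      define \<omega> where "\<omega> = L2_set (\<lambda>j. norm (R.W j)) {1..n}"
      define B where "B = R.load2"
      have \<omega>0: "0 \<le> \<omega>" by (simp add: \<omega>_def)
      have \<omega>2: "(\<Sum>j\<in>{1..n}. (norm (R.W j))\<^sup>2) = \<omega>\<^sup>2" "(\<Sum>j\<in>{1..n}. (norm (b j))\<^sup>2) = B\<^sup>2"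
        by (simp_all add: \<omega>_def B_def R.load2_def L2_set_def sum_nonneg)
      have "(w j)\<^sup>2 \<le> 2 * (real n)\<^sup>2 / 25 * ((norm (R.W (Suc j)))\<^sup>2 + (norm (R.W j))\<^sup>2)" if "j < n" for j
      proof -
        have "(w j)\<^sup>2 = (real n)\<^sup>2 / 25 * (norm (R.W (Suc j)) + norm (R.W j))\<^sup>2"
          using that by (simp add: w_def power_mult_distrib power_divide)
        also have "\<dots> \<le> (real n)\<^sup>2 / 25 * (2 * ((norm (R.W (Suc j)))\<^sup>2 + (norm (R.W j))\<^sup>2))"
          using sum_squares_bound[of "norm (R.W (Suc j))" "norm (R.W j)"]
          by (intro mult_left_mono) (simp_all add: power2_sum)
        finally show ?thesis by (simp add: distrib_left mult_ac)
      qed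
      then have "(\<Sum>j<n. (w j)\<^sup>2) \<le> (\<Sum>j<n. 2 * (real n)\<^sup>2 / 25 * ((norm (R.W (Suc j)))\<^sup>2 + (norm (R.W j))\<^sup>2))"
        by (intro sum_mono) auto
      also have "\<dots> = 2 * (real n)\<^sup>2 / 25 * ((\<Sum>j<n. (norm (R.W (Suc j)))\<^sup>2) + (\<Sum>j<n. (norm (R.W j))\<^sup>2))"
        by (simp only: sum_distrib_left[symmetric] sum.distrib)
      also have "(\<Sum>j<n. (norm (R.W (Suc j)))\<^sup>2) = \<omega>\<^sup>2"
        unfolding \<omega>2(1)[symmetric] by (rule sum.reindex_bij_witness[of _ "\<lambda>j. j - 1" Suc]) auto
      also have "(\<Sum>j<n. (norm (R.W j))\<^sup>2) \<le> \<omega>\<^sup>2"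
      proof -
        have "(\<Sum>j<n. (norm (R.W j))\<^sup>2) \<le> (\<Sum>j\<in>insert 0 {1..n}. (norm (R.W j))\<^sup>2)" by (rule sum_mono2) auto
        then show ?thesis by (simp add: \<omega>2(1)[symmetric] R.W0)
      qed
      finally have 1: "(\<Sum>j<n. (w j)\<^sup>2) \<le> 4 * (real n)\<^sup>2 / 25 * \<omega>\<^sup>2" by (simp add: mult_left_mono)
      have "\<omega>\<^sup>2 \<le> (5 * B + 26 * t * R.load)\<^sup>2"
        using R.stability(2) \<omega>0 unfolding \<omega>_def B_def by (intro power_mono) auto
      also have "\<dots> \<le> 50 * B\<^sup>2 + 1352 * (t * R.load)\<^sup>2"
        using sum_squares_bound[of "5 * B" "26 * t * R.load"] by (simp add: power2_eq_square algebra_simps)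
      \<comment> \<open>Each load is 1/n times an integral over at most two cells, and
        Cauchy-Schwarz on cells gains another 1/n after squaring. The 4 is 2 from squaring a sum
        times 2 because each cell meets two hats.\<close>
      also have "B\<^sup>2 \<le> 4 * (L2_norm f)\<^sup>2 / real n ^ 3"
      proof -
        have "(norm (hat_integral n f m))\<^sup>2 \<le> 2 * ((K (m - 1))\<^sup>2 + (if m < n then (K m)\<^sup>2 else 0))" if "m \<in> {1..n}" for m
        proof -
          define z where "z = (if m < n then K m else 0)"
          have "norm (hat_integral n f m) \<le> K (m - 1) + z"
            using hat_integral_local[OF fa n, of m] that by (auto simp: K_def z_def)
          then have "(norm (hat_integral n f m))\<^sup>2 \<le> (K (m - 1) + z)\<^sup>2" by (intro power_mono) auto
          also have "\<dots> \<le> 2 * ((K (m - 1))\<^sup>2 + z\<^sup>2)"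
            using sum_squares_bound[of "K (m - 1)" z] by (simp add: power2_sum)
          finally show ?thesis by (simp add: z_def split: if_splits)
        qed
        then have "(\<Sum>m\<in>{1..n}. (norm (hat_integral n f m))\<^sup>2)
            \<le> (\<Sum>m\<in>{1..n}. 2 * ((K (m - 1))\<^sup>2 + (if m < n then (K m)\<^sup>2 else 0)))"
          by (rule sum_mono)
        also have "\<dots> = 2 * ((\<Sum>m\<in>{1..n}. (K (m - 1))\<^sup>2) + (\<Sum>m\<in>{1..n}. if m < n then (K m)\<^sup>2 else 0))"
          by (simp only: sum_distrib_left[symmetric] sum.distrib)
        also have "(\<Sum>m\<in>{1..n}. (K (m - 1))\<^sup>2) = (\<Sum>j<n. (K j)\<^sup>2)"
          by (rule sum.reindex_bij_witness[of _ Suc "\<lambda>j. j - 1"]) auto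
        also have "(\<Sum>m\<in>{1..n}. if m < n then (K m)\<^sup>2 else 0) = (\<Sum>m\<in>{1..<n}. (K m)\<^sup>2)"
          by (rule sum.mono_neutral_cong_right) auto
        also have "\<dots> \<le> (\<Sum>j<n. (K j)\<^sup>2)" by (rule sum_mono2) auto
        finally have "(\<Sum>m\<in>{1..n}. (norm (hat_integral n f m))\<^sup>2) \<le> 4 * ((L2_norm f)\<^sup>2 / real n)"
          using sum_mass_squared_le[OF f n] unfolding K_def[symmetric] by simp
        moreover have "B\<^sup>2 = (\<Sum>m\<in>{1..n}. (norm (hat_integral n f m))\<^sup>2) / (real n)\<^sup>2"
          unfolding \<omega>2(2)[symmetric] b_def by (simp add: norm_divide power_divide sum_divide_distrib)
        ultimately have "B\<^sup>2 \<le> 4 * ((L2_norm f)\<^sup>2 / real n) / (real n)\<^sup>2"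
          by (simp only: divide_right_mono zero_le_power2)
        then show ?thesis by (simp add: power2_eq_square power3_eq_cube)
      qed
      also have "(t * R.load)\<^sup>2 \<le> (t * (L2_norm f / real n))\<^sup>2"
        using load MN n t0 R.load_bounds(1) by (intro power_mono mult_left_mono) (auto simp: le_divide_eq)
      finally have 2: "\<omega>\<^sup>2 \<le> 50 * (4 * (L2_norm f)\<^sup>2 / real n ^ 3) + 1352 * (t * (L2_norm f / real n))\<^sup>2" by simp
      have "(\<Sum>j<n. (w j)\<^sup>2) \<le> 4 * (real n)\<^sup>2 / 25
          * (50 * (4 * (L2_norm f)\<^sup>2 / real n ^ 3) + 1352 * (t * (L2_norm f / real n))\<^sup>2)"
        using 2 by (intro order_trans[OF 1] mult_left_mono) auto
      also have "\<dots> = (32 * (1 / real n)\<^sup>2 * real n + 5408 / 25 * t\<^sup>2) * (L2_norm f)\<^sup>2"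
        using n by (simp add: field_simps power2_eq_square power3_eq_cube)
      also have "\<dots> \<le> (32 * \<delta>\<^sup>2 * real n + 5408 / 25 * (\<delta>\<^sup>2 * real n)) * (L2_norm f)\<^sup>2"
      proof (intro mult_right_mono add_mono mult_left_mono)
        \<comment> \<open>From k \<ge> 1: 1/n \<le> k/n = t \<le> \<delta>.\<close>
        have "1 / real n \<le> \<delta>" using \<delta>t k n by (intro order_trans[OF _ \<delta>t]) (simp add: t divide_right_mono)
        then show "(1 / real n)\<^sup>2 \<le> \<delta>\<^sup>2" by (intro power_mono) auto
        have "t\<^sup>2 * 1 \<le> \<delta>\<^sup>2 * real n" using \<delta>t t0 n by (intro mult_mono power_mono) auto
        then show "t\<^sup>2 \<le> \<delta>\<^sup>2 * real n" by simp
      qed auto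
      also have "\<dots> \<le> 250 * (real n * \<delta>\<^sup>2) * (L2_norm f)\<^sup>2"
        by (intro mult_right_mono) (auto simp: algebra_simps)
      finally show ?thesis by (simp add: mult_ac)
    qed
  qed
qed

text \<open>The one-sided limits of the derivative at a node are values of its continuous extensions
  from the two adjacent closed cells, so the same bounds e control the jumps. Each e j enters at
  most two jumps, each time with a factor 2 \<bar>\<gamma>\<bar> \<le> 1/3; this adds 2/3 to the 1
  of the L2 part.\<close>

lemma norm_1h_le:
  fixes u uh v :: "real \<Rightarrow> complex" and e :: "nat \<Rightarrow> real"
  assumes n: "n \<ge> 1" and \<gamma>: "\<bar>\<gamma>\<bar> \<le> 1 / 6" and uh: "uh \<in> V n"
    and vc: "continuous_on {0..1} v"
    and u: "\<And>x. x \<in> {0<..<1} \<Longrightarrow> (u has_vector_derivative v x) (at x)"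
    and e: "\<And>j x. j < n \<Longrightarrow> x \<in> cell n j \<Longrightarrow>
      norm (v x - of_nat n * (uh (node n (Suc j)) - uh (node n j))) \<le> e j"
  shows "(norm_1h n \<gamma> (\<lambda>x. u x - uh x))\<^sup>2 \<le> 5 / 3 * ((\<Sum>j<n. (e j)\<^sup>2) / real n)"
proof -
  define w where "w x = u x - uh x" for x
  define g where "g j x = v x - of_nat n * (uh (node n (Suc j)) - uh (node n j))" for j x
  have gc: "continuous_on (cell n j) (g j)" if "j < n" for j
    unfolding g_def using continuous_on_subset[OF vc element_subset[OF n that]] by (intro continuous_intros)
  have Dw: "D w x = g j x" if j: "j < n" and x: "x \<in> open_cell n j" for j x
  proof -
    have "0 \<le> node n j" "node n (Suc j) \<le> 1"
      using element_subset[OF n j] node_less[OF n, of j] by auto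
    then have "x \<in> {0<..<1}" using x by auto
    then show ?thesis
      unfolding D_def w_def g_def
      by (intro vector_derivative_at has_vector_derivative_diff u V_derivative[OF uh n j x])
  qed
  have e0: "0 \<le> e j" if "j < n" for j
    using e[OF that, of "node n j"] node_less[OF n, of j] by (force intro: order_trans[OF norm_ge_zero])
  have ge: "norm (g j x) \<le> e j" if "j < n" "x \<in> cell n j" for j x
    using e[OF that] by (simp add: g_def)
  have "L2_inner (D w) (D w) = (\<Sum>j<n. integral (cell n j) (\<lambda>x. g j x * cnj (g j x)))"
    unfolding L2_inner_def
    by (rule piecewise_continuous_integral(2)[OF n]) (auto simp: Dw intro!: continuous_intros gc)
  moreover have "norm (integral (cell n j) (\<lambda>x. g j x * cnj (g j x))) \<le> (e j)\<^sup>2 / real n"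
    if j: "j < n" for j
  proof -
    have "norm (integral (cell n j) (\<lambda>x. g j x * cnj (g j x)))
        \<le> (e j)\<^sup>2 * (node n (Suc j) - node n j)"
    proof (rule integral_bound)
      show "node n j \<le> node n (Suc j)" using node_less[OF n, of j] by simp
      show "continuous_on (cell n j) (\<lambda>x. g j x * cnj (g j x))"
        by (intro continuous_intros gc j)
      fix x assume x: "x \<in> cell n j"
      show "norm (g j x * cnj (g j x)) \<le> (e j)\<^sup>2"
        using power_mono[OF ge[OF j x], of 2] by (simp add: norm_mult power2_eq_square)
    qed
    then show ?thesis by (simp add: node_Suc_diff)
  qed
  ultimately have "norm (L2_inner (D w) (D w)) \<le> (\<Sum>j<n. (e j)\<^sup>2 / real n)"
    by (auto intro!: sum_norm_le)
  then have Re: "Re (L2_inner (D w) (D w)) \<le> (\<Sum>j<n. (e j)\<^sup>2) / real n"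
    using complex_Re_le_cmod[of "L2_inner (D w) (D w)"] by (simp add: sum_divide_distrib)
  have Re0: "0 \<le> Re (L2_inner (D w) (D w))"
  proof -
    have "L2_inner (D w) (D w) = (LINT x|lebesgue_on {0<..<1}. of_real ((norm (D w x))\<^sup>2))"
      unfolding L2_inner_def by (intro Bochner_Integration.integral_cong refl) (rule complex_norm_square[symmetric])
    also have "\<dots> = of_real (LINT x|lebesgue_on {0<..<1}. (norm (D w x))\<^sup>2)" by (rule integral_complex_of_real)
    finally show ?thesis by simp
  qed
  have L2: "(L2_norm (D w))\<^sup>2 \<le> (\<Sum>j<n. (e j)\<^sup>2) / real n"
    using Re Re0 by (simp add: L2_norm_def)
  have jumps: "(norm (jump n (D w) j))\<^sup>2 \<le> 2 * ((e (j - 1))\<^sup>2 + (e j)\<^sup>2)" if j: "j \<in> {1..<n}" for j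
  proof -
    have j': "j - 1 < n" "j < n" "Suc (j - 1) = j" using j by auto
    have "left_limit (D w) (node n j) = g (j - 1) (node n j)"
      using left_limit_eq[OF node_less[OF n, of "j - 1"] gc[OF j'(1)] Dw[OF j'(1)]] unfolding j'(3) .
    moreover have "right_limit (D w) (node n j) = g j (node n j)"
      by (rule right_limit_eq[OF node_less[OF n] gc[OF j'(2)] Dw[OF j'(2)]])
    moreover have "norm (g (j - 1) (node n j)) \<le> e (j - 1)"
      using ge[OF j'(1), of "node n j"] node_less[OF n, of "j - 1"] unfolding j'(3) by simp
    moreover have "norm (g j (node n j)) \<le> e j"
      using ge[OF j'(2), of "node n j"] node_less[OF n, of j] by simp
    ultimately have "norm (jump n (D w) j) \<le> e (j - 1) + e j"
      unfolding jump_def using norm_triangle_ineq4[of "g (j - 1) (node n j)" "g j (node n j)"] by simp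
    then have "(norm (jump n (D w) j))\<^sup>2 \<le> (e (j - 1) + e j)\<^sup>2" by (intro power_mono) auto
    also have "\<dots> \<le> 2 * ((e (j - 1))\<^sup>2 + (e j)\<^sup>2)"
      using sum_squares_bound[of "e (j - 1)" "e j"] by (simp add: power2_sum)
    finally show ?thesis .
  qed
  have "(\<Sum>j\<in>{1..<n}. \<bar>\<gamma>\<bar> * (1 / real n) * (norm (jump n (D w) j))\<^sup>2)
      \<le> (\<Sum>j\<in>{1..<n}. 1 / (3 * real n) * ((e (j - 1))\<^sup>2 + (e j)\<^sup>2))"
  proof (rule sum_mono)
    fix j assume j: "j \<in> {1..<n}"
    have "\<bar>\<gamma>\<bar> * (1 / real n) * (norm (jump n (D w) j))\<^sup>2
        \<le> 1 / 6 * (1 / real n) * (2 * ((e (j - 1))\<^sup>2 + (e j)\<^sup>2))"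
      using jumps[OF j] \<gamma> by (intro mult_mono) auto
    also have "\<dots> = 1 / (3 * real n) * ((e (j - 1))\<^sup>2 + (e j)\<^sup>2)"
      using n by (simp add: field_simps)
    finally show "\<bar>\<gamma>\<bar> * (1 / real n) * (norm (jump n (D w) j))\<^sup>2 \<le> 1 / (3 * real n) * ((e (j - 1))\<^sup>2 + (e j)\<^sup>2)" .
  qed
  also have "\<dots> = 1 / (3 * real n) * ((\<Sum>j\<in>{1..<n}. (e (j - 1))\<^sup>2) + (\<Sum>j\<in>{1..<n}. (e j)\<^sup>2))"
    by (simp only: sum_distrib_left[symmetric] sum.distrib)
  also have "\<dots> \<le> 1 / (3 * real n) * ((\<Sum>j<n. (e j)\<^sup>2) + (\<Sum>j<n. (e j)\<^sup>2))"
  proof (intro mult_left_mono add_mono)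
    have "(\<Sum>j\<in>{1..<n}. (e (j - 1))\<^sup>2) = (\<Sum>j<n - 1. (e j)\<^sup>2)"
      by (rule sum.reindex_bij_witness[of _ Suc "\<lambda>j. j - 1"]) auto
    also have "\<dots> \<le> (\<Sum>j<n. (e j)\<^sup>2)" by (rule sum_mono2) auto
    finally show "(\<Sum>j\<in>{1..<n}. (e (j - 1))\<^sup>2) \<le> (\<Sum>j<n. (e j)\<^sup>2)" .
    show "(\<Sum>j\<in>{1..<n}. (e j)\<^sup>2) \<le> (\<Sum>j<n. (e j)\<^sup>2)" by (rule sum_mono2) auto
  qed auto
  finally have J: "(\<Sum>j\<in>{1..<n}. \<bar>\<gamma>\<bar> * (1 / real n) * (norm (jump n (D w) j))\<^sup>2)
      \<le> 2 / 3 * ((\<Sum>j<n. (e j)\<^sup>2) / real n)" by simp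
  have "(norm_1h n \<gamma> w)\<^sup>2 = (L2_norm (D w))\<^sup>2 + (\<Sum>j\<in>{1..<n}. \<bar>\<gamma>\<bar> * (1 / real n) * (norm (jump n (D w) j))\<^sup>2)"
    unfolding norm_1h_def Let_def by (intro real_sqrt_pow2 add_nonneg_nonneg sum_nonneg) auto
  also have "\<dots> \<le> (\<Sum>j<n. (e j)\<^sup>2) / real n + 2 / 3 * ((\<Sum>j<n. (e j)\<^sup>2) / real n)"
    by (rule add_mono[OF L2 J])
  also have "\<dots> = 5 / 3 * ((\<Sum>j<n. (e j)\<^sup>2) / real n)" by simp
  finally show ?thesis unfolding w_def[abs_def] .
qed

text \<open>The local masses are not of order \<delta> individually, but the mean of their squares
  over the n elements is at most (L2_norm f / n)^2, and 1/n \<le> \<delta> since k \<ge> 1.\<close>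

lemma preasymptotic_error:
  fixes f u uh :: "real \<Rightarrow> complex" and k \<gamma> :: real and n :: nat
  assumes n: "n \<ge> 1" and k: "k \<ge> 1" and t: "k / real n \<le> 1"
    and \<gamma>: "\<gamma> \<noteq> 0" "\<bar>\<gamma>\<bar> \<le> 1 / 6"
    and f: "f \<in> L2" and u: "bvp_solution k f u" and sol: "cip_solution n \<gamma> k f uh"
  shows "norm_1h n \<gamma> (\<lambda>x. u x - uh x)
    \<le> 100 * ((k / real n + \<bar>real n * t_minus \<gamma> (k / real n) - k\<bar>) * L2_norm f)"
proof -
  define \<delta> where "\<delta> = k / real n + \<bar>real n * t_minus \<gamma> (k / real n) - k\<bar>"
  define N where "N = L2_norm f"
  have N0: "0 \<le> N" using L2_norm_squared(2)[OF f] by (simp add: N_def)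
  have \<delta>: "1 / real n \<le> \<delta>"
    using k n unfolding \<delta>_def by (intro add_increasing2 divide_right_mono) auto
  then have \<delta>0: "0 \<le> \<delta>" by (rule order_trans[rotated]) simp
  have k0: "0 < k" using k by simp
  obtain v where vc: "continuous_on {0..1} v"
    and ud: "\<And>x. x \<in> {0<..<1} \<Longrightarrow> (u has_vector_derivative v x) (at x)"
    and v: "\<And>x. x \<in> {0..1} \<Longrightarrow> v x = exact_derivative k f x"
    by (rule bvp_solution_derivative[OF k0 f u], (rule that; assumption))
  obtain w where w0: "\<And>j. 0 \<le> w j"
    and w2: "(\<Sum>j<n. (w j)\<^sup>2) \<le> 250 * real n * \<delta>\<^sup>2 * N\<^sup>2"
    and err: "\<And>j x. j < n \<Longrightarrow> x \<in> cell n j \<Longrightarrow>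
      norm (v x - of_nat n * (uh (node n (Suc j)) - uh (node n j)))
      \<le> 33 * \<delta> * N + 5 * mass_on f (node n j) (node n (Suc j)) + w j"
  proof (rule error_on_element[OF n k refl t \<gamma> f sol refl \<delta>_def v])
    fix w assume "\<And>j. 0 \<le> w j" "(\<Sum>j<n. (w j)\<^sup>2) \<le> 250 * real n * \<delta>\<^sup>2 * (L2_norm f)\<^sup>2"
      "\<And>j x. j < n \<Longrightarrow> x \<in> cell n j \<Longrightarrow>
      norm (v x - of_nat n * (uh (node n (Suc j)) - uh (node n j)))
      \<le> 33 * \<delta> * L2_norm f + 5 * mass_on f (node n j) (node n (Suc j)) + w j"
    then show thesis unfolding N_def[symmetric] by (rule that)
  qed
  define K where "K j = mass_on f (node n j) (node n (Suc j))" for j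
  have uhV: "uh \<in> V n" using sol by (simp add: cip_solution_def)
  have "(norm_1h n \<gamma> (\<lambda>x. u x - uh x))\<^sup>2 \<le> 5 / 3 * ((\<Sum>j<n. (33 * \<delta> * N + 5 * K j + w j)\<^sup>2) / real n)"
    by (rule norm_1h_le[OF n \<gamma>(2) uhV vc ud err[folded K_def]])
  also have "(\<Sum>j<n. (33 * \<delta> * N + 5 * K j + w j)\<^sup>2)
      \<le> (\<Sum>j<n. 3 * (33 * \<delta> * N)\<^sup>2 + 75 * (K j)\<^sup>2 + 3 * (w j)\<^sup>2)"
  proof (rule sum_mono)
    have "(x + y + z)\<^sup>2 \<le> 3 * x\<^sup>2 + 3 * y\<^sup>2 + 3 * z\<^sup>2" for x y z :: real
      using sum_squares_bound[of x y] sum_squares_bound[of x z] sum_squares_bound[of y z]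
      by (simp add: power2_eq_square algebra_simps)
    from this[of "33 * \<delta> * N" "5 * K _" "w _"]
    show "(33 * \<delta> * N + 5 * K j + w j)\<^sup>2 \<le> 3 * (33 * \<delta> * N)\<^sup>2 + 75 * (K j)\<^sup>2 + 3 * (w j)\<^sup>2" for j
      by (simp add: power_mult_distrib)
  qed
  also have "\<dots> = real n * (3 * (33 * \<delta> * N)\<^sup>2) + 75 * (\<Sum>j<n. (K j)\<^sup>2) + 3 * (\<Sum>j<n. (w j)\<^sup>2)"
    by (simp add: sum.distrib sum_distrib_left)
  also have "\<dots> \<le> real n * (3 * (33 * \<delta> * N)\<^sup>2) + 75 * (real n * (\<delta>\<^sup>2 * N\<^sup>2)) + 3 * (250 * real n * \<delta>\<^sup>2 * N\<^sup>2)"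
  proof (intro add_mono order_refl mult_left_mono w2)
    have "(\<Sum>j<n. (K j)\<^sup>2) \<le> N\<^sup>2 / real n"
      unfolding K_def N_def by (rule sum_mass_squared_le[OF f n])
    also have "\<dots> = real n * ((1 / real n)\<^sup>2 * N\<^sup>2)" using n by (simp add: power2_eq_square)
    also have "\<dots> \<le> real n * (\<delta>\<^sup>2 * N\<^sup>2)"
      using \<delta> by (intro mult_left_mono mult_right_mono power_mono) auto
    finally show "(\<Sum>j<n. (K j)\<^sup>2) \<le> real n * (\<delta>\<^sup>2 * N\<^sup>2)" .
  qed auto
  also have "\<dots> = 4092 * (\<delta> * N)\<^sup>2 * real n" by (simp add: power_mult_distrib algebra_simps)
  finally have "(norm_1h n \<gamma> (\<lambda>x. u x - uh x))\<^sup>2 \<le> 5 / 3 * (4092 * (\<delta> * N)\<^sup>2)"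
    using n by (simp add: divide_right_mono mult_left_mono)
  \<comment> \<open>5/3 times 4092 is 6820, below 100^2.\<close>
  also have "\<dots> \<le> (100 * (\<delta> * N))\<^sup>2" unfolding power_mult_distrib by simp
  finally show ?thesis
    unfolding \<delta>_def[symmetric] N_def[symmetric]
    by (rule power2_le_imp_le) (use \<delta>0 N0 in simp)
qed

theorem theorem6p2:
  fixes c :: real
  assumes "c > 0"
  shows "\<exists>C>0. \<forall>(k::real) (n::nat) (h::real) (t::real) (\<gamma>::real)
            (f :: real \<Rightarrow> complex) (u :: real \<Rightarrow> complex) (uh :: real \<Rightarrow> complex).
     k \<ge> 1 \<longrightarrow> n \<ge> 1 \<longrightarrow> h = 1 / real n \<longrightarrow> t = k * h \<longrightarrow> t \<le> 1 \<longrightarrow>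
     0 < \<bar>\<gamma>\<bar> \<longrightarrow> \<bar>\<gamma>\<bar> \<le> 1 / 6 \<longrightarrow>
     f \<in> L2 \<longrightarrow> bvp_solution k f u \<longrightarrow> cip_solution n \<gamma> k f uh \<longrightarrow>
       norm_1h n \<gamma> (\<lambda>x. u x - uh x) \<le> C * ((k * h + \<bar>k_minus \<gamma> k h - k\<bar>) * L2_norm f) \<and>
       (k * h + \<bar>k_minus \<gamma> k h - k\<bar>) * L2_norm f \<le> C * ((k * h + k ^ 3 * h ^ 2) * L2_norm f) \<and>
       (\<gamma> = - 1 / 12 \<longrightarrow>
          norm_1h n \<gamma> (\<lambda>x. u x - uh x) \<le> C * ((k * h + k ^ 5 * h ^ 4) * L2_norm f)) \<and>
       (\<bar>\<gamma> - gamma_o t\<bar> \<le> c * (1 / (k\<^sup>2 * h)) \<longrightarrow>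
          norm_1h n \<gamma> (\<lambda>x. u x - uh x) \<le> C * (k * h * L2_norm f))"
proof (intro exI[of _ "100 * (1 + c)"] conjI allI impI)
  \<comment> \<open>100 is the constant of \<open>preasymptotic_error\<close>. The factor 1 + c is
    forced by the last bound, where the phase error is at most c k h; in the others it is inserted
    by \<open>grow\<close>.\<close>
  show "100 * (1 + c) > 0" using assms by simp
  fix k h t \<gamma> :: real and n :: nat and f u uh :: "real \<Rightarrow> complex"
  assume k: "k \<ge> 1" and n: "n \<ge> 1" and h: "h = 1 / real n" and t: "t = k * h" "t \<le> 1"
    and \<gamma>: "0 < \<bar>\<gamma>\<bar>" "\<bar>\<gamma>\<bar> \<le> 1 / 6" and f: "f \<in> L2" and u: "bvp_solution k f u"
    and uh: "cip_solution n \<gamma> k f uh"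
  define N where "N = L2_norm f"
  define e where "e = \<bar>k_minus \<gamma> k h - k\<bar>"
  have N: "0 \<le> N" using L2_norm_squared(2)[OF f] by (simp add: N_def)
  have h0: "0 < h" using n by (simp add: h)
  have t0: "0 < t" using k h0 by (simp add: t)
  have \<gamma>0: "\<gamma> \<noteq> 0" using \<gamma> by auto
  have e_eq: "e = \<bar>t_minus \<gamma> t - t\<bar> / h"
  proof -
    have "k_minus \<gamma> k h - k = (t_minus \<gamma> t - t) / h" using h0 by (simp add: k_minus_def t field_simps)
    then show ?thesis using h0 by (simp add: e_def abs_divide)
  qed
  have e_le: "e \<le> d / h" if "\<bar>t_minus \<gamma> t - t\<bar> \<le> d" for d
    unfolding e_eq using that h0 by (simp add: divide_right_mono)
  have kh: "0 \<le> k * h" using t0 t by simp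
  have main: "norm_1h n \<gamma> (\<lambda>x. u x - uh x) \<le> 100 * ((k * h + e) * N)"
    using preasymptotic_error[OF n k _ \<gamma>0 \<gamma>(2) f u uh] t
    by (simp add: h e_def N_def k_minus_def mult.commute)
  have le: "X \<le> 100 * (1 + c) * (y * N)" if "X \<le> 100 * (z * N)" "z \<le> (1 + c) * y" for X y z
  proof -
    have "100 * (z * N) \<le> 100 * ((1 + c) * y * N)" using that N by (intro mult_left_mono mult_right_mono) auto
    then show ?thesis using that(1) by (simp add: mult_ac)
  qed
  have grow: "z \<le> (1 + c) * z" if "0 \<le> z" for z
    using assms that by (simp add: mult_le_cancel_right1)
  show "norm_1h n \<gamma> (\<lambda>x. u x - uh x) \<le> 100 * (1 + c) * ((k * h + \<bar>k_minus \<gamma> k h - k\<bar>) * L2_norm f)"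
    using le[OF main grow] kh by (simp add: e_def N_def)
  have e3: "e \<le> k ^ 3 * h\<^sup>2"
    using e_le[OF phase_error_cubic[OF t0 t(2) \<gamma>0 \<gamma>(2)]] h0
    by (simp add: t power_mult_distrib power2_eq_square power3_eq_cube mult_ac)
  \<comment> \<open>The second inequality does not involve the error norm; this trivial bound brings
    it into the shape that \<open>le\<close> expects.\<close>
  have e1: "(k * h + e) * N \<le> 100 * ((k * h + e) * N)" using N kh by (simp add: e_def)
  have e2: "k * h + e \<le> (1 + c) * (k * h + k ^ 3 * h\<^sup>2)"
    using e3 kh k by (intro order_trans[OF _ grow]) auto
  show "(k * h + \<bar>k_minus \<gamma> k h - k\<bar>) * L2_norm f
      \<le> 100 * (1 + c) * ((k * h + k ^ 3 * h\<^sup>2) * L2_norm f)"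
    using le[OF e1 e2] by (simp only: e_def N_def)
  show "norm_1h n \<gamma> (\<lambda>x. u x - uh x) \<le> 100 * (1 + c) * ((k * h + k ^ 5 * h ^ 4) * L2_norm f)"
    if g: "\<gamma> = - 1 / 12"
  proof -
    have "e \<le> k ^ 5 * h ^ 4"
      using e_le[OF phase_error_quintic[OF t0 t(2), folded g]] h0
      by (simp add: t power_mult_distrib eval_nat_numeral mult_ac)
    then have "k * h + e \<le> (1 + c) * (k * h + k ^ 5 * h ^ 4)"
      using kh k by (intro order_trans[OF _ grow]) auto
    from le[OF main this] show ?thesis by (simp add: N_def)
  qed
  show "norm_1h n \<gamma> (\<lambda>x. u x - uh x) \<le> 100 * (1 + c) * (k * h * L2_norm f)"
    if g: "\<bar>\<gamma> - gamma_o t\<bar> \<le> c * (1 / (k\<^sup>2 * h))"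
  proof -
    have "\<bar>\<gamma> - gamma_o t\<bar> * t ^ 3 \<le> c * (1 / (k\<^sup>2 * h)) * t ^ 3"
      using g t0 by (intro mult_right_mono) auto
    then have "\<bar>t_minus \<gamma> t - t\<bar> \<le> c * (1 / (k\<^sup>2 * h)) * t ^ 3"
      using phase_error_gamma_o[OF t0 t(2) \<gamma>0 \<gamma>(2)] by simp
    then have "e \<le> c * (1 / (k\<^sup>2 * h)) * t ^ 3 / h" by (rule e_le)
    also have "\<dots> = c * (k * h)"
      using h0 k by (simp add: t power_mult_distrib power2_eq_square power3_eq_cube)
    finally have "k * h + e \<le> (1 + c) * (k * h)" by (simp add: distrib_right)
    from le[OF main this] show ?thesis by (simp add: N_def)
  qed
qed

end
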